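(* Let $F : [0,\infty) \to [0,\infty)$ be a function, and consider the composition transform $C_F$ taking any function $\Lambda : X \to [0,\infty)$ to $C_F(\Lambda) := F \circ \Lambda : X \to [0,\infty)$. (1) $C_F$ preserves the class of Pólya frequency functions if and only if there exists $c > 0$ such that $F(x) = cx$ for all $x$. (2) $C_F$ preserves the class of Pólya frequency sequences if and only if either $F \equiv 0$ or there exists $c > 0$ such that $F \equiv c$ or $F(x) = cx$ for all $x$. (3) $C_F$ preserves the class of totally non-negative functions $\mathbb{R} \to \mathbb{R}$ if and only if $F \equiv 0$ or there exists $c > 0$ such that $F \equiv c$, or $F(x) = cx$ for all $x$, or $F(x) = c\,\mathbf{1}_{x > 0}$ for all $x$.
   Context: A function $\Lambda : \mathbb{R} \to \mathbb{R}$ is totally non-negative if for every $n \geq 1$ and all reals $x_1 < \cdots < x_n$, $y_1 < \cdots < y_n$ one has $\det(\Lambda(x_i - y_j))_{i,j=1}^n \geq 0$ (in particular $\Lambda \geq 0$). A Pólya frequency function is a totally non-negative function $\mathbb{R}\to\mathbb{R}$ that is Lebesgue integrable and non-zero at two or more points. A Pólya frequency sequence is a function $\Lambda : \mathbb{Z} \to \mathbb{R}$ such that the same determinants are non-negative for all integers $x_1 < \cdots < x_n$, $y_1 < \cdots < y_n$ and all $n \geq 1$. $C_F$ preserves a class if $F \circ \Lambda$ belongs to the class for every $\Lambda$ in the class. $\mathbf{1}_{x>0}$ equals $1$ if $x > 0$ and $0$ if $x = 0$. *)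

theory Defs
  imports "HOL-Analysis.Analysis" "Jordan_Normal_Form.Determinant"
begin

text \<open>
  The determinants have arbitrary size \<open>n\<close>, so they are taken over the matrices of
  \<^theory>\<open>Jordan_Normal_Form.Matrix\<close>. The points \<open>x\<^sub>1 < \<dots> < x\<^sub>n\<close> are \<open>x 0 < \<dots> < x (n - 1)\<close>;
  the values \<open>x k\<close> with \<open>k \<ge> n\<close> are irrelevant. The domain is \<^typ>\<open>real\<close> for functions
  on the line and \<^typ>\<open>int\<close> for sequences.
\<close>

definition totally_nonneg :: "('a::linordered_ab_group_add \<Rightarrow> real) \<Rightarrow> bool" where
  "totally_nonneg \<Lambda> \<longleftrightarrow>
    (\<forall>n\<ge>1. \<forall>x y :: nat \<Rightarrow> 'a.
      strict_mono_on {..<n} x \<longrightarrow> strict_mono_on {..<n} y \<longrightarrow>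
      Determinant.det (Matrix.mat n n (\<lambda>(i, j). \<Lambda> (x i - y j))) \<ge> 0)"

definition polya_frequency_function :: "(real \<Rightarrow> real) \<Rightarrow> bool" where
  "polya_frequency_function \<Lambda> \<longleftrightarrow>
    totally_nonneg \<Lambda> \<and> integrable lebesgue \<Lambda> \<and> (\<exists>s t. s \<noteq> t \<and> \<Lambda> s \<noteq> 0 \<and> \<Lambda> t \<noteq> 0)"

definition polya_frequency_sequence :: "(int \<Rightarrow> real) \<Rightarrow> bool" where
  "polya_frequency_sequence \<Lambda> \<longleftrightarrow> totally_nonneg \<Lambda>"

text \<open>
  The paper's \<open>F\<close> has domain \<open>[0, \<infinity>)\<close>. Here \<open>F\<close> is total on the reals, but its values at
  negative arguments play no role: members of the three classes are non-negative (the case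
  \<open>n = 1\<close> of total non-negativity).
\<close>

definition preserves :: "(real \<Rightarrow> real) \<Rightarrow> (('a \<Rightarrow> real) \<Rightarrow> bool) \<Rightarrow> bool" where
  "preserves F \<C> \<longleftrightarrow> (\<forall>\<Lambda>. \<C> \<Lambda> \<longrightarrow> \<C> (F \<circ> \<Lambda>))"

end

theory Submission
  imports Defs "HOL-Computational_Algebra.Fundamental_Theorem_Algebra" "HOL-Real_Asymp.Real_Asymp"
begin

text \<open>
  \<^emph>\<open>Necessity.\<close> All three classes reduce to one test: \<open>k \<mapsto> F (\<Lambda> (h * k))\<close> is totally
  non-negative on the integers for every Polya frequency function \<open>\<Lambda>\<close> and \<open>h > 0\<close>. If
  \<open>F 0 \<noteq> 0\<close>, minors of order 2 make \<open>F\<close> constant. Otherwise \<open>exp (- \<bar>x\<bar>)\<close> makes \<open>F\<close> monotone,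
  and a minor of order 3 of the one-sided exponentials \<open>c * exp (- x)\<close>, \<open>x \<ge> 0\<close>, whose starting
  value \<open>c\<close> is free, forces \<open>ln (F (exp u))\<close> to be affine, so \<open>F x = c * x powr \<alpha>\<close>. The function
  \<open>x * exp (- x)\<close>, \<open>x \<ge> 0\<close>, excludes \<open>0 < \<alpha> < 1\<close>, and a limit of minors of order 4 of
  \<open>exp (- a * \<bar>x\<bar>) * (1 + a - a * exp (- \<bar>x\<bar>))\<close> excludes \<open>\<alpha> > 1\<close>.

  \<^emph>\<open>Sufficiency.\<close> Only the indicator of the support is not immediate. It is totally non-negative
  because a totally non-negative function on the line with at least two nonzero values has
  unbounded support. Otherwise its samples at mesh \<open>h\<close> would be the coefficients of polynomials of
  degree \<open>O(1 / h)\<close>, which have only real roots, and Newton's inequalities for them fail as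
  \<open>h\<close> tends to 0.
\<close>

section \<open>Determinants and totally non-negative functions\<close>

text \<open>Convolutions enter without an integral formula for determinants: a combination of
  neighbouring columns is shown to lie in the cone of translates of a kernel already known to be
  totally non-negative, and multilinearity does the rest. The one-sided tests cannot exclude
  integers \<alpha> > 1: for these, \<open>x ^ \<alpha> * exp (- \<alpha> * x)\<close> on x \<ge> 0
  is a multiple of a repeated convolution of exponentials and so stays totally non-negative. Hence
  the kernel with two different decay rates. Nothing is assumed about the regularity of
  \<open>F\<close>, so the proof that \<open>F\<close> is a power works with finite differences at
  dyadic meshes instead of derivatives. Real-rootedness is the finite case of one direction of the
  theorem of Aissen, Schoenberg and Whitney. A nonreal root would give a sequence annihilated by the
  coefficients whose sign changes are too rare for the positive minors available. Lines and integers
  differ only in the support indicator: finite supports with several points occur on the integers,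
  but not for functions on the line.\<close>

lemma det_column_expansion:
  fixes v :: "nat \<Rightarrow> nat \<Rightarrow> real"
  assumes "m < n"
  obtains c where "\<And>z. Determinant.det (Matrix.mat n n (\<lambda>(i, j). if j = m then z i else v j i)) = (\<Sum>i<n. c i * z i)"
proof -
  let ?A = "\<lambda>z. Matrix.mat n n (\<lambda>(i, j). if j = m then z i else v j i :: real)"
  define c where "c i = cofactor (?A (\<lambda>_. 0)) i m" for i
  have "Determinant.det (?A z) = (\<Sum>i<n. c i * z i)" for z
  proof -
    have "Determinant.det (?A z) = (\<Sum>i<n. ?A z $$ (i, m) * cofactor (?A z) i m)"
      by (rule laplace_expansion_column) (use assms in auto)
    also have "\<dots> = (\<Sum>i<n. c i * z i)"
    proof (rule sum.cong[OF refl])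
      fix i assume i: "i \<in> {..<n}"
      have "mat_delete (?A z) i m = mat_delete (?A (\<lambda>_. 0)) i m"
        by (rule eq_matI) (use assms i in \<open>auto simp: mat_delete_def\<close>)
      then show "?A z $$ (i, m) * cofactor (?A z) i m = c i * z i"
        using i assms by (simp add: c_def cofactor_def)
    qed
    finally show ?thesis .
  qed
  then show ?thesis by (rule that)
qed

text \<open>Hypothesis \<open>dom\<close> says that \<open>u j\<close> and \<open>w j - u j\<close> lie in the bidual cone of \<open>C j\<close>, so that
  columns may be mixed by sums and integrals alike.\<close>

lemma det_columns_mono:
  fixes C :: "nat \<Rightarrow> (nat \<Rightarrow> real) set" and u w :: "nat \<Rightarrow> nat \<Rightarrow> real"
  assumes nonneg: "\<And>v. (\<And>j. j < n \<Longrightarrow> v j \<in> C j) \<Longrightarrow> 0 \<le> Determinant.det (Matrix.mat n n (\<lambda>(i, j). v j i))"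
    and dom: "\<And>j c. j < n \<Longrightarrow> (\<And>z. z \<in> C j \<Longrightarrow> 0 \<le> (\<Sum>i<n. c i * z i)) \<Longrightarrow>
      0 \<le> (\<Sum>i<n. c i * u j i) \<and> (\<Sum>i<n. c i * u j i) \<le> (\<Sum>i<n. c i * w j i)"
  shows "0 \<le> Determinant.det (Matrix.mat n n (\<lambda>(i, j). u j i))"
    and "Determinant.det (Matrix.mat n n (\<lambda>(i, j). u j i)) \<le> Determinant.det (Matrix.mat n n (\<lambda>(i, j). w j i))"
proof -
  define D where "D v = Determinant.det (Matrix.mat n n (\<lambda>(i, j). v j i :: real))" for v :: "nat \<Rightarrow> nat \<Rightarrow> real"
  define mix where "mix m a v = (\<lambda>j. if j < m then a j else v j)"
    for m and a v :: "nat \<Rightarrow> nat \<Rightarrow> real"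
  have D_cong: "D v = D v'" if "\<And>j. j < n \<Longrightarrow> v j = v' j" for v v'
    unfolding D_def by (rule arg_cong[where f = Determinant.det]) (auto intro!: eq_matI simp: that)
  have expand: "\<exists>c. \<forall>z. D (v(m := z)) = (\<Sum>i<n. c i * z i)" if m: "m < n" for m v
  proof -
    obtain c where c: "\<And>z. Determinant.det (Matrix.mat n n (\<lambda>(i, j). if j = m then z i else v j i)) = (\<Sum>i<n. c i * z i)"
      using det_column_expansion[OF m] by blast
    have "D (v(m := z)) = (\<Sum>i<n. c i * z i)" for z
      unfolding c[symmetric] D_def
      by (rule arg_cong[where f = Determinant.det]) (auto intro!: eq_matI)
    then show ?thesis by blast
  qed
  have main: "0 \<le> D (mix m u v) \<and> D (mix m u v) \<le> D (mix m w v)"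
    if "m \<le> n" "\<And>j. m \<le> j \<Longrightarrow> j < n \<Longrightarrow> v j \<in> C j" for m v
    using that
  proof (induction m arbitrary: v)
    case 0
    then show ?case using nonneg[of v] by (simp add: mix_def D_def)
  next
    case (Suc m)
    have m: "m < n" using Suc.prems by simp
    have IH: "0 \<le> D (mix m u (v(m := z))) \<and> D (mix m u (v(m := z))) \<le> D (mix m w (v(m := z)))"
      if "z \<in> C m" for z
      by (rule Suc.IH) (use Suc.prems that m in auto)
    have upd: "mix m a (v(m := z)) = (mix m a v)(m := z)" for a z
      by (auto simp: mix_def fun_eq_iff)
    have step: "mix (Suc m) a v = (mix m a v)(m := a m)" for a
      by (auto simp: mix_def fun_eq_iff less_Suc_eq)
    obtain cu where cu: "\<And>z. D ((mix m u v)(m := z)) = (\<Sum>i<n. cu i * z i)" using expand[OF m] by blast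
    obtain cw where cw: "\<And>z. D ((mix m w v)(m := z)) = (\<Sum>i<n. cw i * z i)" using expand[OF m] by blast
    have a1: "0 \<le> (\<Sum>i<n. cu i * u m i)"
      using dom[OF m, of cu] IH by (simp add: upd cu)
    have a2: "(\<Sum>i<n. cw i * u m i) \<le> (\<Sum>i<n. cw i * w m i)"
      using dom[OF m, of cw] IH by (fastforce simp: upd cu cw)
    \<comment> \<open>By the induction hypothesis \<open>cw - cu\<close> is non-negative on
      \<open>C m\<close>, so \<open>dom\<close> applies to this functional as well: the columns
      before \<open>m\<close> are enlarged with column \<open>m\<close> still equal to
      \<open>u m\<close>.\<close>
    have "0 \<le> (\<Sum>i<n. (cw i - cu i) * u m i)"
      using dom[OF m, of "\<lambda>i. cw i - cu i"] IH
      by (simp add: upd cu cw left_diff_distrib sum_subtractf)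
    then have a3: "(\<Sum>i<n. cu i * u m i) \<le> (\<Sum>i<n. cw i * u m i)"
      by (simp add: left_diff_distrib sum_subtractf)
    show ?case unfolding step cu cw using a1 a2 a3 by linarith
  qed
  have u: "D (mix n u u) = D u" by (rule D_cong) (simp add: mix_def)
  have w: "D (mix n w u) = D w" by (rule D_cong) (simp add: mix_def)
  show "0 \<le> Determinant.det (Matrix.mat n n (\<lambda>(i, j). u j i))"
    using main[of n u] unfolding D_def[symmetric] by (simp add: u)
  show "Determinant.det (Matrix.mat n n (\<lambda>(i, j). u j i)) \<le> Determinant.det (Matrix.mat n n (\<lambda>(i, j). w j i))"
    using main[of n u] unfolding D_def[symmetric] by (simp add: u w)
qed

lemma det_eq_prod_diag:
  fixes A :: "'a::comm_ring_1 mat"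
  assumes A: "A \<in> carrier_mat n n"
    and "\<And>p. p permutes {0..<n} \<Longrightarrow> p \<noteq> id \<Longrightarrow> \<exists>i<n. A $$ (i, p i) = 0"
  shows "Determinant.det A = (\<Prod>i=0..<n. A $$ (i, i))"
proof -
  have "Determinant.det A = (\<Sum>p\<in>{p. p permutes {0..<n}}. signof p * (\<Prod>i=0..<n. A $$ (i, p i)))"
    by (rule det_def'[OF A])
  also have "\<dots> = (\<Sum>p\<in>{id}. signof p * (\<Prod>i=0..<n. A $$ (i, p i)))"
  proof (rule sum.mono_neutral_right)
    show "\<forall>p\<in>{p. p permutes {0..<n}} - {id}. signof p * (\<Prod>i=0..<n. A $$ (i, p i)) = 0"
    proof
      fix p assume "p \<in> {p. p permutes {0..<n}} - {id}"
      then obtain i where "i < n" "A $$ (i, p i) = 0" using assms(2) by blast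
      then have "(\<Prod>i=0..<n. A $$ (i, p i)) = 0" by (intro prod_zero) auto
      then show "signof p * (\<Prod>i=0..<n. A $$ (i, p i)) = 0" by simp
    qed
  qed (auto simp: finite_permutations permutes_id)
  finally show ?thesis by (simp add: sign_id)
qed

lemma totally_nonnegD:
  assumes "totally_nonneg \<Lambda>" "strict_mono_on {..<n} x" "strict_mono_on {..<n} y"
  shows "0 \<le> Determinant.det (Matrix.mat n n (\<lambda>(i, j). \<Lambda> (x i - y j)))"
  using assms by (cases n) (auto simp: totally_nonneg_def)

lemma strict_mono_on_lessThan_Suc:
  fixes y :: "nat \<Rightarrow> 'a::order"
  assumes "\<And>j. Suc j < n \<Longrightarrow> y j < y (Suc j)"
  shows "strict_mono_on {..<n} y"
proof -
  have "y i < y (i + Suc k)" if "i + Suc k < n" for i k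
    using that
  proof (induction k)
    case 0 then show ?case using assms by simp
  next
    case (Suc k)
    then have "y i < y (i + Suc k)" by simp
    also have "\<dots> < y (i + Suc (Suc k))" using assms[of "i + Suc k"] Suc.prems by simp
    finally show ?case .
  qed
  then show ?thesis
    by (auto simp: strict_mono_on_def) (metis less_iff_Suc_add add_Suc_right)
qed

text \<open>A permutation \<open>q\<close> that meets no zero entry satisfies
  \<open>y (q i) = x i - p\<close>, so it is increasing and equals the identity. The determinant is
  therefore the product of the diagonal.\<close>

lemma totally_nonneg_single:
  fixes p :: "'a::linordered_ab_group_add"
  shows "totally_nonneg (\<lambda>x. if x = p then 1 else 0)"
  unfolding totally_nonneg_def
proof (intro allI impI)
  fix n :: nat and x y :: "nat \<Rightarrow> 'a"
  assume x: "strict_mono_on {..<n} x" and y: "strict_mono_on {..<n} y"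
  let ?A = "Matrix.mat n n (\<lambda>(i, j). if x i - y j = p then 1 else 0) :: real mat"
  have "Determinant.det ?A = (\<Prod>i=0..<n. ?A $$ (i, i))"
  proof (rule det_eq_prod_diag)
    fix q assume q: "q permutes {0..<n}" "q \<noteq> id"
    have "\<not> (\<forall>i<n. x i - y (q i) = p)"
    proof
      assume *: "\<forall>i<n. x i - y (q i) = p"
      have lt: "q i < n" if "i < n" for i using permutes_in_image[OF q(1)] that by auto
      have mono: "q i < q j" if "i < j" "j < n" for i j
      proof (rule ccontr)
        assume "\<not> q i < q j"
        then have "y (q j) \<le> y (q i)"
          using strict_mono_onD[OF y, of "q j" "q i"] lt[of i] lt[of j] that
          by (cases "q i = q j") (auto simp: less_le)
        moreover have "x i < x j" using x that by (auto simp: strict_mono_on_def)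
        moreover have "x i - y (q i) = x j - y (q j)" using * that by auto
        ultimately show False
          using diff_left_mono[of "y (q j)" "y (q i)" "x i"] diff_strict_right_mono[of "x i" "x j" "y (q j)"]
          by simp
      qed
      have "i \<le> q i" if "i < n" for i
        using that
      proof (induction i)
        case (Suc i)
        then show ?case using mono[of i "Suc i"] by force
      qed simp
      then have "q = id" by (intro permutes_natset_ge[OF q(1)]) auto
      then show False using q by simp
    qed
    then obtain i where "i < n" "x i - y (q i) \<noteq> p" by auto
    moreover have "q i < n" using permutes_in_image[OF q(1), of i] \<open>i < n\<close> by auto
    ultimately show "\<exists>i<n. ?A $$ (i, q i) = 0" by auto
  qed auto
  also have "\<dots> \<ge> 0" by (intro prod_nonneg) auto
  finally show "0 \<le> Determinant.det ?A" .
qed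

text \<open>Subtracting from each column \<open>t\<close> times the next one is multiplication by a unit triangular
  matrix. Since \<open>U\<close> is closed upwards, the columns so obtained are mixtures of \<open>a (x - z)\<close> over
  sets of \<open>z\<close> that increase strictly from one column to the next.\<close>

lemma totally_nonneg_causal:
  fixes a f :: "'a::linordered_ab_group_add \<Rightarrow> real" and U :: "'a set"
  assumes a: "totally_nonneg a"
    and U: "\<And>x y. x \<in> U \<Longrightarrow> x \<le> y \<Longrightarrow> y \<in> U"
    and step: "\<And>n (x :: nat \<Rightarrow> 'a) c y y'. strict_mono_on {..<n} x \<Longrightarrow> y < y' \<Longrightarrow>
      (\<And>z. z - y \<in> U \<Longrightarrow> z - y' \<notin> U \<Longrightarrow> 0 \<le> (\<Sum>i<n. c i * a (x i - z))) \<Longrightarrow>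
      0 \<le> (\<Sum>i<n. c i * (f (x i - y) - t y y' * f (x i - y')))"
    and last: "\<And>n (x :: nat \<Rightarrow> 'a) c y. strict_mono_on {..<n} x \<Longrightarrow>
      (\<And>z. z - y \<in> U \<Longrightarrow> 0 \<le> (\<Sum>i<n. c i * a (x i - z))) \<Longrightarrow>
      0 \<le> (\<Sum>i<n. c i * f (x i - y))"
  shows "totally_nonneg f"
  unfolding totally_nonneg_def
proof (intro allI impI)
  fix n :: nat and x y :: "nat \<Rightarrow> 'a"
  assume n: "1 \<le> n" and x: "strict_mono_on {..<n} x" and y: "strict_mono_on {..<n} y"
  define Z where "Z j = (if Suc j < n then {z. z - y j \<in> U \<and> z - y (Suc j) \<notin> U} else {z. z - y j \<in> U})" for j
  define g where "g j i = (if Suc j < n then f (x i - y j) - t (y j) (y (Suc j)) * f (x i - y (Suc j)) else f (x i - y j))" for i j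
  let ?F = "Matrix.mat n n (\<lambda>(i, j). f (x i - y j))"
  let ?E = "Matrix.mat n n (\<lambda>(i, j). if i = j then 1 else if i = Suc j then - t (y j) (y (Suc j)) else 0)"
  let ?G = "Matrix.mat n n (\<lambda>(i, j). g j i)"
  have "?G = ?F * ?E"
  proof (rule eq_matI)
    fix i j assume ij: "i < dim_row (?F * ?E)" "j < dim_col (?F * ?E)"
    then have i: "i < n" and j: "j < n" by auto
    have "(?F * ?E) $$ (i, j) = (\<Sum>k\<in>{0..<n}. f (x i - y k) *
        (if k = j then 1 else if k = Suc j then - t (y j) (y (Suc j)) else 0))"
      using i j by (simp add: scalar_prod_def)
    also have "\<dots> = (\<Sum>k\<in>{0..<n}. (if k = j then f (x i - y k) else 0) +
        (if k = Suc j then - t (y j) (y (Suc j)) * f (x i - y k) else 0))"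
      by (intro sum.cong) auto
    also have "\<dots> = g j i"
      using j unfolding sum.distrib by (simp add: g_def sum.delta)
    finally show "?G $$ (i, j) = (?F * ?E) $$ (i, j)" using i j by simp
  qed auto
  moreover have "Determinant.det ?E = 1"
  proof -
    have "Determinant.det ?E = prod_list (diag_mat ?E)"
      by (rule det_lower_triangular[of n]) auto
    also have "\<dots> = 1" by (simp add: prod_list_diag_prod)
    finally show ?thesis .
  qed
  ultimately have FG: "Determinant.det ?F = Determinant.det ?G"
    by (simp add: det_mult[of _ n])
  have "0 \<le> Determinant.det ?G"
  proof (rule det_columns_mono(1)[where C = "\<lambda>j. {\<lambda>i. a (x i - z) | z. z \<in> Z j}" and w = g])
    fix v assume "\<And>j. j < n \<Longrightarrow> v j \<in> {\<lambda>i. a (x i - z) | z. z \<in> Z j}"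
    then have "\<forall>j. \<exists>z. j < n \<longrightarrow> z \<in> Z j \<and> v j = (\<lambda>i. a (x i - z))" by blast
    then obtain z where z: "\<And>j. j < n \<Longrightarrow> z j \<in> Z j \<and> v j = (\<lambda>i. a (x i - z j))" by metis
    have "strict_mono_on {..<n} z"
    proof (rule strict_mono_on_lessThan_Suc)
      fix j assume j: "Suc j < n"
      then have "z j - y (Suc j) \<notin> U" "z (Suc j) - y (Suc j) \<in> U"
        using z[of j] z[of "Suc j"] by (auto simp: Z_def split: if_splits)
      then have "\<not> z (Suc j) - y (Suc j) \<le> z j - y (Suc j)" using U by blast
      then show "z j < z (Suc j)" by (metis diff_right_mono not_le)
    qed
    from totally_nonnegD[OF a x this]
    have "0 \<le> Determinant.det (Matrix.mat n n (\<lambda>(i, j). a (x i - z j)))" .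
    also have "Matrix.mat n n (\<lambda>(i, j). a (x i - z j)) = Matrix.mat n n (\<lambda>(i, j). v j i)"
      using z by (intro eq_matI) auto
    finally show "0 \<le> Determinant.det (Matrix.mat n n (\<lambda>(i, j). v j i))" .
  next
    fix j c assume j: "j < n" and c: "\<And>v. v \<in> {\<lambda>i. a (x i - z) | z. z \<in> Z j} \<Longrightarrow> 0 \<le> (\<Sum>i<n. c i * v i)"
    have c': "0 \<le> (\<Sum>i<n. c i * a (x i - z))" if "z \<in> Z j" for z using c that by blast
    have "0 \<le> (\<Sum>i<n. c i * g j i)"
    proof (cases "Suc j < n")
      case True
      have "y j < y (Suc j)" using y True by (auto simp: strict_mono_on_def)
      then show ?thesis using step[OF x, of "y j" "y (Suc j)" c] c' True by (simp add: g_def Z_def)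
    next
      case False
      then show ?thesis using last[OF x, of "y j" c] c' by (simp add: g_def Z_def)
    qed
    then show "0 \<le> (\<Sum>i<n. c i * g j i) \<and> (\<Sum>i<n. c i * g j i) \<le> (\<Sum>i<n. c i * g j i)" by simp
  qed
  then show "0 \<le> Determinant.det ?F" by (simp add: FG)
qed

section \<open>Closure properties and convolution with one-sided exponentials\<close>

lemma totally_nonneg_nonneg:
  assumes "totally_nonneg \<Lambda>"
  shows "0 \<le> \<Lambda> x"
proof -
  have "strict_mono_on {..<1::nat} (\<lambda>_. u)" for u :: 'a
    by (auto simp: strict_mono_on_def)
  from totally_nonnegD[OF assms this this, of x 0] show ?thesis
    by (simp add: det_single)
qed

lemma totally_nonneg_twist:
  assumes a: "totally_nonneg a" and pos: "\<And>x. 0 \<le> \<alpha> x" "\<And>y. 0 \<le> \<beta> y"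
    and b: "\<And>x y. b (x - y) = \<alpha> x * \<beta> y * a (x - y)"
  shows "totally_nonneg b"
  unfolding totally_nonneg_def
proof (intro allI impI)
  fix n :: nat and x y :: "nat \<Rightarrow> 'a"
  assume x: "strict_mono_on {..<n} x" and y: "strict_mono_on {..<n} y"
  let ?A = "Matrix.mat n n (\<lambda>(i, j). a (x i - y j))"
  let ?B = "Matrix.mat n n (\<lambda>(i, j). b (x i - y j))"
  let ?P = "{p. p permutes {0..<n}}"
  have "Determinant.det ?B = (\<Sum>p\<in>?P. signof p * (\<Prod>i=0..<n. ?B $$ (i, p i)))"
    by (rule det_def') auto
  also have "\<dots> = (\<Sum>p\<in>?P. (\<Prod>i=0..<n. \<alpha> (x i)) * (\<Prod>i=0..<n. \<beta> (y i)) *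
      (signof p * (\<Prod>i=0..<n. ?A $$ (i, p i))))"
  proof (rule sum.cong[OF refl])
    fix p assume "p \<in> ?P"
    then have p: "p permutes {0..<n}" by simp
    have "(\<Prod>i=0..<n. ?B $$ (i, p i)) = (\<Prod>i=0..<n. \<alpha> (x i) * \<beta> (y (p i)) * ?A $$ (i, p i))"
      using permutes_in_image[OF p] by (intro prod.cong) (auto simp: b)
    also have "\<dots> = (\<Prod>i=0..<n. \<alpha> (x i)) * (\<Prod>i=0..<n. \<beta> (y (p i))) * (\<Prod>i=0..<n. ?A $$ (i, p i))"
      by (simp add: prod.distrib)
    also have "(\<Prod>i=0..<n. \<beta> (y (p i))) = (\<Prod>i=0..<n. \<beta> (y i))"
      using prod.permute[OF p, of "\<lambda>i. \<beta> (y i)"] by (simp add: o_def)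
    finally show "signof p * (\<Prod>i=0..<n. ?B $$ (i, p i)) =
        (\<Prod>i=0..<n. \<alpha> (x i)) * (\<Prod>i=0..<n. \<beta> (y i)) * (signof p * (\<Prod>i=0..<n. ?A $$ (i, p i)))"
      by simp
  qed
  also have "\<dots> = (\<Prod>i=0..<n. \<alpha> (x i)) * (\<Prod>i=0..<n. \<beta> (y i)) * Determinant.det ?A"
    by (subst det_def'[of ?A n]) (auto simp: sum_distrib_left)
  also have "\<dots> \<ge> 0"
    by (intro mult_nonneg_nonneg prod_nonneg totally_nonnegD[OF a x y]) (auto simp: pos)
  finally show "0 \<le> Determinant.det ?B" .
qed

lemma totally_nonneg_cmult:
  assumes "totally_nonneg a" "0 \<le> c"
  shows "totally_nonneg (\<lambda>x. c * a x)"
  by (rule totally_nonneg_twist[where \<alpha> = "\<lambda>_. c" and \<beta> = "\<lambda>_. 1"]) (use assms in auto)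

lemma totally_nonneg_exp_mult_int:
  fixes a :: "int \<Rightarrow> real"
  assumes "totally_nonneg a"
  shows "totally_nonneg (\<lambda>k. exp (s * k) * a k)"
  by (rule totally_nonneg_twist[OF assms, where \<alpha> = "\<lambda>x. exp (s * x)" and \<beta> = "\<lambda>y. exp (- s * y)"])
    (auto simp: exp_add[symmetric] algebra_simps)

text \<open>Two maps instead of one, so that a translation of the argument can be absorbed into one
  of them.\<close>

lemma totally_nonneg_transfer:
  fixes a :: "'a::linordered_ab_group_add \<Rightarrow> real" and b :: "'b::linordered_ab_group_add \<Rightarrow> real"
  assumes a: "totally_nonneg a" and "strict_mono \<phi>" "strict_mono \<psi>"
    and b: "\<And>x y. b (x - y) = a (\<phi> x - \<psi> y)"
  shows "totally_nonneg b"
  unfolding totally_nonneg_def b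
proof (intro allI impI)
  fix n :: nat and x y :: "nat \<Rightarrow> 'b"
  assume "strict_mono_on {..<n} x" "strict_mono_on {..<n} y"
  then have "strict_mono_on {..<n} (\<lambda>i. \<phi> (x i))" "strict_mono_on {..<n} (\<lambda>i. \<psi> (y i))"
    using assms by (auto simp: strict_mono_on_def strict_mono_def)
  then show "0 \<le> Determinant.det (Matrix.mat n n (\<lambda>(i, j). a (\<phi> (x i) - \<psi> (y j))))"
    by (rule totally_nonnegD[OF a])
qed

lemma totally_nonneg_sample:
  fixes a :: "real \<Rightarrow> real"
  assumes "totally_nonneg a" "0 < h"
  shows "totally_nonneg (\<lambda>k::int. a (t + h * k))"
  by (rule totally_nonneg_transfer[OF assms(1), where \<phi> = "\<lambda>k. t + h * real_of_int k" and \<psi> = "\<lambda>k. h * real_of_int k"])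
    (use assms(2) in \<open>auto simp: strict_mono_def algebra_simps\<close>)

lemma totally_nonneg_reflect:
  assumes a: "totally_nonneg a"
  shows "totally_nonneg (\<lambda>x. a (- x))"
  unfolding totally_nonneg_def
proof (intro allI impI)
  fix n :: nat and x y :: "nat \<Rightarrow> 'a"
  assume x: "strict_mono_on {..<n} x" and y: "strict_mono_on {..<n} y"
  let ?A = "Matrix.mat n n (\<lambda>(i, j). a (y i - x j))"
  have "Matrix.mat n n (\<lambda>(i, j). a (- (x i - y j))) = transpose_mat ?A"
    by (intro eq_matI) auto
  then show "0 \<le> Determinant.det (Matrix.mat n n (\<lambda>(i, j). a (- (x i - y j))))"
    using totally_nonnegD[OF a y x] det_transpose[of ?A n] by simp
qed

text \<open>Subtracting \<open>exp (- l * (y' - y))\<close> times the column at \<open>y'\<close>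
  cancels the exponential wherever \<open>x - y'\<close> lies in \<open>U\<close> and leaves
  positive multiples of point masses. Open rays, closed rays and the whole line are all covered;
  with \<open>l = 0\<close> they give the support indicators.\<close>

lemma totally_nonneg_exp_upset:
  fixes U :: "real set"
  assumes U: "\<And>x y. x \<in> U \<Longrightarrow> x \<le> y \<Longrightarrow> y \<in> U"
  shows "totally_nonneg (\<lambda>x. if x \<in> U then exp (- l * x) else 0)"
proof (rule totally_nonneg_causal[OF totally_nonneg_single[where p = 0] U, where t = "\<lambda>y y'. exp (- l * (y' - y))"])
  have single: "(\<Sum>k<n. c k * (if x k - x i = 0 then 1 else 0)) = c i"
    if "strict_mono_on {..<n} x" "i < n" for n i and x c :: "nat \<Rightarrow> real"
  proof -
    have "(\<Sum>k<n. c k * (if x k - x i = 0 then 1 else 0)) = (\<Sum>k<n. if k = i then c k else 0)"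
      using strict_mono_on_imp_inj_on[OF that(1)] that(2)
      by (intro sum.cong) (auto simp: inj_on_def)
    then show ?thesis using that(2) by simp
  qed
  {
    fix n :: nat and x c :: "nat \<Rightarrow> real" and y y' :: real
    assume x: "strict_mono_on {..<n} x" and yy: "y < y'"
      and H: "\<And>z. z - y \<in> U \<Longrightarrow> z - y' \<notin> U \<Longrightarrow> 0 \<le> (\<Sum>i<n. c i * (if x i - z = 0 then 1 else 0))"
    show "0 \<le> (\<Sum>i<n. c i * ((if x i - y \<in> U then exp (- l * (x i - y)) else 0) -
        exp (- l * (y' - y)) * (if x i - y' \<in> U then exp (- l * (x i - y')) else 0)))"
    proof (rule sum_nonneg)
      fix i assume i: "i \<in> {..<n}"
      consider "x i - y' \<in> U" "x i - y \<in> U" | "x i - y' \<notin> U" "x i - y \<in> U" | "x i - y' \<notin> U" "x i - y \<notin> U"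
        using U[of "x i - y'" "x i - y"] yy by fastforce
      then show "0 \<le> c i * ((if x i - y \<in> U then exp (- l * (x i - y)) else 0) -
          exp (- l * (y' - y)) * (if x i - y' \<in> U then exp (- l * (x i - y')) else 0))"
      proof cases
        case 1
        then show ?thesis by (simp add: exp_add[symmetric] algebra_simps)
      next
        case 2
        then have "0 \<le> c i" using H[of "x i"] single[OF x, of i c] i by simp
        with 2 show ?thesis by simp
      qed simp
    qed
  }
  fix n :: nat and x c :: "nat \<Rightarrow> real" and y :: real
  assume x: "strict_mono_on {..<n} x"
    and H: "\<And>z. z - y \<in> U \<Longrightarrow> 0 \<le> (\<Sum>i<n. c i * (if x i - z = 0 then 1 else 0))"
  show "0 \<le> (\<Sum>i<n. c i * (if x i - y \<in> U then exp (- l * (x i - y)) else 0))"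
  proof (rule sum_nonneg)
    fix i assume i: "i \<in> {..<n}"
    show "0 \<le> c i * (if x i - y \<in> U then exp (- l * (x i - y)) else 0)"
      using H[of "x i"] single[OF x, of i c] i by simp
  qed
qed

text \<open>Here \<open>f\<close> is the convolution of \<open>a\<close> with \<open>exp (- l * x)\<close> on \<open>x \<ge> 0\<close>, described by its
  differential equation instead of an integral.\<close>

lemma totally_nonneg_resolvent:
  fixes a f :: "real \<Rightarrow> real"
  assumes a: "totally_nonneg a" and l: "0 < l" and D: "finite D"
    and cont: "continuous_on UNIV f" and bdd: "\<And>x. \<bar>f x\<bar> \<le> M"
    and deriv: "\<And>x. x \<notin> D \<Longrightarrow> (f has_real_derivative a x - l * f x) (at x)"
  shows "totally_nonneg f"
proof (rule totally_nonneg_causal[OF a, where U = "{0..}" and t = "\<lambda>y y'. exp (- l * (y' - y))"])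
  have cont': "continuous_on S (\<lambda>z. f (g z))" if "continuous_on S g" for S and g :: "real \<Rightarrow> real"
    using continuous_on_compose2[OF cont that] by simp
  \<comment> \<open>In \<open>z\<close>, the derivative of \<open>exp (- l * z) * f (x - z)\<close>
    is \<open>- exp (- l * z) * a (x - z)\<close>. The weighted functional therefore decreases on
    intervals where \<open>c\<close> is non-negative on the translates of \<open>a\<close>.\<close>
  have decr: "exp (- l * y') * (\<Sum>i<n. c i * f (x i - y')) \<le> exp (- l * y) * (\<Sum>i<n. c i * f (x i - y))"
    if yy: "y \<le> y'" and H: "\<And>z. y < z \<Longrightarrow> z < y' \<Longrightarrow> 0 \<le> (\<Sum>i<n. c i * a (x i - z))"
    for n and x c :: "nat \<Rightarrow> real" and y y'
  proof -
    define G where "G z = - (exp (- l * z) * (\<Sum>i<n. c i * f (x i - z)))" for z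
    define S where "S = (\<Union>i<n. (\<lambda>d. x i - d) ` D)"
    have "finite S" using D by (simp add: S_def)
    have "((\<lambda>z. exp (- l * z) * (\<Sum>i<n. c i * a (x i - z))) has_integral (G y' - G y)) {y..y'}"
    proof (rule fundamental_theorem_of_calculus_interior_strong[OF \<open>finite S\<close> yy])
      fix z assume z: "z \<in> {y<..<y'} - S"
      have d: "((\<lambda>z. f (x i - z)) has_real_derivative - (a (x i - z) - l * f (x i - z))) (at z)" if "i < n" for i
      proof -
        have "x i - z \<notin> D"
        proof
          assume "x i - z \<in> D"
          then have "x i - (x i - z) \<in> S" using that unfolding S_def by blast
          then show False using z by simp
        qed
        moreover have "((\<lambda>z. x i - z) has_real_derivative - 1) (at z)"
          by (auto intro!: derivative_eq_intros)
        ultimately show ?thesis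
          using DERIV_chain2[of f _ "\<lambda>z. x i - z" z "-1" UNIV] deriv by fastforce
      qed
      have dS: "((\<lambda>z. \<Sum>i<n. c i * f (x i - z)) has_real_derivative
          (\<Sum>i<n. c i * (- (a (x i - z) - l * f (x i - z))))) (at z)"
        by (intro DERIV_sum DERIV_cmult d) simp
      have dE: "((\<lambda>z. exp (- l * z)) has_real_derivative (- l) * exp (- l * z)) (at z)"
        by (auto intro!: derivative_eq_intros)
      have "(G has_real_derivative - ((- l) * exp (- l * z) * (\<Sum>i<n. c i * f (x i - z)) +
          exp (- l * z) * (\<Sum>i<n. c i * (- (a (x i - z) - l * f (x i - z)))))) (at z)"
        unfolding G_def using DERIV_minus[OF DERIV_mult[OF dE dS]] by (simp add: mult.commute)
      also have "- ((- l) * exp (- l * z) * (\<Sum>i<n. c i * f (x i - z)) +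
          exp (- l * z) * (\<Sum>i<n. c i * (- (a (x i - z) - l * f (x i - z))))) =
          exp (- l * z) * (\<Sum>i<n. c i * a (x i - z))"
        by (simp add: sum_subtractf sum_negf sum_distrib_left algebra_simps)
      finally show "(G has_vector_derivative exp (- l * z) * (\<Sum>i<n. c i * a (x i - z))) (at z)"
        by (simp add: has_real_derivative_iff_has_vector_derivative)
    next
      show "continuous_on {y..y'} G"
        unfolding G_def by (intro continuous_intros cont')
    qed
    then have "((\<lambda>z. exp (- l * z) * (\<Sum>i<n. c i * a (x i - z))) has_integral (G y' - G y)) {y<..<y'}"
      by (simp add: has_integral_Icc_iff_Ioo)
    then have "0 \<le> G y' - G y"
      by (rule has_integral_nonneg) (use H in auto)
    then show ?thesis by (simp add: G_def)
  qed
  {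
    fix n :: nat and x c :: "nat \<Rightarrow> real" and y y' :: real
    assume yy: "y < y'"
      and H: "\<And>z. z - y \<in> {0..} \<Longrightarrow> z - y' \<notin> {0..} \<Longrightarrow> 0 \<le> (\<Sum>i<n. c i * a (x i - z))"
    have "0 \<le> exp (l * y) * (exp (- l * y) * (\<Sum>i<n. c i * f (x i - y)) - exp (- l * y') * (\<Sum>i<n. c i * f (x i - y')))"
      using decr[where y = y and y' = y' and n = n and c = c and x = x] yy H by simp
    also have "\<dots> = (\<Sum>i<n. c i * f (x i - y)) - exp (- l * (y' - y)) * (\<Sum>i<n. c i * f (x i - y'))"
    proof -
      have "exp (l * y) * exp (- l * y) = 1" "exp (l * y) * exp (- l * y') = exp (- l * (y' - y))"
        by (simp_all add: exp_add[symmetric] algebra_simps)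
      then show ?thesis by (simp add: right_diff_distrib mult.assoc[symmetric] del: mult_minus_left)
    qed
    also have "\<dots> = (\<Sum>i<n. c i * (f (x i - y) - exp (- l * (y' - y)) * f (x i - y')))"
      by (simp add: algebra_simps sum_subtractf sum_distrib_left)
    finally show "0 \<le> (\<Sum>i<n. c i * (f (x i - y) - exp (- l * (y' - y)) * f (x i - y')))" .
  }
  fix n :: nat and x c :: "nat \<Rightarrow> real" and y :: real
  assume H: "\<And>z. z - y \<in> {0..} \<Longrightarrow> 0 \<le> (\<Sum>i<n. c i * a (x i - z))"
  \<comment> \<open>The differential equation fixes \<open>f\<close> only up to multiples of
    \<open>exp (- l * x)\<close>, which are unbounded on the left. Boundedness excludes them: it
    makes the weighted sum tend to 0 as \<open>z\<close> grows.\<close>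
  define K where "K = (\<Sum>i<n. \<bar>c i\<bar> * M)"
  have "- (exp (- l * z) * K) \<le> exp (- l * y) * (\<Sum>i<n. c i * f (x i - y))" if "y \<le> z" for z
  proof -
    have "\<bar>\<Sum>i<n. c i * f (x i - z)\<bar> \<le> K"
      unfolding K_def by (rule order_trans[OF sum_abs]) (auto intro!: sum_mono mult_left_mono bdd simp: abs_mult)
    then have "exp (- l * z) * (- K) \<le> exp (- l * z) * (\<Sum>i<n. c i * f (x i - z))"
      by (intro mult_left_mono) auto
    also have "\<dots> \<le> exp (- l * y) * (\<Sum>i<n. c i * f (x i - y))"
      by (rule decr) (use that H in auto)
    finally show ?thesis by simp
  qed
  moreover have "((\<lambda>z. - (exp (- l * z) * K)) \<longlongrightarrow> - (0 * K)) at_top"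
  proof (intro tendsto_intros)
    have "LIM z at_top. - l * z :> at_bot"
      using l by (intro filterlim_tendsto_neg_mult_at_bot[OF tendsto_const _ filterlim_ident]) auto
    then show "((\<lambda>z. exp (- l * z)) \<longlongrightarrow> 0) at_top"
      by (rule filterlim_compose[OF exp_at_bot])
  qed
  ultimately have "- (0 * K) \<le> exp (- l * y) * (\<Sum>i<n. c i * f (x i - y))"
    by (intro tendsto_upperbound[where F = at_top and f = "\<lambda>z. - (exp (- l * z) * K)"])
      (auto intro!: eventually_at_top_linorderI[of y])
  then show "0 \<le> (\<Sum>i<n. c i * f (x i - y))" by (simp add: zero_le_mult_iff)
qed auto

section \<open>Examples of Polya frequency functions\<close>

lemma integrable_lebesgue_exp_bound:
  fixes f :: "real \<Rightarrow> real"
  assumes meas: "f \<in> borel_measurable borel" and l: "0 < l" and bound: "\<And>x. \<bar>f x\<bar> \<le> K * exp (- l * \<bar>x\<bar>)"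
  shows "integrable lebesgue f"
proof -
  define g where "g x = indicat_real {0..} x * exp (- l * x)" for x :: real
  have "(\<lambda>x. exp (- l * x)) absolutely_integrable_on {0..}"
    using integrable_on_exp_minus_to_infinity[OF l] by (intro nonnegative_absolutely_integrable_1) auto
  then have "integrable lebesgue g"
    by (simp add: g_def[abs_def] set_integrable_def)
  then have g: "integrable lborel g"
    by (subst (asm) integrable_completion) (auto simp: g_def[abs_def])
  have g': "integrable lborel (\<lambda>x. g (- x))"
    using lborel_integrable_real_affine[OF g, of "-1" 0] by simp
  have "integrable lborel f"
  proof (rule Bochner_Integration.integrable_bound)
    show "integrable lborel (\<lambda>x. K * (g x + g (- x)))" using g g' by auto
    show "AE x in lborel. norm (f x) \<le> norm (K * (g x + g (- x)))"
    proof (rule AE_I2)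
      fix x :: real
      have K: "0 \<le> K" using order_trans[OF abs_ge_zero bound[of 0]] by simp
      have "\<bar>f x\<bar> \<le> K * exp (- l * \<bar>x\<bar>)" by (rule bound)
      also have "\<dots> \<le> K * (g x + g (- x))"
        by (intro mult_left_mono K) (auto simp: g_def indicator_def abs_if)
      finally show "norm (f x) \<le> norm (K * (g x + g (- x)))"
        by (metis abs_ge_self order_trans real_norm_def)
    qed
  qed (use meas in auto)
  then show ?thesis using meas by (simp add: integrable_completion)
qed

lemma totally_nonneg_onesided_exp:
  "totally_nonneg (\<lambda>x::real. if 0 \<le> x then exp (- l * x) else 0)"
  using totally_nonneg_exp_upset[of "{0..}" l] by simp

text \<open>The reflected one-sided exponential convolved with the one-sided one is
  \<open>exp (- l * \<bar>x\<bar>) / (2 * l)\<close>; the constant is the integral of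
  \<open>exp (- 2 * l * x)\<close> over x \<ge> 0.\<close>

lemma totally_nonneg_symmetric_exp:
  assumes "0 < l"
  shows "totally_nonneg (\<lambda>x::real. exp (- l * \<bar>x\<bar>))"
proof -
  define f where "f x = exp (- l * \<bar>x\<bar>) / (2 * l)" for x :: real
  have "totally_nonneg f"
  proof (rule totally_nonneg_resolvent[OF totally_nonneg_reflect[OF totally_nonneg_onesided_exp[of l]] assms])
    show "finite {0::real}" by simp
    show "continuous_on UNIV f" unfolding f_def by (intro continuous_intros) (use assms in auto)
    show "\<bar>f x\<bar> \<le> 1 / (2 * l)" for x
      using assms by (auto simp: f_def divide_simps)
    fix x :: real assume "x \<notin> {0}"
    then consider "x < 0" | "0 < x" by fastforce
    then show "(f has_real_derivative (if 0 \<le> - x then exp (- l * - x) else 0) - l * f x) (at x)"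
    proof cases
      case 1
      have "((\<lambda>x. exp (l * x) / (2 * l)) has_real_derivative exp (l * x) / 2) (at x)"
        using assms by (auto intro!: derivative_eq_intros)
      then have "(f has_real_derivative exp (l * x) / 2) (at x)"
        by (rule has_field_derivative_transform_within_open[where S = "{..<0}"]) (use 1 in \<open>auto simp: f_def\<close>)
      with 1 assms show ?thesis by (simp add: f_def)
    next
      case 2
      have "((\<lambda>x. exp (- l * x) / (2 * l)) has_real_derivative - exp (- l * x) / 2) (at x)"
        using assms by (auto intro!: derivative_eq_intros)
      then have "(f has_real_derivative - exp (- l * x) / 2) (at x)"
        by (rule has_field_derivative_transform_within_open[where S = "{0<..}"]) (use 2 in \<open>auto simp: f_def\<close>)
      with 2 assms show ?thesis by (simp add: f_def)
    qed
  qed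
  from totally_nonneg_cmult[OF this, of "2 * l"] assms show ?thesis by (simp add: f_def)
qed

text \<open>This is the one-sided exponential convolved with itself.\<close>

lemma totally_nonneg_gamma:
  "totally_nonneg (\<lambda>x::real. if 0 \<le> x then x * exp (- x) else 0)"
proof -
  define f where "f x = max 0 x * exp (- x)" for x :: real
  have "totally_nonneg f"
  proof (rule totally_nonneg_resolvent[OF totally_nonneg_onesided_exp[of 1]])
    show "finite {0::real}" "0 < (1::real)" by simp_all
    show "continuous_on UNIV f" unfolding f_def by (intro continuous_intros)
    show "\<bar>f x\<bar> \<le> 1" for x
    proof -
      have "max 0 x \<le> exp x" using exp_ge_add_one_self[of x] exp_gt_zero[of x] by linarith
      then have "max 0 x * exp (- x) \<le> exp x * exp (- x)" by (intro mult_right_mono) auto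
      then show ?thesis by (simp add: f_def exp_minus_inverse abs_mult)
    qed
    fix x :: real assume "x \<notin> {0}"
    then consider "x < 0" | "0 < x" by fastforce
    then show "(f has_real_derivative (if 0 \<le> x then exp (- 1 * x) else 0) - 1 * f x) (at x)"
    proof cases
      case 1
      have "((\<lambda>x. 0) has_real_derivative 0) (at x)" by simp
      then have "(f has_real_derivative 0) (at x)"
        by (rule has_field_derivative_transform_within_open[where S = "{..<0}"]) (use 1 in \<open>auto simp: f_def\<close>)
      with 1 show ?thesis by (simp add: f_def)
    next
      case 2
      have "((\<lambda>x. x * exp (- x)) has_real_derivative exp (- x) - x * exp (- x)) (at x)"
        by (auto intro!: derivative_eq_intros)
      then have "(f has_real_derivative exp (- x) - x * exp (- x)) (at x)"
        by (rule has_field_derivative_transform_within_open[where S = "{0<..}"]) (use 2 in \<open>auto simp: f_def\<close>)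
      with 2 show ?thesis by (simp add: f_def)
    qed
  qed
  moreover have "f = (\<lambda>x. if 0 \<le> x then x * exp (- x) else 0)" by (auto simp: f_def fun_eq_iff)
  ultimately show ?thesis by simp
qed

text \<open>Up to a factor this is the convolution of \<open>exp (- a * \<bar>x\<bar>)\<close> and \<open>exp (- (a + 1) * \<bar>x\<bar>)\<close>,
  built from the first function by two one-sided convolutions; \<open>g\<close> is the intermediate stage.\<close>

lemma totally_nonneg_two_exp:
  fixes a :: real
  assumes a: "0 < a"
  shows "totally_nonneg (\<lambda>x. exp (- a * \<bar>x\<bar>) * (1 + a - a * exp (- \<bar>x\<bar>)))"
proof -
  \<comment> \<open>With this \<open>b\<close> the factor \<open>1 / (b - a)\<close> in the
    convolution is 1, and the final bracket has degree 1 in \<open>exp (- \<bar>x\<bar>)\<close>.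
    The function \<open>g\<close> is \<open>exp (- a * \<bar>x\<bar>)\<close> convolved with
    \<open>exp (- b * x)\<close> on x \<ge> 0.\<close>
  define b where "b = a + 1"
  define g where "g x = (if x \<le> 0 then exp (a * x) / (a + b)
    else exp (- a * x) - exp (- b * x) + exp (- b * x) / (a + b))" for x :: real
  define K where "K = 1 / (b * (a + b))"
  define f where "f x = K * (b * exp (- a * \<bar>x\<bar>) - a * exp (- b * \<bar>x\<bar>))" for x :: real
  have ab: "0 < b" "0 < a + b" "a < b" and K: "0 < K" using a by (auto simp: b_def K_def)
  have "totally_nonneg g"
  proof (rule totally_nonneg_resolvent[OF totally_nonneg_symmetric_exp[OF a] ab(1)])
    show "finite {0::real}" by simp
    have "continuous_on ({..0} \<union> {0..}) (\<lambda>x. if x \<le> 0 then exp (a * x) / (a + b)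
        else exp (- a * x) - exp (- b * x) + exp (- b * x) / (a + b))"
      by (rule continuous_on_cases) (use ab in \<open>auto intro!: continuous_intros\<close>)
    moreover have "{..0} \<union> {0..} = (UNIV :: real set)" by auto
    ultimately show "continuous_on UNIV g" by (simp add: g_def[abs_def])
    show "\<bar>g x\<bar> \<le> 1 + 1 / (a + b)" for x
    proof (cases "x \<le> 0")
      case True
      have "exp (a * x) / (a + b) \<le> 1 / (a + b)"
        using True a ab by (intro divide_right_mono) (auto simp: mult_nonneg_nonpos)
      then show ?thesis using True a ab by (simp add: g_def)
    next
      case False
      have "exp (- b * x) \<le> exp (- a * x)" using False ab by auto
      moreover have "exp (- a * x) \<le> 1" using False a by auto
      moreover have "exp (- b * x) / (a + b) \<le> 1 / (a + b)"
        using False a ab by (intro divide_right_mono) (auto simp: mult_nonneg_nonpos)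
      moreover have "0 \<le> exp (- b * x) / (a + b)" "0 < exp (- b * x)" using ab by auto
      moreover have "\<bar>g x\<bar> = exp (- a * x) - exp (- b * x) + exp (- b * x) / (a + b)"
        using False calculation by (simp add: g_def)
      ultimately show ?thesis by linarith
    qed
    fix x :: real assume "x \<notin> {0}"
    then consider "x < 0" | "0 < x" by fastforce
    then show "(g has_real_derivative exp (- a * \<bar>x\<bar>) - b * g x) (at x)"
    proof cases
      case 1
      have "((\<lambda>x. exp (a * x) / (a + b)) has_real_derivative a * exp (a * x) / (a + b)) (at x)"
        using ab by (auto intro!: derivative_eq_intros)
      then have "(g has_real_derivative a * exp (a * x) / (a + b)) (at x)"
        by (rule has_field_derivative_transform_within_open[where S = "{..<0}"]) (use 1 in \<open>auto simp: g_def\<close>)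
      moreover have "a * exp (a * x) / (a + b) = exp (- a * \<bar>x\<bar>) - b * g x"
        using 1 ab by (simp add: g_def field_simps)
      ultimately show ?thesis by simp
    next
      case 2
      have "((\<lambda>x. exp (- a * x) - exp (- b * x) + exp (- b * x) / (a + b)) has_real_derivative
          - a * exp (- a * x) + b * exp (- b * x) - b * exp (- b * x) / (a + b)) (at x)"
        using ab by (auto intro!: derivative_eq_intros)
      then have "(g has_real_derivative - a * exp (- a * x) + b * exp (- b * x) - b * exp (- b * x) / (a + b)) (at x)"
        by (rule has_field_derivative_transform_within_open[where S = "{0<..}"]) (use 2 in \<open>auto simp: g_def\<close>)
      moreover have "- a * exp (- a * x) + b * exp (- b * x) - b * exp (- b * x) / (a + b) = exp (- a * \<bar>x\<bar>) - b * g x"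
      proof -
        have "exp (- a * x) = b * exp (- a * x) - a * exp (- a * x)" by (simp add: b_def algebra_simps)
        then show ?thesis using 2 by (simp add: g_def algebra_simps)
      qed
      ultimately show ?thesis by simp
    qed
  qed
  from totally_nonneg_reflect[OF this] have "totally_nonneg (\<lambda>x. g (- x))" .
  then have "totally_nonneg f"
  proof (rule totally_nonneg_resolvent)
    show "finite {0::real}" "0 < b" using ab by simp_all
    show "continuous_on UNIV f" unfolding f_def by (intro continuous_intros)
    show "\<bar>f x\<bar> \<le> K * (b + a)" for x
    proof -
      have "b * exp (- a * \<bar>x\<bar>) \<le> b * 1" "a * exp (- b * \<bar>x\<bar>) \<le> a * 1"
        using a ab by (intro mult_left_mono; simp)+
      moreover have "0 \<le> b * exp (- a * \<bar>x\<bar>)" "0 \<le> a * exp (- b * \<bar>x\<bar>)" using a ab by auto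
      ultimately have "\<bar>b * exp (- a * \<bar>x\<bar>) - a * exp (- b * \<bar>x\<bar>)\<bar> \<le> b + a" by linarith
      then show ?thesis using K by (simp add: f_def abs_mult)
    qed
    have Kb: "exp y / (a + b) = b * K * exp y" for y using ab by (simp add: K_def)
    fix x :: real assume "x \<notin> {0}"
    then consider "x < 0" | "0 < x" by fastforce
    then show "(f has_real_derivative g (- x) - b * f x) (at x)"
    proof cases
      case 1
      have "((\<lambda>x. K * (b * exp (a * x) - a * exp (b * x))) has_real_derivative
          K * (b * (a * exp (a * x)) - a * (b * exp (b * x)))) (at x)"
        by (auto intro!: derivative_eq_intros)
      then have "(f has_real_derivative K * (b * (a * exp (a * x)) - a * (b * exp (b * x)))) (at x)"
        by (rule has_field_derivative_transform_within_open[where S = "{..<0}"]) (use 1 in \<open>auto simp: f_def\<close>)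
      moreover have "K * (b * (a * exp (a * x)) - a * (b * exp (b * x))) = g (- x) - b * f x"
      proof -
        have K1: "b * K * (a + b) = 1" using ab by (simp add: K_def)
        have "g (- x) = exp (a * x) - exp (b * x) + b * K * exp (b * x)"
          using 1 by (simp add: g_def Kb)
        moreover have "exp (a * x) - exp (b * x) = b * K * (a + b) * (exp (a * x) - exp (b * x))"
          by (simp add: K1)
        ultimately show ?thesis using 1 by (simp add: f_def algebra_simps b_def)
      qed
      ultimately show ?thesis by simp
    next
      case 2
      have "((\<lambda>x. K * (b * exp (- a * x) - a * exp (- b * x))) has_real_derivative
          K * (- b * (a * exp (- a * x)) + a * (b * exp (- b * x)))) (at x)"
        by (auto intro!: derivative_eq_intros simp: algebra_simps)
      then have "(f has_real_derivative K * (- b * (a * exp (- a * x)) + a * (b * exp (- b * x)))) (at x)"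
        by (rule has_field_derivative_transform_within_open[where S = "{0<..}"]) (use 2 in \<open>auto simp: f_def\<close>)
      moreover have "K * (- b * (a * exp (- a * x)) + a * (b * exp (- b * x))) = g (- x) - b * f x"
        using 2 by (simp add: f_def g_def Kb) (simp add: b_def algebra_simps)
      ultimately show ?thesis by simp
    qed
  qed
  from totally_nonneg_cmult[OF this, of "1 / K"] K
  have "totally_nonneg (\<lambda>x. b * exp (- a * \<bar>x\<bar>) - a * exp (- b * \<bar>x\<bar>))" by (simp add: f_def)
  moreover have "b * exp (- a * \<bar>x\<bar>) - a * exp (- b * \<bar>x\<bar>) = exp (- a * \<bar>x\<bar>) * (1 + a - a * exp (- \<bar>x\<bar>))" for x
    by (simp add: b_def algebra_simps exp_add[symmetric])
  ultimately show ?thesis by simp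
qed

lemma polya_frequency_onesided_exp:
  assumes "0 < c"
  shows "polya_frequency_function (\<lambda>x. c * (if 0 \<le> x then exp (- x) else 0))"
  unfolding polya_frequency_function_def
proof (intro conjI)
  show "totally_nonneg (\<lambda>x::real. c * (if 0 \<le> x then exp (- x) else 0))"
    using totally_nonneg_cmult[OF totally_nonneg_onesided_exp[of 1], of c] assms by (simp cong: if_cong)
  show "integrable lebesgue (\<lambda>x. c * (if 0 \<le> x then exp (- x) else 0))"
    by (rule integrable_lebesgue_exp_bound[where l = 1 and K = c]) (use assms in auto)
  show "\<exists>s t. s \<noteq> t \<and> c * (if 0 \<le> s then exp (- s) else 0) \<noteq> 0 \<and> c * (if 0 \<le> t then exp (- t) else 0) \<noteq> 0"
    using assms by (intro exI[of _ 0] exI[of _ 1]) auto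
qed

lemma polya_frequency_symmetric_exp:
  assumes "0 < c"
  shows "polya_frequency_function (\<lambda>x. c * exp (- \<bar>x\<bar>))"
  unfolding polya_frequency_function_def
proof (intro conjI)
  show "totally_nonneg (\<lambda>x::real. c * exp (- \<bar>x\<bar>))"
    using totally_nonneg_cmult[OF totally_nonneg_symmetric_exp[of 1], of c] assms by simp
  show "integrable lebesgue (\<lambda>x. c * exp (- \<bar>x\<bar>))"
    by (rule integrable_lebesgue_exp_bound[where l = 1 and K = c]) (use assms in auto)
  show "\<exists>s t. s \<noteq> t \<and> c * exp (- \<bar>s\<bar>) \<noteq> 0 \<and> c * exp (- \<bar>t\<bar>) \<noteq> 0"
    using assms by (intro exI[of _ 0] exI[of _ 1]) auto
qed

lemma polya_frequency_gamma:
  "polya_frequency_function (\<lambda>x. if 0 \<le> x then x * exp (- x) else 0)"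
  unfolding polya_frequency_function_def
proof (intro conjI)
  show "integrable lebesgue (\<lambda>x::real. if 0 \<le> x then x * exp (- x) else 0)"
  proof (rule integrable_lebesgue_exp_bound[where l = "1/2" and K = 2])
    fix x :: real
    show "\<bar>if 0 \<le> x then x * exp (- x) else 0\<bar> \<le> 2 * exp (- (1/2) * \<bar>x\<bar>)"
    proof (cases "0 \<le> x")
      case True
      have "x / 2 \<le> exp (x / 2)" using exp_ge_add_one_self[of "x / 2"] by linarith
      then have "x * exp (- x) \<le> 2 * exp (x / 2) * exp (- x)" by (intro mult_right_mono) auto
      also have "\<dots> = 2 * exp (- (1/2) * \<bar>x\<bar>)" using True by (simp add: exp_add[symmetric])
      finally show ?thesis using True by simp
    qed simp
  qed auto
  show "\<exists>s t. s \<noteq> t \<and> (if 0 \<le> s then s * exp (- s) else 0) \<noteq> (0::real) \<and> (if 0 \<le> t then t * exp (- t) else 0) \<noteq> 0"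
    by (intro exI[of _ 1] exI[of _ 2]) auto
qed (rule totally_nonneg_gamma)

lemma polya_frequency_two_exp:
  assumes "0 < a"
  shows "polya_frequency_function (\<lambda>x. exp (- a * \<bar>x\<bar>) * (1 + a - a * exp (- \<bar>x\<bar>)))"
  unfolding polya_frequency_function_def
proof (intro conjI)
  have pos: "0 < 1 + a - a * exp (- \<bar>x\<bar>)" for x :: real
  proof -
    have "a * exp (- \<bar>x\<bar>) \<le> a * 1" using assms by (intro mult_left_mono) auto
    then show ?thesis by simp
  qed
  show "integrable lebesgue (\<lambda>x. exp (- a * \<bar>x\<bar>) * (1 + a - a * exp (- \<bar>x\<bar>)))"
  proof (rule integrable_lebesgue_exp_bound[where l = a and K = "1 + a"])
    fix x :: real
    have "exp (- a * \<bar>x\<bar>) * (1 + a - a * exp (- \<bar>x\<bar>)) \<le> exp (- a * \<bar>x\<bar>) * (1 + a)"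
      using assms by (intro mult_left_mono) auto
    then show "\<bar>exp (- a * \<bar>x\<bar>) * (1 + a - a * exp (- \<bar>x\<bar>))\<bar> \<le> (1 + a) * exp (- a * \<bar>x\<bar>)"
      using pos[of x] by (simp add: abs_mult mult.commute)
  qed (use assms in auto)
  show "\<exists>s t. s \<noteq> t \<and> exp (- a * \<bar>s\<bar>) * (1 + a - a * exp (- \<bar>s\<bar>)) \<noteq> 0 \<and>
      exp (- a * \<bar>t\<bar>) * (1 + a - a * exp (- \<bar>t\<bar>)) \<noteq> 0"
    using pos[of 0] pos[of 1] by (intro exI[of _ 0] exI[of _ 1]) auto
qed (rule totally_nonneg_two_exp[OF assms])

section \<open>Finitely supported sequences have real-rooted generating polynomials\<close>

lemma det_mat_Suc:
  fixes f :: "nat \<times> nat \<Rightarrow> 'a::comm_ring_1"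
  shows "Determinant.det (Matrix.mat (Suc n) (Suc n) f) =
    (\<Sum>j<Suc n. (-1) ^ j * f (0, j) * Determinant.det (Matrix.mat n n (\<lambda>(i, k). f (Suc i, insert_index j k))))"
proof -
  let ?A = "Matrix.mat (Suc n) (Suc n) f"
  have "Determinant.det ?A = (\<Sum>j<Suc n. ?A $$ (0, j) * cofactor ?A 0 j)"
    by (rule laplace_expansion_row) auto
  also have "\<dots> = (\<Sum>j<Suc n. (-1) ^ j * f (0, j) * Determinant.det (Matrix.mat n n (\<lambda>(i, k). f (Suc i, insert_index j k))))"
  proof (rule sum.cong[OF refl])
    fix j assume "j \<in> {..<Suc n}"
    moreover have "mat_delete ?A 0 j = Matrix.mat n n (\<lambda>(i, k). f (Suc i, insert_index j k))"
      by (rule eq_matI) (auto simp: mat_delete_def insert_index_def)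
    ultimately show "?A $$ (0, j) * cofactor ?A 0 j =
        (-1) ^ j * f (0, j) * Determinant.det (Matrix.mat n n (\<lambda>(i, k). f (Suc i, insert_index j k)))"
      by (simp add: cofactor_def)
  qed
  finally show ?thesis .
qed

lemma det_mat_2:
  fixes f :: "nat \<times> nat \<Rightarrow> 'a::comm_ring_1"
  shows "Determinant.det (Matrix.mat 2 2 f) = f (0, 0) * f (1, 1) - f (0, 1) * f (1, 0)"
  by (simp add: numeral_2_eq_2 det_mat_Suc insert_index_def)

lemma det_mat_3:
  fixes f :: "nat \<times> nat \<Rightarrow> 'a::comm_ring_1"
  shows "Determinant.det (Matrix.mat 3 3 f) =
    f (0, 0) * (f (1, 1) * f (2, 2) - f (1, 2) * f (2, 1))
    - f (0, 1) * (f (1, 0) * f (2, 2) - f (1, 2) * f (2, 0))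
    + f (0, 2) * (f (1, 0) * f (2, 1) - f (1, 1) * f (2, 0))"
  by (simp add: numeral_eq_Suc det_mat_Suc insert_index_def algebra_simps)

lemma det_mat_4:
  fixes f :: "nat \<times> nat \<Rightarrow> 'a::comm_ring_1"
  shows "Determinant.det (Matrix.mat 4 4 f) =
    (\<Sum>j<4. (-1) ^ j * f (0, j) * Determinant.det (Matrix.mat 3 3 (\<lambda>(i, k). f (Suc i, insert_index j k))))"
  using det_mat_Suc[of 3 f] by simp
text \<open>Iterating this convolution with \<open>1 + z\<close> makes enough minors strictly positive without
  changing the roots off the real line.\<close>

definition shift_sum :: "(int \<Rightarrow> real) \<Rightarrow> int \<Rightarrow> real" where
  "shift_sum a k = a k + a (k - 1)"

lemma shift_sum_iterate_Suc:
  "(shift_sum ^^ Suc m) a k = (shift_sum ^^ m) a k + (shift_sum ^^ m) a (k - 1)"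
  by (simp only: funpow.simps o_apply) (simp only: shift_sum_def)

lemma shift_sum_det:
  assumes a: "totally_nonneg a" and x: "strict_mono_on {..<n} x" and y: "strict_mono_on {..<n} y"
    and y': "strict_mono_on {..<n} y'" "\<And>j. j < n \<Longrightarrow> y' j \<in> {y j, y j + 1}"
  shows "0 \<le> Determinant.det (Matrix.mat n n (\<lambda>(i, j). a (x i - y' j)))"
    and "Determinant.det (Matrix.mat n n (\<lambda>(i, j). a (x i - y' j))) \<le>
      Determinant.det (Matrix.mat n n (\<lambda>(i, j). shift_sum a (x i - y j)))"
proof -
  let ?C = "\<lambda>j. {\<lambda>i. a (x i - z) | z. z \<in> {y j, y j + 1}}"
  have nonneg: "0 \<le> Determinant.det (Matrix.mat n n (\<lambda>(i, j). v j i))"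
    if v: "\<And>j. j < n \<Longrightarrow> v j \<in> ?C j" for v
  proof -
    have "\<forall>j. \<exists>z. j < n \<longrightarrow> z \<in> {y j, y j + 1} \<and> v j = (\<lambda>i. a (x i - z))" using v by blast
    then obtain z where z: "\<And>j. j < n \<Longrightarrow> z j \<in> {y j, y j + 1}" "\<And>j. j < n \<Longrightarrow> v j = (\<lambda>i. a (x i - z j))"
      by metis
    have eq: "Matrix.mat n n (\<lambda>(i, j). v j i) = Matrix.mat n n (\<lambda>(i, j). a (x i - z j))"
      using z by (intro eq_matI) auto
    show ?thesis
    proof (cases "strict_mono_on {..<n} z")
      case True
      then show ?thesis unfolding eq by (rule totally_nonnegD[OF a x])
    next
      case False
      then obtain j where j: "Suc j < n" "\<not> z j < z (Suc j)"
        using strict_mono_on_lessThan_Suc by blast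
      \<comment> \<open>Moves by 0 or 1 can make neighbouring columns coincide, in which case the
        minor vanishes, but never cross.\<close>
      have "y j < y (Suc j)" using y j by (auto simp: strict_mono_on_def)
      then have "z j = z (Suc j)" using z(1)[of j] z(1)[of "Suc j"] j by auto
      then have "Determinant.det (Matrix.mat n n (\<lambda>(i, j). a (x i - z j))) = 0"
        using j by (intro det_identical_columns[where i = j and j = "Suc j" and n = n]) auto
      then show ?thesis by (simp add: eq)
    qed
  qed
  have dom: "0 \<le> (\<Sum>i<n. c i * a (x i - y' j)) \<and>
      (\<Sum>i<n. c i * a (x i - y' j)) \<le> (\<Sum>i<n. c i * shift_sum a (x i - y j))"
    if j: "j < n" and c: "\<And>z. z \<in> ?C j \<Longrightarrow> 0 \<le> (\<Sum>i<n. c i * z i)" for j c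
  proof -
    have "0 \<le> (\<Sum>i<n. c i * a (x i - y j))" "0 \<le> (\<Sum>i<n. c i * a (x i - (y j + 1)))"
      using c by blast+
    moreover have "(\<Sum>i<n. c i * shift_sum a (x i - y j)) =
        (\<Sum>i<n. c i * a (x i - y j)) + (\<Sum>i<n. c i * a (x i - (y j + 1)))"
      by (simp add: shift_sum_def sum.distrib[symmetric] algebra_simps)
    ultimately show ?thesis using y'(2)[OF j] by auto
  qed
  show "0 \<le> Determinant.det (Matrix.mat n n (\<lambda>(i, j). a (x i - y' j)))"
    by (rule totally_nonnegD[OF a x y'(1)])
  show "Determinant.det (Matrix.mat n n (\<lambda>(i, j). a (x i - y' j))) \<le>
      Determinant.det (Matrix.mat n n (\<lambda>(i, j). shift_sum a (x i - y j)))"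
    by (rule det_columns_mono(2)[where C = ?C, OF nonneg dom])
qed

lemma totally_nonneg_shift_sum:
  assumes "totally_nonneg a"
  shows "totally_nonneg (shift_sum a)"
  unfolding totally_nonneg_def
proof (intro allI impI)
  fix n :: nat and x y :: "nat \<Rightarrow> int"
  assume "strict_mono_on {..<n} x" "strict_mono_on {..<n} y"
  then show "0 \<le> Determinant.det (Matrix.mat n n (\<lambda>(i, j). shift_sum a (x i - y j)))"
    using shift_sum_det[OF assms, of n x y y] by simp
qed

lemma totally_nonneg_shift_sum_iterate:
  "totally_nonneg a \<Longrightarrow> totally_nonneg ((shift_sum ^^ m) a)"
  by (induction m) (auto intro: totally_nonneg_shift_sum)

text \<open>Each application of \<open>shift_sum\<close> dominates the minors obtained by moving any
  columns one step to the right. After \<open>m\<close> applications every increasing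
  \<open>z\<close> within distance \<open>m\<close> of \<open>y\<close> is reached.\<close>

lemma det_shift_sum_iterate_ge:
  assumes a: "totally_nonneg a" and x: "strict_mono_on {..<n} x" and y: "strict_mono_on {..<n} y"
    and z: "strict_mono_on {..<n} z" "\<And>j. j < n \<Longrightarrow> y j \<le> z j" "\<And>j. j < n \<Longrightarrow> z j \<le> y j + int m"
  shows "Determinant.det (Matrix.mat n n (\<lambda>(i, j). a (x i - z j))) \<le>
    Determinant.det (Matrix.mat n n (\<lambda>(i, j). (shift_sum ^^ m) a (x i - y j)))"
  using y z
proof (induction m arbitrary: y)
  case 0
  then have "z j = y j" if "j < n" for j using that by (intro antisym) auto
  then have "Matrix.mat n n (\<lambda>(i, j). a (x i - z j)) = Matrix.mat n n (\<lambda>(i, j). a (x i - y j))"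
    by (intro eq_matI) auto
  then show ?case by simp
next
  case (Suc m)
  \<comment> \<open>Every column moves greedily one step towards its target; a minimum of two
    increasing sequences is again increasing, so the columns stay in order.\<close>
  define y' where "y' j = min (z j) (y j + 1)" for j
  have y': "strict_mono_on {..<n} y'"
  proof (rule strict_mono_onI)
    fix i j assume "i \<in> {..<n}" "j \<in> {..<n}" "i < j"
    then have "z i < z j" "y i < y j"
      using Suc.prems(1,2) by (auto simp: strict_mono_on_def)
    then show "y' i < y' j" by (auto simp: y'_def min_def)
  qed
  have "Determinant.det (Matrix.mat n n (\<lambda>(i, j). a (x i - z j))) \<le>
      Determinant.det (Matrix.mat n n (\<lambda>(i, j). (shift_sum ^^ m) a (x i - y' j)))"
  proof (rule Suc.IH[OF y' Suc.prems(2)])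
    fix j assume "j < n"
    then show "y' j \<le> z j" "z j \<le> y' j + int m" using Suc.prems(4)[of j] by (auto simp: y'_def)
  qed
  also have "\<dots> \<le> Determinant.det (Matrix.mat n n (\<lambda>(i, j). shift_sum ((shift_sum ^^ m) a) (x i - y j)))"
  proof (rule shift_sum_det(2)[OF totally_nonneg_shift_sum_iterate[OF a] x Suc.prems(1) y'])
    fix j assume "j < n"
    then show "y' j \<in> {y j, y j + 1}" using Suc.prems(3)[of j] by (auto simp: y'_def)
  qed
  finally show ?case by simp
qed

lemma shift_sum_iterate_support:
  assumes "\<And>k. k < 0 \<or> int n < k \<Longrightarrow> a k = 0"
  shows "k < 0 \<or> int (n + m) < k \<Longrightarrow> (shift_sum ^^ m) a k = 0"
proof (induction m arbitrary: k)
  case 0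
  then show ?case using assms by simp
next
  case (Suc m)
  then have "(shift_sum ^^ m) a k = 0" "(shift_sum ^^ m) a (k - 1) = 0" by (auto intro!: Suc.IH)
  then show ?case by (simp only: shift_sum_iterate_Suc)
qed

text \<open>The convolution of \<open>a\<close> with \<open>p\<close> vanishes identically, and so
  it still does after multiplication of the generating polynomial by
  \<open>(1 + z) ^ m\<close>.\<close>

lemma shift_sum_iterate_kernel:
  fixes p :: "int \<Rightarrow> real"
  assumes supp: "\<And>k. k < 0 \<or> int n < k \<Longrightarrow> a k = 0"
    and ker: "\<And>i. (\<Sum>k=0..n. a (int k) * p (i - int k)) = 0"
  shows "(\<Sum>k=0..n + m. (shift_sum ^^ m) a (int k) * p (i - int k)) = 0"
proof (induction m arbitrary: i)
  case 0
  then show ?case using ker by simp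
next
  case (Suc m)
  define b where "b = (shift_sum ^^ m) a"
  have b0: "b (int (Suc (n + m))) = 0" "b (- 1) = 0"
    using shift_sum_iterate_support[OF supp, where m = m] by (auto simp: b_def)
  have IH: "(\<Sum>k=0..n + m. b (int k) * p (i - int k)) = 0" for i
    unfolding b_def by (rule Suc.IH)
  have "(\<Sum>k=0..n + Suc m. (shift_sum ^^ Suc m) a (int k) * p (i - int k)) =
      (\<Sum>k=0..Suc (n + m). b (int k) * p (i - int k)) + (\<Sum>k=0..Suc (n + m). b (int k - 1) * p (i - int k))"
    unfolding shift_sum_iterate_Suc b_def[symmetric] by (simp only: distrib_right sum.distrib add_Suc_right)
  also have "(\<Sum>k=0..Suc (n + m). b (int k) * p (i - int k)) = 0"
    using IH[of i] b0 by simp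
  also have "(\<Sum>k=0..Suc (n + m). b (int k - 1) * p (i - int k)) = (\<Sum>k=0..n + m. b (int k) * p (i - 1 - int k))"
    unfolding sum.atLeast0_atMost_Suc_shift using b0 by (simp add: algebra_simps)
  also have "\<dots> = 0" by (rule IH)
  finally show ?case by simp
qed

text \<open>The nonzero entries lie on or above the diagonal in the columns \<open>j < j0\<close> and on or below
  it in the others, so the identity is the only permutation without a zero entry.\<close>

lemma det_split_triangular_pos:
  fixes A :: "real mat"
  assumes A: "A \<in> carrier_mat s s"
    and left: "\<And>i j. i < s \<Longrightarrow> j < s \<Longrightarrow> j < j0 \<Longrightarrow> j < i \<Longrightarrow> A $$ (i, j) = 0"
    and right: "\<And>i j. i < s \<Longrightarrow> j < s \<Longrightarrow> j0 \<le> j \<Longrightarrow> i < j \<Longrightarrow> A $$ (i, j) = 0"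
    and diag: "\<And>i. i < s \<Longrightarrow> 0 < A $$ (i, i)"
  shows "0 < Determinant.det A"
proof -
  have "Determinant.det A = (\<Prod>i=0..<s. A $$ (i, i))"
  proof (rule det_eq_prod_diag[OF A])
    fix p assume p: "p permutes {0..<s}" "p \<noteq> id"
    show "\<exists>i<s. A $$ (i, p i) = 0"
    proof (rule ccontr)
      assume "\<not> ?thesis"
      then have nz: "A $$ (i, p i) \<noteq> 0" if "i < s" for i using that by auto
      have lt: "p i < s" if "i < s" for i using permutes_in_image[OF p(1), of i] that by auto
      have inj: "p i = p j \<Longrightarrow> i = j" for i j using permutes_inj[OF p(1)] by (auto simp: inj_def)
      have l: "i \<le> p i" if "i < s" "p i < j0" for i
        using left[of i "p i"] nz[of i] lt[of i] that by force
      have r: "p i \<le> i" if "i < s" "j0 \<le> p i" for i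
        using right[of i "p i"] nz[of i] lt[of i] that by force
      \<comment> \<open>For such \<open>i\<close>, \<open>l\<close> rules out
        \<open>p i < j0\<close>, so \<open>r\<close> gives \<open>p i \<le> i\<close>, and
        injectivity fixes the indices one after another from \<open>j0\<close> upwards.\<close>
      have high: "p i = i" if "i < s" "j0 \<le> i" for i
        using that
      proof (induction i rule: less_induct)
        case (less i)
        have "j0 \<le> p i" using l[of i] less.prems by force
        with r less.prems have "p i \<le> i" by blast
        show ?case
        proof (rule ccontr)
          assume "p i \<noteq> i"
          with \<open>p i \<le> i\<close> have "p i < i" by simp
          then have "p (p i) = p i" using less.IH[of "p i"] less.prems \<open>j0 \<le> p i\<close> by simp
          then show False using inj \<open>p i \<noteq> i\<close> by blast
        qed
      qed
      have "p = id"
      proof (rule permutes_natset_ge[OF p(1)], rule ballI)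
        fix i assume i: "i \<in> {0..<s}"
        show "i \<le> p i"
        proof (cases "j0 \<le> i")
          case True
          then show ?thesis using high i by simp
        next
          case False
          then have "p i < j0" using r[of i] i by force
          then show ?thesis using l i by simp
        qed
      qed
      then show False using p by simp
    qed
  qed
  also have "\<dots> > 0" using diag by (intro prod_pos) auto
  finally show ?thesis .
qed

lemma discrete_ivt:
  fixes g :: "nat \<Rightarrow> nat"
  assumes "g 0 \<le> N" and "\<And>l. g (Suc l) \<le> Suc (g l)" and "N \<le> g M"
  obtains l where "l \<le> M" "g l = N"
proof -
  define l where "l = (LEAST l. N \<le> g l)"
  have l: "N \<le> g l" unfolding l_def using assms(3) by (rule LeastI)
  have "l \<le> M" unfolding l_def using assms(3) by (rule Least_le)
  moreover have "g l = N"
  proof (cases l)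
    case 0
    then show ?thesis using l assms(1) by simp
  next
    case (Suc k)
    then have "\<not> N \<le> g k" using not_less_Least[of k "\<lambda>l. N \<le> g l"] by (simp add: l_def)
    then show ?thesis using l assms(2)[of k] Suc by simp
  qed
  ultimately show ?thesis by (rule that)
qed

text \<open>A sign-alternating combination of the merged columns \<open>w j\<close> vanishes, although their
  determinant is positive: it dominates a minor with one column from each sign block.\<close>

lemma totally_nonneg_no_slow_kernel:
  fixes a p :: "int \<Rightarrow> real" and \<beta> :: "nat \<Rightarrow> nat"
  assumes a: "totally_nonneg a" and supp: "\<And>k. k < 0 \<or> int n < k \<Longrightarrow> a k = 0"
    and ends: "0 < a 0" "0 < a (int n)"
    and \<beta>0: "\<beta> 0 = 0" and \<beta>_Suc: "\<And>l. \<beta> (Suc l) \<in> {\<beta> l, Suc (\<beta> l)}"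
    and sgn: "\<And>l. 0 < (-1) ^ \<beta> l * p (int l)"
    and slow: "\<And>N. \<exists>l. N + \<beta> l \<le> l"
    and ker: "\<And>i. (\<Sum>k=0..n. a (int k) * p (i - int k)) = 0"
  shows False
proof -
  have \<beta>_le: "\<beta> l \<le> l" for l
  proof (induction l)
    case (Suc l)
    then show ?case using \<beta>_Suc[of l] by auto
  qed (simp add: \<beta>0)
  have \<beta>_mono: "\<beta> l \<le> \<beta> l'" if "l \<le> l'" for l l'
  proof (rule lift_Suc_mono_le[OF _ that])
    show "\<beta> l \<le> \<beta> (Suc l)" for l using \<beta>_Suc[of l] by auto
  qed
  obtain M where M: "2 * n + \<beta> M \<le> M" using slow by blast
  have step: "Suc l - \<beta> (Suc l) \<le> Suc (l - \<beta> l)" for l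
    using \<beta>_Suc[of l] \<beta>_le[of l] by auto
  \<comment> \<open>The indices up to \<open>l0\<close> outnumber their \<open>s\<close> sign blocks
    by exactly \<open>2 * n\<close>. The sequence \<open>b\<close> below is supported on
    \<open>0, ..., 2 * n\<close>, so the \<open>s\<close> rows \<open>x i = i + 2 * n\<close> see
    precisely the indices \<open>0, ..., l0 = s + 2 * n - 1\<close>.\<close>
  obtain l0 where "l0 \<le> M" and l0: "l0 - \<beta> l0 = 2 * n"
    by (rule discrete_ivt[of "\<lambda>l. l - \<beta> l" "2 * n" M]) (use M step in auto)
  define s where "s = Suc (\<beta> l0)"
  have l0_eq: "Suc l0 = s + 2 * n" using l0 \<beta>_le[of l0] by (simp add: s_def)
  define t where "t j = (LEAST l. \<beta> l = j)" for j
  have ex: "\<exists>l. \<beta> l = j" if "j < s" for j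
  proof (rule discrete_ivt[of \<beta> j l0])
    show "\<beta> (Suc l) \<le> Suc (\<beta> l)" for l using \<beta>_Suc[of l] by auto
  qed (use that in \<open>auto simp: s_def \<beta>0\<close>)
  have \<beta>t: "\<beta> (t j) = j" if "j < s" for j
    unfolding t_def using ex[OF that] by (rule LeastI_ex)
  have t_lt: "t i < t j" if "i < j" "j < s" for i j
    using \<beta>_mono[of "t j" "t i"] \<beta>t[of i] \<beta>t[of j] that by (cases "t i < t j") auto
  have t_l0: "t j \<le> l0" if "j < s" for j
  proof (cases "j = \<beta> l0")
    case True
    then show ?thesis unfolding t_def by (intro Least_le) simp
  next
    case False
    then have "\<beta> (t j) < \<beta> l0" using that \<beta>t by (simp add: s_def)
    then show ?thesis using \<beta>_mono[of l0 "t j"] by (cases "t j \<le> l0") auto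
  qed
  have t_ge: "t i + (j - i) \<le> t j" if "i \<le> j" "j < s" for i j
    using that
  proof (induction j)
    case (Suc j)
    show ?case
    proof (cases "i = Suc j")
      case False
      then show ?thesis using Suc t_lt[of j "Suc j"] by auto
    qed simp
  qed simp
  have t_ge': "j \<le> t j" if "j < s" for j using \<beta>_le[of "t j"] \<beta>t that by simp
  have t_le: "t j \<le> j + 2 * n" if "j < s" for j
    using t_ge[of j "\<beta> l0"] t_l0[of "\<beta> l0"] l0_eq that by (simp add: s_def)
  define x where "x i = int (i + 2 * n)" for i
  define b where "b = (shift_sum ^^ n) a"
  have b_tn: "totally_nonneg b" unfolding b_def by (rule totally_nonneg_shift_sum_iterate[OF a])
  have x_mono: "strict_mono_on {..<s} x" by (auto simp: strict_mono_on_def x_def)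
  define blk where "blk j = {l. l \<le> l0 \<and> \<beta> l = j}" for j
  define C where "C j = {\<lambda>i. b (x i - int l) | l. l \<in> blk j}" for j
  define q where "q l = \<bar>p (int l)\<bar>" for l
  have q_pos: "0 < q l" for l using sgn[of l] by (auto simp: q_def)
  define w where "w j i = (\<Sum>l\<in>blk j. q l / q (t j) * b (x i - int l))" for j i
  have fin: "finite (blk j)" for j by (simp add: blk_def)
  have t_blk: "t j \<in> blk j" if "j < s" for j using \<beta>t t_l0 that by (simp add: blk_def)
  have le: "Determinant.det (Matrix.mat s s (\<lambda>(i, j). b (x i - int (t j)))) \<le>
      Determinant.det (Matrix.mat s s (\<lambda>(i, j). w j i))"
  proof (rule det_columns_mono(2)[where C = C])
    fix v assume "\<And>j. j < s \<Longrightarrow> v j \<in> C j"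
    then have "\<forall>j. \<exists>l. j < s \<longrightarrow> l \<in> blk j \<and> v j = (\<lambda>i. b (x i - int l))" unfolding C_def by blast
    then obtain l where l: "\<And>j. j < s \<Longrightarrow> l j \<in> blk j" "\<And>j. j < s \<Longrightarrow> v j = (\<lambda>i. b (x i - int (l j)))"
      by metis
    have "strict_mono_on {..<s} (\<lambda>j. int (l j))"
    proof (rule strict_mono_onI)
      fix i j assume ij: "i \<in> {..<s}" "j \<in> {..<s}" "i < j"
      then have "\<beta> (l i) < \<beta> (l j)" using l(1)[of i] l(1)[of j] by (simp add: blk_def)
      then show "int (l i) < int (l j)" using \<beta>_mono[of "l j" "l i"] by (cases "l i < l j") auto
    qed
    from totally_nonnegD[OF b_tn x_mono this]
    have "0 \<le> Determinant.det (Matrix.mat s s (\<lambda>(i, j). b (x i - int (l j))))" .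
    also have "Matrix.mat s s (\<lambda>(i, j). b (x i - int (l j))) = Matrix.mat s s (\<lambda>(i, j). v j i)"
      using l by (intro eq_matI) auto
    finally show "0 \<le> Determinant.det (Matrix.mat s s (\<lambda>(i, j). v j i))" .
  next
    fix j c assume j: "j < s" and c: "\<And>z. z \<in> C j \<Longrightarrow> 0 \<le> (\<Sum>i<s. c i * z i)"
    have c': "0 \<le> (\<Sum>i<s. c i * b (x i - int l))" if "l \<in> blk j" for l
      using c that by (auto simp: C_def)
    have "(\<Sum>i<s. c i * w j i) = (\<Sum>l\<in>blk j. q l / q (t j) * (\<Sum>i<s. c i * b (x i - int l)))"
      unfolding w_def sum_distrib_left by (subst sum.swap) (simp add: mult_ac)
    also have "\<dots> \<ge> (\<Sum>l\<in>{t j}. q l / q (t j) * (\<Sum>i<s. c i * b (x i - int l)))"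
      using q_pos[THEN less_imp_le] t_blk[OF j] c'
      by (intro sum_mono2[OF fin]) (auto intro!: mult_nonneg_nonneg divide_nonneg_nonneg)
    finally show "0 \<le> (\<Sum>i<s. c i * b (x i - int (t j))) \<and>
        (\<Sum>i<s. c i * b (x i - int (t j))) \<le> (\<Sum>i<s. c i * w j i)"
      using c'[OF t_blk[OF j]] q_pos[of "t j"] by simp
  qed
  \<comment> \<open>The diagonal entries \<open>x j - z j\<close> are then \<open>n\<close> or 0,
    the two places where \<open>a\<close> is known to be positive. As \<open>t j\<close> lies
    between \<open>j\<close> and \<open>j + 2 * n\<close>, the chosen target is at most
    \<open>n\<close> steps to its right. Since \<open>t j - j\<close> never decreases, the choice
    switches at most once, which gives the split triangular shape.\<close>
  define z where "z j = (if t j \<le> j + n then int (j + n) else int (j + 2 * n))" for j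
  have z_mono: "strict_mono_on {..<s} z"
  proof (rule strict_mono_onI)
    fix i j assume ij: "i \<in> {..<s}" "j \<in> {..<s}" "i < j"
    then show "z i < z j" using t_ge[of i j] by (auto simp: z_def)
  qed
  have t_mono: "strict_mono_on {..<s} (\<lambda>j. int (t j))"
    using t_lt by (auto simp: strict_mono_on_def)
  have "Determinant.det (Matrix.mat s s (\<lambda>(i, j). a (x i - z j))) \<le>
      Determinant.det (Matrix.mat s s (\<lambda>(i, j). b (x i - int (t j))))"
    unfolding b_def
  proof (rule det_shift_sum_iterate_ge[OF a x_mono t_mono z_mono])
    fix j assume "j < s"
    then show "int (t j) \<le> z j" "z j \<le> int (t j) + int n"
      using t_le[of j] t_ge'[of j] by (auto simp: z_def)
  qed
  moreover have "0 < Determinant.det (Matrix.mat s s (\<lambda>(i, j). a (x i - z j)))"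
  proof -
    define j0 where "j0 = (LEAST j. j = s \<or> j + n < t j)"
    have lo: "t j \<le> j + n" if "j < j0" for j
      using not_less_Least[of j "\<lambda>j. j = s \<or> j + n < t j"] that by (auto simp: j0_def)
    have j0: "j0 = s \<or> j0 + n < t j0"
      unfolding j0_def by (rule LeastI[of _ s]) simp
    have hi: "j + n < t j" if "j0 \<le> j" "j < s" for j
      using t_ge[of j0 j] j0 that by auto
    show ?thesis
    proof (rule det_split_triangular_pos[of _ s j0])
      fix i j assume ij: "i < s" "j < s" "j < j0" "j < i"
      have "a (x i - z j) = 0" by (rule supp) (use ij lo[of j] in \<open>auto simp: x_def z_def\<close>)
      then show "Matrix.mat s s (\<lambda>(i, j). a (x i - z j)) $$ (i, j) = 0" using ij by simp
    next
      fix i j assume ij: "i < s" "j < s" "j0 \<le> j" "i < j"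
      have "a (x i - z j) = 0" by (rule supp) (use ij hi[of j] in \<open>auto simp: x_def z_def\<close>)
      then show "Matrix.mat s s (\<lambda>(i, j). a (x i - z j)) $$ (i, j) = 0" using ij by simp
    next
      fix i assume i: "i < s"
      have "0 < a (x i - z i)" using ends by (auto simp: x_def z_def)
      then show "0 < Matrix.mat s s (\<lambda>(i, j). a (x i - z j)) $$ (i, i)" using i by simp
    qed auto
  qed
  ultimately have det_pos: "0 < Determinant.det (Matrix.mat s s (\<lambda>(i, j). w j i))"
    using le by linarith
  \<comment> \<open>The signs undo the absolute values in \<open>q\<close>, so that the matrix
    applied to \<open>\<sigma>\<close> is the convolution of \<open>b\<close> with \<open>p\<close>
    at the points \<open>x i\<close>.\<close>
  define \<sigma> where "\<sigma> = vec s (\<lambda>j. (-1) ^ j * q (t j))"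
  have "Matrix.mat s s (\<lambda>(i, j). w j i) *\<^sub>v \<sigma> = 0\<^sub>v s"
  proof (rule eq_vecI)
    fix i assume "i < dim_vec (0\<^sub>v s)"
    then have i: "i < s" by simp
    have ql: "(-1) ^ \<beta> l * q l = p (int l)" for l
      using sgn[of l] by (cases "even (\<beta> l)") (auto simp: q_def)
    have b0: "b k = 0" if "k < 0 \<or> int (n + n) < k" for k
      unfolding b_def by (rule shift_sum_iterate_support[OF supp that])
    have "(Matrix.mat s s (\<lambda>(i, j). w j i) *\<^sub>v \<sigma>) $ i = (\<Sum>j\<in>{0..<s}. w j i * ((-1) ^ j * q (t j)))"
      using i by (simp add: scalar_prod_def \<sigma>_def)
    also have "\<dots> = (\<Sum>j\<in>{0..<s}. \<Sum>l\<in>blk j. p (int l) * b (x i - int l))"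
    proof (rule sum.cong[OF refl])
      fix j assume "j \<in> {0..<s}"
      show "w j i * ((-1) ^ j * q (t j)) = (\<Sum>l\<in>blk j. p (int l) * b (x i - int l))"
        unfolding w_def sum_distrib_right
      proof (rule sum.cong[OF refl])
        fix l assume "l \<in> blk j"
        then have "p (int l) = (-1) ^ j * q l" using ql[of l] by (simp add: blk_def)
        then show "q l / q (t j) * b (x i - int l) * ((-1) ^ j * q (t j)) = p (int l) * b (x i - int l)"
          using q_pos[of "t j"] by simp
      qed
    qed
    also have "\<dots> = (\<Sum>l\<in>(\<Union>j\<in>{0..<s}. blk j). p (int l) * b (x i - int l))"
      by (rule sum.UNION_disjoint[symmetric]) (auto simp: blk_def)
    also have "(\<Union>j\<in>{0..<s}. blk j) = {..l0}"
      using \<beta>_mono by (auto simp: blk_def s_def less_Suc_eq_le)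
    also have "(\<Sum>l\<in>{..l0}. p (int l) * b (x i - int l)) = (\<Sum>l\<in>{i..i + 2 * n}. p (int l) * b (x i - int l))"
      using i l0_eq by (intro sum.mono_neutral_right) (auto simp: x_def intro!: b0)
    also have "\<dots> = (\<Sum>k\<in>{0..n + n}. b (int k) * p (x i - int k))"
      by (rule sum.reindex_bij_witness[of _ "\<lambda>k. i + 2 * n - k" "\<lambda>l. i + 2 * n - l"])
        (auto simp: x_def of_nat_diff)
    also have "\<dots> = 0"
      unfolding b_def by (rule shift_sum_iterate_kernel[OF supp ker])
    finally show "(Matrix.mat s s (\<lambda>(i, j). w j i) *\<^sub>v \<sigma>) $ i = 0\<^sub>v s $ i" using i by simp
  qed auto
  moreover have "\<sigma> \<in> carrier_vec s" by (simp add: \<sigma>_def)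
  moreover have "\<sigma> \<noteq> 0\<^sub>v s"
  proof
    assume "\<sigma> = 0\<^sub>v s"
    then have "\<sigma> $ 0 = 0" by (simp add: s_def)
    then show False using q_pos[of "t 0"] by (simp add: \<sigma>_def s_def)
  qed
  ultimately have "Determinant.det (Matrix.mat s s (\<lambda>(i, j). w j i)) = 0"
    using det_0_iff_vec_prod_zero_field[of "Matrix.mat s s (\<lambda>(i, j). w j i)" s] by auto
  then show False using det_pos by simp
qed

lemma exists_phase_avoiding:
  fixes \<theta> :: real
  shows "\<exists>\<phi>. 0 < \<phi> \<and> \<phi> < pi \<and> (\<forall>(l::nat) (m::int). l * \<theta> + \<phi> \<noteq> m * pi)"
proof -
  \<comment> \<open>These are the phases at which some \<open>sin (l * \<theta> + \<phi>)\<close>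
    vanishes. They are countably many, so a phase with strict signs throughout remains.\<close>
  define S where "S = range (\<lambda>(l::nat, m::int). m * pi - l * \<theta>)"
  have "countable S" by (simp add: S_def)
  moreover have "uncountable {0<..<pi}" by (simp add: uncountable_open_interval)
  ultimately have "\<not> {0<..<pi} \<subseteq> S" using countable_subset by blast
  then obtain \<phi> where "\<phi> \<in> {0<..<pi}" and \<phi>_S: "\<phi> \<notin> S" by blast
  then have \<phi>: "0 < \<phi>" "\<phi> < pi" by auto
  have "l * \<theta> + \<phi> \<noteq> m * pi" for l :: nat and m :: int
  proof
    assume "l * \<theta> + \<phi> = m * pi"
    then have "\<phi> = (\<lambda>(l::nat, m::int). m * pi - l * \<theta>) (l, m)" by simp
    then show False using \<phi>_S unfolding S_def by blast
  qed
  with \<phi> show ?thesis by blast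
qed

lemma sgn_sin_floor:
  assumes t: "0 \<le> t" and ne: "\<And>m::int. t \<noteq> m * pi"
  shows "0 < (-1) ^ nat \<lfloor>t / pi\<rfloor> * sin t"
proof -
  define m where "m = nat \<lfloor>t / pi\<rfloor>"
  have m: "real m = of_int \<lfloor>t / pi\<rfloor>" using t by (simp add: m_def)
  have "real m \<le> t / pi" "t / pi < real m + 1" unfolding m by linarith+
  then have "real m * pi \<le> t" "t < (real m + 1) * pi" by (simp_all add: field_simps)
  moreover have "t \<noteq> real m * pi" using ne[of "int m"] by simp
  ultimately have "0 < sin (t - real m * pi)" by (intro sin_gt_zero) (auto simp: algebra_simps)
  also have "sin (t - real m * pi) = (-1) ^ m * sin t"
    by (simp add: sin_diff)
  finally show ?thesis by (simp add: m_def)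
qed

text \<open>A nonreal root gives the recurrence solution \<open>Im (cis \<phi> * z powi i)\<close>, which changes sign less
  than once per step; \<open>\<beta> l\<close> counts its sign changes up to \<open>l\<close>.\<close>

lemma totally_nonneg_root_real:
  assumes a: "totally_nonneg a" and supp: "\<And>k. k < 0 \<or> int n < k \<Longrightarrow> a k = 0"
    and ends: "0 < a 0" "0 < a (int n)"
    and root: "(\<Sum>k=0..n. of_real (a (int k)) * z ^ (n - k)) = (0::complex)"
  shows "Im z = 0"
proof (rule ccontr)
  assume "Im z \<noteq> 0"
  \<comment> \<open>Coefficients are real, so the conjugate is also a root. An argument in the open
    interval from 0 to \<open>pi\<close> ensures that one step of the phase crosses at most one
    multiple of \<open>pi\<close>.\<close>
  define u where "u = (if 0 < Im z then z else cnj z)"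
  have "(\<Sum>k=0..n. of_real (a (int k)) * cnj z ^ (n - k)) = cnj (\<Sum>k=0..n. of_real (a (int k)) * z ^ (n - k))"
    by simp
  then have u_root: "(\<Sum>k=0..n. of_real (a (int k)) * u ^ (n - k)) = 0"
    using root by (simp add: u_def)
  have "0 < Im u" using \<open>Im z \<noteq> 0\<close> by (simp add: u_def)
  then have u0: "u \<noteq> 0" by auto
  define \<theta> where "\<theta> = Arg u"
  have \<theta>: "0 < \<theta>" "\<theta> < pi" using \<open>0 < Im u\<close> Arg_lt_pi[of u] by (auto simp: \<theta>_def)
  obtain \<phi> where \<phi>: "0 < \<phi>" "\<phi> < pi" "\<And>(l::nat) (m::int). l * \<theta> + \<phi> \<noteq> m * pi"
    using exists_phase_avoiding[of \<theta>] by blast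
  define p where "p i = Im (cis \<phi> * u powi i)" for i :: int
  define \<beta> where "\<beta> l = nat \<lfloor>(real l * \<theta> + \<phi>) / pi\<rfloor>" for l :: nat
  have nn: "0 \<le> real l * \<theta> + \<phi>" for l using \<theta> \<phi> by simp
  have p: "p (int l) = norm u ^ l * sin (real l * \<theta> + \<phi>)" for l
  proof -
    have "u = rcis (norm u) \<theta>" by (simp add: \<theta>_def rcis_cmod_Arg)
    then have "u ^ l = rcis (norm u ^ l) (real l * \<theta>)" by (metis DeMoivre2)
    then have "cis \<phi> * u ^ l = rcis (norm u ^ l) (real l * \<theta> + \<phi>)"
      by (simp add: rcis_def cis_mult mult_ac add_ac)
    then show ?thesis by (simp add: p_def rcis_def)
  qed
  show False
  proof (rule totally_nonneg_no_slow_kernel[OF a supp ends, where \<beta> = \<beta> and p = p])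
    show "\<beta> 0 = 0" using \<phi> by (simp add: \<beta>_def floor_eq_iff)
    show "\<beta> (Suc l) \<in> {\<beta> l, Suc (\<beta> l)}" for l
    proof -
      define r where "r = (real l * \<theta> + \<phi>) / pi"
      have r: "(real (Suc l) * \<theta> + \<phi>) / pi = r + \<theta> / pi"
        by (simp add: r_def add_divide_distrib distrib_right)
      have "0 < \<theta> / pi" "\<theta> / pi < 1" using \<theta> by auto
      then have "\<lfloor>r + \<theta> / pi\<rfloor> = \<lfloor>r\<rfloor> \<or> \<lfloor>r + \<theta> / pi\<rfloor> = \<lfloor>r\<rfloor> + 1" by linarith
      moreover have "0 \<le> \<lfloor>r\<rfloor>" using nn[of l] by (simp add: r_def)
      ultimately show ?thesis unfolding \<beta>_def r r_def[symmetric] by (auto simp: nat_add_distrib)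
    qed
    show "0 < (-1) ^ \<beta> l * p (int l)" for l
    proof -
      have "0 < (-1) ^ \<beta> l * sin (real l * \<theta> + \<phi>)"
        unfolding \<beta>_def by (rule sgn_sin_floor[OF nn \<phi>(3)])
      moreover have "0 < norm u ^ l" using u0 by simp
      ultimately have "0 < norm u ^ l * ((-1) ^ \<beta> l * sin (real l * \<theta> + \<phi>))" by (rule mult_pos_pos[rotated])
      then show ?thesis by (simp add: p mult_ac)
    qed
    show "\<exists>l. N + \<beta> l \<le> l" for N
    proof -
      \<comment> \<open>Sign changes have density \<open>\<theta> / pi\<close> below 1, so the
        surplus of indices over sign changes is unbounded.\<close>
      have d: "0 < 1 - \<theta> / pi" using \<theta> by simp
      obtain l where l: "(real N + 1) / (1 - \<theta> / pi) \<le> real l" using real_arch_simple by blast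
      have "real (\<beta> l) \<le> (real l * \<theta> + \<phi>) / pi"
        using nn[of l] by (simp add: \<beta>_def)
      also have "\<dots> \<le> real l * (\<theta> / pi) + 1" using \<phi> by (simp add: add_divide_distrib)
      finally have "real (\<beta> l) \<le> real l * (\<theta> / pi) + 1" .
      moreover have "real N + 1 \<le> real l * (1 - \<theta> / pi)" using l d by (simp add: field_simps)
      ultimately have "real N + real (\<beta> l) \<le> real l" by (simp add: algebra_simps)
      then show ?thesis by (intro exI[of _ l]) linarith
    qed
    show "(\<Sum>k=0..n. a (int k) * p (i - int k)) = 0" for i
    proof -
      have "(\<Sum>k=0..n. a (int k) * p (i - int k)) =
          Im (\<Sum>k=0..n. of_real (a (int k)) * (cis \<phi> * u powi (i - int k)))"
      proof -
        have "Im (of_real r * w) = r * Im w" for r w by simp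
        then show ?thesis by (simp only: p_def Im_sum)
      qed
      also have "(\<Sum>k=0..n. of_real (a (int k)) * (cis \<phi> * u powi (i - int k))) =
          (\<Sum>k=0..n. cis \<phi> * u powi (i - int n) * (of_real (a (int k)) * u ^ (n - k)))"
      proof (rule sum.cong[OF refl])
        fix k assume "k \<in> {0..n}"
        then have "u powi (i - int k) = u powi (i - int n) * u ^ (n - k)"
          using u0 by (simp add: power_int_add[symmetric] of_nat_diff flip: power_int_of_nat)
        then show "of_real (a (int k)) * (cis \<phi> * u powi (i - int k)) =
            cis \<phi> * u powi (i - int n) * (of_real (a (int k)) * u ^ (n - k))" by (simp add: mult_ac)
      qed
      also have "\<dots> = 0" unfolding sum_distrib_left[symmetric] u_root by simp
      finally show ?thesis by simp
    qed
  qed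
qed

section \<open>Newton's inequalities for polynomials with negative real roots\<close>

lemma poly_map_poly_of_real:
  "poly (map_poly of_real P) (of_real x :: complex) = of_real (poly P x)"
  by (simp add: poly_altdef degree_map_poly coeff_map_poly)

text \<open>The inequality says that \<open>k! * coeff P k\<close> is log-concave. It keeps only the
  first half of Newton's factor \<open>(1 + 1 / k) * (1 + 1 / (n - k))\<close> for the middle index
  \<open>k\<close>; this form is inherited under multiplication by \<open>x + r\<close>, so linear
  factors can be split off one by one.\<close>

lemma newton_weak:
  fixes P :: "real poly"
  assumes "0 < lead_coeff P"
    and "\<And>z. poly (map_poly of_real P) z = (0::complex) \<Longrightarrow> Im z = 0 \<and> Re z < 0"
  shows "\<forall>k\<le>degree P. 0 < coeff P k"
    and "\<forall>k. real (Suc k) * (coeff P (Suc k))\<^sup>2 \<ge> real (Suc (Suc k)) * (coeff P k * coeff P (Suc (Suc k)))"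
proof -
  have "(\<forall>k\<le>degree P. 0 < coeff P k) \<and>
    (\<forall>k. real (Suc k) * (coeff P (Suc k))\<^sup>2 \<ge> real (Suc (Suc k)) * (coeff P k * coeff P (Suc (Suc k))))"
    using assms
  proof (induction "degree P" arbitrary: P)
    case 0
    then show ?case using coeff_eq_0[of P] by auto
  next
    case (Suc d P)
    have "\<not> constant (poly (map_poly complex_of_real P))"
      using Suc.hyps(2) by (subst constant_degree) (simp add: degree_map_poly)
    then obtain z where z: "poly (map_poly of_real P) z = (0::complex)"
      using fundamental_theorem_of_algebra by blast
    define r where "r = - Re z"
    have "0 < r" and zr: "z = of_real (- r)" using Suc.prems(2)[OF z] by (auto simp: r_def complex_eq_iff)
    have "poly P (- r) = 0"
      using z unfolding zr by (simp only: poly_map_poly_of_real of_real_eq_0_iff)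
    then obtain Q where PQ: "P = [:r, 1:] * Q"
      by (metis dvdE minus_minus poly_eq_0_iff_dvd)
    have "P \<noteq> 0" using Suc.prems(1) by auto
    then have Q0: "Q \<noteq> 0" using PQ by auto
    have "degree P = degree [:r, 1:] + degree Q"
      unfolding PQ by (rule degree_mult_eq) (use Q0 in auto)
    then have deg: "degree Q = d" using Suc.hyps(2) by simp
    have lead: "0 < lead_coeff Q" using Suc.prems(1) unfolding PQ lead_coeff_mult by simp
    have "(\<forall>k\<le>degree Q. 0 < coeff Q k) \<and>
      (\<forall>k. real (Suc k) * (coeff Q (Suc k))\<^sup>2 \<ge> real (Suc (Suc k)) * (coeff Q k * coeff Q (Suc (Suc k))))"
    proof (rule Suc.hyps(1)[OF deg[symmetric] lead])
      fix z :: complex assume "poly (map_poly of_real Q) z = 0"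
      then have "poly (map_poly of_real P) z = 0"
      proof -
        have "map_poly of_real P = [:of_real r, 1:] * (map_poly of_real Q :: complex poly)"
          unfolding PQ by (rule poly_eqI) (simp add: coeff_map_poly coeff_pCons split: nat.split)
        then show ?thesis using \<open>poly (map_poly of_real Q) z = 0\<close> by simp
      qed
      then show "Im z = 0 \<and> Re z < 0" by (rule Suc.prems(2))
    qed
    then have Qpos: "\<And>k. k \<le> d \<Longrightarrow> 0 < coeff Q k"
      and N: "\<And>k. real (Suc k) * (coeff Q (Suc k))\<^sup>2 \<ge> real (Suc (Suc k)) * (coeff Q k * coeff Q (Suc (Suc k)))"
      by (auto simp: deg)
    have Qnn: "0 \<le> coeff Q k" for k
      using Qpos[of k] coeff_eq_0[of Q k] deg by (cases "k \<le> d") auto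
    have c0: "coeff P 0 = r * coeff Q 0" by (simp add: PQ)
    have cS: "coeff P (Suc k) = r * coeff Q (Suc k) + coeff Q k" for k by (simp add: PQ)
    have pos: "0 < coeff P k" if "k \<le> degree P" for k
    proof (cases k)
      case 0
      then show ?thesis using c0 Qpos[of 0] \<open>0 < r\<close> by simp
    next
      case (Suc j)
      then have "0 < coeff Q j" using that Suc.hyps(2) Qpos by simp
      then show ?thesis using Suc cS[of j] Qnn[of k] \<open>0 < r\<close> by (simp add: add_nonneg_pos)
    qed
    \<comment> \<open>Multiplying two consecutive inequalities and cancelling the inner product
      bounds the outer product of four consecutive coefficients, which arises when \<open>Q\<close>
      is multiplied by \<open>x + r\<close>.\<close>
    have cross: "real (Suc (Suc (Suc k))) * (coeff Q k * coeff Q (Suc (Suc (Suc k)))) \<le>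
        real (Suc k) * (coeff Q (Suc k) * coeff Q (Suc (Suc k)))" for k
    proof (cases "Suc (Suc k) \<le> d")
      case False
      then have "coeff Q (Suc (Suc (Suc k))) = 0" using coeff_eq_0[of Q] deg by simp
      then show ?thesis using Qnn by simp
    next
      case True
      define A where "A = coeff Q k"
      define B where "B = coeff Q (Suc k)"
      define C where "C = coeff Q (Suc (Suc k))"
      define D where "D = coeff Q (Suc (Suc (Suc k)))"
      have p: "0 < A" "0 < B" "0 < C" "0 \<le> D" using Qpos Qnn True by (auto simp: A_def B_def C_def D_def)
      have 1: "real (k + 2) * (A * C) \<le> real (k + 1) * B\<^sup>2" using N[of k] by (simp add: A_def B_def C_def)
      have 2: "real (k + 3) * (B * D) \<le> real (k + 2) * C\<^sup>2" using N[of "Suc k"] by (simp add: B_def C_def D_def add_ac)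
      have "real (k + 2) * (A * C) * (real (k + 3) * (B * D)) \<le> real (k + 1) * B\<^sup>2 * (real (k + 2) * C\<^sup>2)"
        by (intro mult_mono 1 2) (use p in auto)
      then have "(real (k + 2) * B * C) * (real (k + 3) * (A * D)) \<le> (real (k + 2) * B * C) * (real (k + 1) * (B * C))"
        by (simp add: power2_eq_square mult_ac)
      moreover have "0 < real (k + 2) * B * C" using p by simp
      ultimately have "real (k + 3) * (A * D) \<le> real (k + 1) * (B * C)"
        by (simp only: mult_le_cancel_left_pos)
      then show ?thesis by (simp add: A_def B_def C_def D_def add_ac)
    qed
    have newton: "real (Suc (Suc k)) * (coeff P k * coeff P (Suc (Suc k))) \<le> real (Suc k) * (coeff P (Suc k))\<^sup>2" for k
    proof (cases k)
      case 0
      define B where "B = coeff Q 0"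
      define C where "C = coeff Q 1"
      define D where "D = coeff Q 2"
      have 1: "2 * (B * D) \<le> C\<^sup>2" using N[of 0] by (simp add: B_def C_def D_def numeral_2_eq_2)
      have "r\<^sup>2 * (2 * (B * D)) \<le> r\<^sup>2 * C\<^sup>2" using 1 by (intro mult_left_mono) auto
      then have "2 * (r * B * (r * D + C)) \<le> (r * C + B)\<^sup>2"
        by (simp add: power2_eq_square algebra_simps add_increasing)
      then show ?thesis using 0 c0 cS[of 0] cS[of 1] by (simp add: B_def C_def D_def numeral_2_eq_2)
    next
      case (Suc j)
      define A where "A = coeff Q j"
      define B where "B = coeff Q (Suc j)"
      define C where "C = coeff Q (Suc (Suc j))"
      define D where "D = coeff Q (Suc (Suc (Suc j)))"
      have nn: "0 \<le> A" "0 \<le> B" "0 \<le> C" "0 \<le> D" using Qnn by (auto simp: A_def B_def C_def D_def)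
      define m where "m = real j"
      have m: "0 \<le> m" by (simp add: m_def)
      have 1: "(m + 2) * (A * C) \<le> (m + 1) * B\<^sup>2" using N[of j] by (simp add: A_def B_def C_def m_def add_ac)
      have 2: "(m + 3) * (B * D) \<le> (m + 2) * C\<^sup>2" using N[of "Suc j"] by (simp add: B_def C_def D_def m_def add_ac)
      have 3: "(m + 3) * (A * D) \<le> (m + 1) * (B * C)"
        using cross[of j] by (simp add: A_def B_def C_def D_def m_def add_ac)
      \<comment> \<open>The final inequality is compared coefficientwise in powers of
        \<open>r\<close>. The square uses \<open>2\<close>, and the constant term uses
        \<open>4\<close>, which follows from \<open>1\<close> by
        \<open>(m + 1) * (m + 3) \<le> (m + 2) ^ 2\<close>. In the linear term \<open>B * C\<close>
        has the surplus \<open>2 * (m + 2) - (m + 3) = m + 1\<close>, exactly what \<open>3\<close>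
        consumes.\<close>
      have 4: "(m + 3) * (A * C) \<le> (m + 2) * B\<^sup>2"
      proof -
        have "(m + 2) * ((m + 3) * (A * C)) \<le> (m + 3) * ((m + 1) * B\<^sup>2)"
          using mult_left_mono[OF 1, of "m + 3"] m by (simp add: mult_ac)
        also have "\<dots> \<le> (m + 2) * ((m + 2) * B\<^sup>2)" by (simp add: algebra_simps)
        finally show ?thesis using m by simp
      qed
      have "r\<^sup>2 * ((m + 3) * (B * D)) \<le> r\<^sup>2 * ((m + 2) * C\<^sup>2)" using 2 by (intro mult_left_mono) auto
      moreover have "r * ((m + 3) * (A * D)) \<le> r * ((m + 1) * (B * C))"
        using 3 \<open>0 < r\<close> by (intro mult_left_mono) auto
      ultimately have "(m + 3) * ((r * B + A) * (r * D + C)) \<le> (m + 2) * (r * C + B)\<^sup>2"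
        using 4 by (simp add: power2_eq_square algebra_simps)
      then show ?thesis using Suc cS[of j] cS[of "Suc j"] cS[of "Suc (Suc j)"]
        by (simp add: A_def B_def C_def D_def m_def add_ac)
    qed
    show ?case using pos newton by blast
  qed
  then show "\<forall>k\<le>degree P. 0 < coeff P k"
    and "\<forall>k. real (Suc k) * (coeff P (Suc k))\<^sup>2 \<ge> real (Suc (Suc k)) * (coeff P k * coeff P (Suc (Suc k)))" by auto
qed

section \<open>Unbounded support\<close>

lemma totally_nonneg_minor2:
  assumes "totally_nonneg \<Lambda>" "x\<^sub>1 < x\<^sub>2" "y\<^sub>1 < y\<^sub>2"
  shows "\<Lambda> (x\<^sub>1 - y\<^sub>2) * \<Lambda> (x\<^sub>2 - y\<^sub>1) \<le> \<Lambda> (x\<^sub>1 - y\<^sub>1) * \<Lambda> (x\<^sub>2 - y\<^sub>2)"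
proof -
  define x where "x i = (if i = 0 then x\<^sub>1 else x\<^sub>2)" for i :: nat
  define y where "y i = (if i = 0 then y\<^sub>1 else y\<^sub>2)" for i :: nat
  have "strict_mono_on {..<2} x" "strict_mono_on {..<2} y"
    using assms(2,3) by (auto simp: strict_mono_on_def x_def y_def)
  from totally_nonnegD[OF assms(1) this] show ?thesis
    by (simp add: det_mat_2 x_def y_def)
qed

lemma totally_nonneg_minor3:
  assumes a: "totally_nonneg a" and "a (- 1 :: int) = 0"
  shows "2 * a 0 * a 1 * a 2 \<le> a 1 ^ 3 + (a 0)\<^sup>2 * a 3"
proof -
  have "strict_mono_on {..<3} (\<lambda>i. 1 + int i)" "strict_mono_on {..<3} (\<lambda>i. int i)"
    by (auto simp: strict_mono_on_def)
  from totally_nonnegD[OF a this] show ?thesis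
    using assms(2) by (simp add: det_mat_3 power2_eq_square power3_eq_cube algebra_simps)
qed

text \<open>Log-concavity in a form where the two points may pass each other, so that
  \<open>u + d\<close> can be any point strictly between \<open>u\<close> and
  \<open>v\<close>.\<close>

lemma totally_nonneg_inward:
  assumes "totally_nonneg \<Lambda>" "0 < d" "d < v - u"
  shows "\<Lambda> u * \<Lambda> v \<le> \<Lambda> (u + d) * \<Lambda> (v - d)"
  using totally_nonneg_minor2[OF assms(1), of "u + d" v 0 d] assms(2,3)
  by (simp add: less_diff_eq add.commute)

lemma totally_nonneg_support_convex:
  assumes \<Lambda>: "totally_nonneg \<Lambda>" and "\<Lambda> s \<noteq> 0" "\<Lambda> t \<noteq> 0" "s < m" "m < t"
  shows "0 < \<Lambda> m"
proof -
  have nn: "0 \<le> \<Lambda> x" for x by (rule totally_nonneg_nonneg[OF \<Lambda>])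
  have "0 < \<Lambda> s * \<Lambda> t" using nn[of s] nn[of t] assms(2,3) by simp
  also have "\<dots> \<le> \<Lambda> (s + (m - s)) * \<Lambda> (t - (m - s))"
    by (rule totally_nonneg_inward[OF \<Lambda>]) (use assms(4,5) in auto)
  finally have "\<Lambda> m \<noteq> 0" by auto
  then show ?thesis using nn[of m] by simp
qed

text \<open>A second difference of step \<open>2 * H\<close> at \<open>x\<close> is the sum of those
  of step \<open>H\<close> at \<open>x - H\<close>, \<open>x\<close> (twice) and
  \<open>x + H\<close>, so each doubling gains a factor 4.\<close>

lemma second_difference_doubling:
  fixes \<phi> :: "real \<Rightarrow> real"
  assumes "0 < h"
    and "\<And>y. \<bar>y - x\<bar> < 2 ^ n * h \<Longrightarrow> c \<le> 2 * \<phi> y - \<phi> (y + h) - \<phi> (y - h)"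
  shows "4 ^ n * c \<le> 2 * \<phi> x - \<phi> (x + 2 ^ n * h) - \<phi> (x - 2 ^ n * h)"
  using assms(2)
proof (induction n arbitrary: x)
  case 0
  then show ?case using assms(1) by simp
next
  case (Suc n)
  define H where "H = 2 ^ n * h"
  have H: "0 < H" using assms(1) by (simp add: H_def)
  have step: "4 ^ n * c \<le> 2 * \<phi> z - \<phi> (z + H) - \<phi> (z - H)" if "\<bar>z - x\<bar> \<le> H" for z
    unfolding H_def
  proof (rule Suc.IH)
    fix y assume "\<bar>y - z\<bar> < 2 ^ n * h"
    then have "\<bar>y - x\<bar> < 2 ^ Suc n * h" using that unfolding H_def by simp
    then show "c \<le> 2 * \<phi> y - \<phi> (y + h) - \<phi> (y - h)" by (rule Suc.prems)
  qed
  have H2: "2 ^ Suc n * h = 2 * H" by (simp add: H_def)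
  have eqs: "x - H - H = x - 2 * H" "x + H + H = x + 2 * H" "x - H + H = x" "x + H - H = x"
    "4 ^ Suc n * c = 4 * (4 ^ n * c)" by simp_all
  show ?case
    unfolding H2 eqs(5) using step[of x] step[of "x - H"] step[of "x + H"] H unfolding eqs by simp
qed

lemma finite_support_newton:
  fixes c :: "int \<Rightarrow> real" and l u :: int
  assumes c: "totally_nonneg c" and fin: "\<And>k. c k \<noteq> 0 \<Longrightarrow> l \<le> k \<and> k \<le> u"
    and nz: "c (- 1) \<noteq> 0" "c 0 \<noteq> 0" "c 1 \<noteq> 0"
  shows "(1 + 1 / real_of_int (u - l)) * (c (- 1) * c 1) \<le> (c 0)\<^sup>2"
proof -
  have nn: "0 \<le> c k" for k by (rule totally_nonneg_nonneg[OF c])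
  define K where "K = {k. c k \<noteq> 0}"
  have K: "finite K" by (rule finite_subset[of _ "{l..u}"]) (use fin in \<open>auto simp: K_def\<close>)
  have K_mem: "- 1 \<in> K" "1 \<in> K" using nz by (auto simp: K_def)
  then have "K \<noteq> {}" by auto
  define L where "L = Min K"
  define n where "n = nat (Max K - L)"
  have L: "L \<in> K" "Max K \<in> K" using K \<open>K \<noteq> {}\<close> by (auto simp: L_def)
  have L1: "L \<le> - 1" "1 \<le> Max K" using K K_mem by (auto simp: L_def)
  then have n: "int n = Max K - L" by (simp add: n_def)
  define a where "a k = c (k + L)" for k
  have a: "totally_nonneg a"
    by (rule totally_nonneg_transfer[OF c, where \<phi> = "\<lambda>k. k + L" and \<psi> = id])
      (auto simp: a_def strict_mono_def algebra_simps)
  have supp: "a k = 0" if "k < 0 \<or> int n < k" for k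
  proof (rule ccontr)
    assume "a k \<noteq> 0"
    then have "k + L \<in> K" by (simp add: a_def K_def)
    then have "L \<le> k + L" "k + L \<le> Max K"
      using Min_le[OF K, of "k + L"] Max_ge[OF K, of "k + L"] by (simp_all only: L_def)
    then show False using that n by simp
  qed
  have ends: "0 < a 0" "0 < a (int n)"
    using L nn by (auto simp: a_def n K_def less_le)
  \<comment> \<open>Reversed, because the root criterion uses the powers
    \<open>z ^ (n - k)\<close>.\<close>
  define P where "P = Poly (map (\<lambda>k. a (int (n - k))) [0..<Suc n])"
  have cP: "coeff P k = (if k \<le> n then a (int (n - k)) else 0)" for k
    by (auto simp: P_def coeff_Poly_eq nth_default_def simp del: upt_Suc)
  have deg: "degree P = n"
  proof (rule antisym)
    show "degree P \<le> n" by (rule degree_le) (simp add: cP)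
    show "n \<le> degree P" by (rule le_degree) (use ends in \<open>simp add: cP\<close>)
  qed
  have lead: "0 < lead_coeff P" using ends by (simp add: deg cP)
  have roots: "Im z = 0 \<and> Re z < 0" if "poly (map_poly of_real P) z = 0" for z :: complex
  proof -
    have "0 = (\<Sum>k\<le>n. of_real (a (int (n - k))) * z ^ k)"
      using that by (simp add: poly_altdef degree_map_poly deg coeff_map_poly cP)
    also have "\<dots> = (\<Sum>k=0..n. of_real (a (int k)) * z ^ (n - k))"
      by (rule sum.reindex_bij_witness[of _ "\<lambda>k. n - k" "\<lambda>k. n - k"]) auto
    finally have root: "0 = (\<Sum>k=0..n. of_real (a (int k)) * z ^ (n - k))" .
    have "Im z = 0" by (rule totally_nonneg_root_real[OF a supp ends root[symmetric]])
    then have z: "z = of_real (Re z)" by (simp add: complex_eq_iff)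
    have "poly P (Re z) = 0"
      using that by (subst (asm) z) (simp only: poly_map_poly_of_real of_real_eq_0_iff)
    moreover have "0 < poly P x" if x: "0 \<le> x" for x
    proof -
      have "0 < coeff P 0 * x ^ 0" using ends by (simp add: cP)
      also have "\<dots> \<le> (\<Sum>k\<le>n. coeff P k * x ^ k)"
        by (rule member_le_sum[where f = "\<lambda>k. coeff P k * x ^ k"]) (use x nn in \<open>auto simp: cP a_def\<close>)
      finally show ?thesis by (simp add: poly_altdef deg)
    qed
    ultimately have "\<not> 0 \<le> Re z" by force
    with \<open>Im z = 0\<close> show ?thesis by simp
  qed
  \<comment> \<open>By the reversal \<open>coeff P j = c (Max K - j)\<close>, so \<open>c 0\<close>
    has index \<open>Max K = Suc k\<close>, which is less than the length of the support.\<close>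
  define k where "k = nat (Max K - 1)"
  have k: "int k = Max K - 1" using L1 by (simp add: k_def)
  have kn: "Suc (Suc k) \<le> n" using k n L1 by simp
  have "coeff P k = a (int n - int k)" "coeff P (Suc k) = a (int n - int k - 1)"
    "coeff P (Suc (Suc k)) = a (int n - int k - 2)"
    using kn by (auto simp: cP of_nat_diff algebra_simps)
  then have co: "coeff P k = c 1" "coeff P (Suc k) = c 0" "coeff P (Suc (Suc k)) = c (- 1)"
    by (simp_all add: a_def n k)
  have "real (Suc (Suc k)) * (c 1 * c (- 1)) \<le> real (Suc k) * (c 0)\<^sup>2"
    using newton_weak(2)[OF lead roots] co by metis
  then have "(1 + 1 / real (Suc k)) * (c (- 1) * c 1) \<le> (c 0)\<^sup>2"
    by (simp add: field_simps)
  moreover have "1 / real_of_int (u - l) \<le> 1 / real (Suc k)"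
  proof -
    have "l \<le> L" "Max K \<le> u" using L fin by (auto simp: K_def)
    then have "int (Suc k) \<le> u - l" using kn n by linarith
    then have "real (Suc k) \<le> real_of_int (u - l)" by linarith
    then show ?thesis by (intro divide_left_mono) auto
  qed
  moreover have "0 \<le> c (- 1) * c 1" using nn by simp
  ultimately show ?thesis
    by (meson add_left_mono mult_right_mono order_trans)
qed

text \<open>Sampling at mesh \<open>h\<close>, Newton's inequalities make the second differences of \<open>ln \<circ> \<Lambda>\<close> at
  most \<open>- const * h\<close>, whereas the second difference at a fixed scale is finite.\<close>

lemma totally_nonneg_unbounded_support:
  fixes \<Lambda> :: "real \<Rightarrow> real"
  assumes \<Lambda>: "totally_nonneg \<Lambda>" and bdd: "\<And>x. \<Lambda> x \<noteq> 0 \<Longrightarrow> \<bar>x\<bar> \<le> B"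
    and st: "\<Lambda> s \<noteq> 0" "\<Lambda> t \<noteq> 0" "s < t"
  shows False
proof -
  \<comment> \<open>A quarter of the interval: points within \<open>H\<close> of the midpoint, and
    their neighbours at distance \<open>h \<le> H\<close>, stay strictly between \<open>s\<close>
    and \<open>t\<close>, where the logarithm makes sense.\<close>
  define H where "H = (t - s) / 4"
  define x where "x = (s + t) / 2"
  define \<phi> where "\<phi> y = ln (\<Lambda> y)" for y
  have H: "0 < H" using st by (simp add: H_def)
  have B: "0 < B" using bdd[OF st(1)] bdd[OF st(2)] st(3) by linarith
  have pos: "0 < \<Lambda> y" if "\<bar>y - x\<bar> < 2 * H" for y
  proof (rule totally_nonneg_support_convex[OF \<Lambda> st(1,2)])
    have "y - x < (t - s) / 2" "x - y < (t - s) / 2" using that unfolding H_def by linarith+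
    then show "s < y" "y < t" by (simp_all add: x_def field_simps)
  qed
  define G where "G = 2 * \<phi> x - \<phi> (x + H) - \<phi> (x - H)"
  \<comment> \<open>At mesh \<open>h\<close> the support spans
    \<open>N \<le> (2 * B + 2 * H) / h\<close> cells, and \<open>N \<ge> 2\<close> gives
    \<open>ln (1 + 1 / N) \<ge> 1 / (2 * N) \<ge> h / (4 * B + 4 * H)\<close>. Doubling
    \<open>n\<close> times gains \<open>4 ^ n\<close>, while \<open>h\<close> shrinks only by
    \<open>2 ^ n\<close>.\<close>
  have bound: "2 ^ n * (H / (4 * B + 4 * H)) \<le> G" for n
  proof -
    define h where "h = H / 2 ^ n"
    have h: "0 < h" "h \<le> H" "2 ^ n * h = H" using H by (auto simp: h_def divide_le_eq)
    have "4 ^ n * (h / (4 * B + 4 * H)) \<le> 2 * \<phi> x - \<phi> (x + 2 ^ n * h) - \<phi> (x - 2 ^ n * h)"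
    proof (rule second_difference_doubling[OF h(1)])
      fix y assume "\<bar>y - x\<bar> < 2 ^ n * h"
      then have y: "\<bar>y - x\<bar> < H" by (simp add: h)
      define c where "c k = \<Lambda> (y + h * real_of_int k)" for k
      have c: "totally_nonneg c" unfolding c_def by (rule totally_nonneg_sample[OF \<Lambda> h(1)])
      have pc: "0 < c (- 1)" "0 < c 0" "0 < c 1"
      proof -
        have "\<bar>y - h - x\<bar> < 2 * H" "\<bar>y - x\<bar> < 2 * H" "\<bar>y + h - x\<bar> < 2 * H"
          using y h(1,2) H by linarith+
        from this[THEN pos] show "0 < c (- 1)" "0 < c 0" "0 < c 1" by (simp_all add: c_def)
      qed
      define l where "l = \<lfloor>(- B - y) / h\<rfloor>"
      define u where "u = \<lceil>(B - y) / h\<rceil>"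
      have lu: "l \<le> k \<and> k \<le> u" if "c k \<noteq> 0" for k
      proof -
        have "- B - y \<le> real_of_int k * h" "real_of_int k * h \<le> B - y"
          using bdd that by (fastforce simp: c_def abs_le_iff mult.commute)+
        then have "(- B - y) / h \<le> real_of_int k" "real_of_int k \<le> (B - y) / h"
          using h by (simp_all add: field_simps)
        then show ?thesis unfolding l_def u_def by linarith
      qed
      define N where "N = real_of_int (u - l)"
      have N2: "2 \<le> N" using lu[of "- 1"] lu[of 1] pc by (simp add: N_def)
      have "N \<le> (B - y) / h - (- B - y) / h + 2" unfolding N_def l_def u_def by linarith
      also have "\<dots> = (2 * B + 2 * h) / h" using h by (simp add: field_simps)
      also have "\<dots> \<le> (2 * B + 2 * H) / h" using h by (intro divide_right_mono) auto
      finally have "N * h \<le> 2 * B + 2 * H" using h by (simp add: field_simps)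
      have "(1 + 1 / N) * (c (- 1) * c 1) \<le> (c 0)\<^sup>2"
        unfolding N_def using finite_support_newton[OF c lu] pc by simp
      then have "ln ((1 + 1 / N) * (c (- 1) * c 1)) \<le> ln ((c 0)\<^sup>2)"
        using pc N2 by (intro ln_mono mult_pos_pos) (auto intro: add_pos_nonneg)
      moreover have "ln ((1 + 1 / N) * (c (- 1) * c 1)) = ln (1 + 1 / N) + (ln (c (- 1)) + ln (c 1))"
      proof -
        have "0 < 1 + 1 / N" using N2 by (intro add_pos_nonneg) auto
        then show ?thesis using pc by (simp only: ln_mult_pos mult_pos_pos)
      qed
      moreover have "ln ((c 0)\<^sup>2) = 2 * ln (c 0)" using pc by (simp add: ln_realpow)
      ultimately have "ln (1 + 1 / N) \<le> 2 * \<phi> y - \<phi> (y + h) - \<phi> (y - h)"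
        by (simp add: \<phi>_def c_def)
      moreover have "1 / N - (1 / N)\<^sup>2 \<le> ln (1 + 1 / N)"
        using N2 by (intro ln_one_plus_pos_lower_bound) auto
      moreover have "1 / (2 * N) \<le> 1 / N - (1 / N)\<^sup>2"
        using N2 by (simp add: power2_eq_square field_simps)
      moreover have "h / (4 * B + 4 * H) \<le> 1 / (2 * N)"
        using \<open>N * h \<le> 2 * B + 2 * H\<close> N2 B H by (simp add: field_simps)
      ultimately show "h / (4 * B + 4 * H) \<le> 2 * \<phi> y - \<phi> (y + h) - \<phi> (y - h)" by linarith
    qed
    moreover have "4 ^ n * (h / (4 * B + 4 * H)) = 2 ^ n * (H / (4 * B + 4 * H))"
    proof -
      have "(4::real) ^ n = 2 ^ n * 2 ^ n" by (simp add: power_mult_distrib[symmetric])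
      then show ?thesis using h(3) by (metis mult.assoc times_divide_eq_right)
    qed
    ultimately show ?thesis by (simp only: G_def h(3))
  qed
  define e where "e = H / (4 * B + 4 * H)"
  have e: "0 < e" using H B by (simp add: e_def)
  obtain n where "G / e < 2 ^ n" using real_arch_pow[of 2 "G / e"] by auto
  then have "G < 2 ^ n * e" using e by (simp add: field_simps)
  then show False using bound[of n] by (simp add: e_def)
qed

section \<open>Preservers are powers\<close>

text \<open>Cauchy's functional equation with monotonicity in place of continuity. The Jensen
  equation makes \<phi> affine along arithmetic progressions, and monotonicity squeezes any other
  point between neighbours of a grid of mesh \<open>1 / N\<close>.\<close>

lemma monotone_jensen_affine:
  fixes \<phi> :: "real \<Rightarrow> real"
  assumes up: "\<And>x y. x \<in> I \<Longrightarrow> x \<le> y \<Longrightarrow> y \<in> I" and ne: "I \<noteq> {}"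
    and mono: "\<And>x y. x \<in> I \<Longrightarrow> x \<le> y \<Longrightarrow> \<phi> x \<le> \<phi> y"
    and jensen: "\<And>x h. 0 < h \<Longrightarrow> x - h \<in> I \<Longrightarrow> \<phi> (x + h) + \<phi> (x - h) = 2 * \<phi> x"
  obtains \<alpha> \<beta> where "0 \<le> \<alpha>" "\<And>x. x \<in> I \<Longrightarrow> \<phi> x = \<alpha> * x + \<beta>"
proof -
  have arith: "\<phi> (b + real k * h) = \<phi> b + real k * (\<phi> (b + h) - \<phi> b)" if "0 < h" "b \<in> I" for b h k
  proof (induction k rule: less_induct)
    case (less k)
    consider "k = 0" | "k = 1" | j where "k = Suc (Suc j)" by (metis One_nat_def not0_implies_Suc)
    then show ?case
    proof cases
      case 3
      have "b + real j * h \<in> I" using up[OF that(2)] that(1) by simp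
      moreover have e: "b + real (Suc j) * h + h = b + real k * h" "b + real (Suc j) * h - h = b + real j * h"
        using 3 by (simp_all add: algebra_simps)
      ultimately have "\<phi> (b + real k * h) + \<phi> (b + real j * h) = 2 * \<phi> (b + real (Suc j) * h)"
        using jensen[OF that(1), of "b + real (Suc j) * h"] by (simp only:)
      then have "\<phi> (b + real k * h) = 2 * \<phi> (b + real (Suc j) * h) - \<phi> (b + real j * h)" by linarith
      also have "\<dots> = \<phi> b + real k * (\<phi> (b + h) - \<phi> b)"
        using less.IH[of j] less.IH[of "Suc j"] 3 by (simp add: algebra_simps)
      finally show ?thesis .
    qed simp_all
  qed
  define A where "A b = \<phi> (b + 1) - \<phi> b" for b
  have line: "\<phi> x = \<phi> b + (x - b) * A b" if b: "b \<in> I" and x: "b \<le> x" for b x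
  proof -
    have A0: "0 \<le> A b" using mono[OF b, of "b + 1"] by (simp add: A_def)
    have "\<bar>\<phi> x - (\<phi> b + (x - b) * A b)\<bar> \<le> A b * inverse (real (Suc n))" for n
    proof -
      define N where "N = real (Suc n)"
      have N: "0 < N" by (simp add: N_def)
      have "\<phi> (b + real (Suc n) * (1 / N)) = \<phi> b + real (Suc n) * (\<phi> (b + 1 / N) - \<phi> b)"
        by (rule arith) (use N b in auto)
      then have Ab: "A b = N * (\<phi> (b + 1 / N) - \<phi> b)"
        unfolding A_def N_def[symmetric] using N by (simp only: times_divide_eq_right mult_1_right divide_self_if) simp
      have AN: "\<phi> (b + 1 / N) - \<phi> b = A b / N" unfolding Ab using N by simp
      define k where "k = nat \<lfloor>N * (x - b)\<rfloor>"
      have "0 \<le> N * (x - b)" using N x by simp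
      then have k: "real k \<le> N * (x - b)" "N * (x - b) \<le> real k + 1"
        unfolding k_def by linarith+
      have lo: "\<phi> (b + real k * (1 / N)) \<le> \<phi> x" and hi: "\<phi> x \<le> \<phi> (b + real (Suc k) * (1 / N))"
        using k N x b by (auto intro!: mono up[OF b] simp: field_simps)
      have e: "\<phi> (b + real j * (1 / N)) = \<phi> b + real j * (A b / N)" for j
        using arith[of "1 / N" b j] N b by (simp add: AN)
      define t where "t = A b / N"
      have t: "0 \<le> t" "N * t = A b" using A0 N by (simp_all add: t_def)
      have "N * (x - b) * t = (x - b) * (N * t)" by (simp only: mult_ac)
      then have "real k * t \<le> (x - b) * A b" "(x - b) * A b \<le> real k * t + t"
        using mult_right_mono[OF k(1) t(1)] mult_right_mono[OF k(2) t(1)] t(2)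
        by (simp_all only: distrib_right mult_1)
      moreover have "\<phi> b + real k * t \<le> \<phi> x" using lo unfolding e t_def .
      moreover have "\<phi> x \<le> \<phi> b + (real k * t + t)"
        using hi unfolding e t_def[symmetric] by (simp only: of_nat_Suc distrib_right mult_1 add.commute)
      moreover have "\<bar>p - (q + u)\<bar> \<le> t" if "r \<le> u" "u \<le> r + t" "q + r \<le> p" "p \<le> q + (r + t)"
        for p q r u
        using that by linarith
      ultimately have "\<bar>\<phi> x - (\<phi> b + (x - b) * A b)\<bar> \<le> t" by blast
      then show ?thesis by (simp add: t_def N_def divide_inverse)
    qed
    moreover have "(\<lambda>n. A b * inverse (real (Suc n))) \<longlonglongrightarrow> A b * 0"
      by (intro tendsto_intros LIMSEQ_inverse_real_of_nat)
    ultimately have "\<bar>\<phi> x - (\<phi> b + (x - b) * A b)\<bar> \<le> A b * 0"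
      by (intro LIMSEQ_le_const) auto
    then show ?thesis by simp
  qed
  have A_eq: "A b' = A b" if "b \<in> I" "b \<le> b'" for b b'
  proof -
    have "\<phi> b' = \<phi> b + (b' - b) * A b" "\<phi> (b' + 1) = \<phi> b + (b' + 1 - b) * A b"
      by (rule line; use that in simp)+
    then have "A b' = (b' + 1 - b) * A b - (b' - b) * A b" by (simp only: A_def[of b'])
    also have "\<dots> = A b" by (simp add: left_diff_distrib[symmetric])
    finally show ?thesis .
  qed
  obtain b where b: "b \<in> I" using ne by blast
  have A: "A x = A b" if "x \<in> I" for x
    using A_eq[of x b] A_eq[of b x] b that by (cases "x \<le> b") auto
  show ?thesis
  proof (rule that[of "A b" "\<phi> b - b * A b"])
    show "0 \<le> A b" using mono[OF b, of "b + 1"] by (simp add: A_def)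
    fix x assume x: "x \<in> I"
    have "\<phi> x = \<phi> b + (x - b) * A b"
    proof (cases "b \<le> x")
      case True
      then show ?thesis by (rule line[OF b])
    next
      case False
      then have "\<phi> b = \<phi> x + (b - x) * A x" by (intro line[OF x]) simp
      then show ?thesis unfolding A[OF x] by (simp add: left_diff_distrib)
    qed
    then show "\<phi> x = A b * x + (\<phi> b - b * A b)" by (simp add: algebra_simps)
  qed
qed

text \<open>Increments of a concave function decrease, so the last of \<open>N\<close> is at most
  their average. This bounds second differences by a multiple of the mesh.\<close>

lemma concave_last_increment:
  fixes \<phi> :: "real \<Rightarrow> real"
  assumes conc: "\<And>x. x - h \<in> I \<Longrightarrow> \<phi> (x + h) + \<phi> (x - h) \<le> 2 * \<phi> x"
    and up: "\<And>x y. x \<in> I \<Longrightarrow> x \<le> y \<Longrightarrow> y \<in> I"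
    and h: "0 < h" and y: "y - real N * h \<in> I"
  shows "real N * (\<phi> y - \<phi> (y - h)) \<le> \<phi> y - \<phi> (y - real N * h)"
proof -
  have I: "y - real i * h \<in> I" if "i \<le> N" for i
    by (rule up[OF y]) (use that h in simp)
  have incr: "\<phi> y - \<phi> (y - h) \<le> \<phi> (y - real i * h) - \<phi> (y - real (Suc i) * h)" if "Suc i \<le> N" for i
    using that
  proof (induction i)
    case (Suc i)
    have e: "y - real (Suc i) * h - h = y - real (Suc (Suc i)) * h" "y - real (Suc i) * h + h = y - real i * h"
      by (simp_all add: algebra_simps)
    have "\<phi> (y - real (Suc i) * h + h) + \<phi> (y - real (Suc i) * h - h) \<le> 2 * \<phi> (y - real (Suc i) * h)"
      by (rule conc, unfold e(1), rule I[OF Suc.prems])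
    then show ?case using Suc unfolding e by simp
  qed simp
  have "real i * (\<phi> y - \<phi> (y - h)) \<le> \<phi> y - \<phi> (y - real i * h)" if "i \<le> N" for i
    using that
  proof (induction i)
    case (Suc i)
    then show ?case using incr[of i] by (simp add: distrib_right)
  qed simp
  then show ?thesis by simp
qed

text \<open>The hypothesis \<open>m3\<close> squares the second difference, which is \<open>O(h)\<close> by concavity. Applying
  it twice gives \<open>O(h\<^sup>4)\<close>, while there are only \<open>O(h\<^sup>-\<^sup>2)\<close> second differences of mesh \<open>h\<close>
  in one of fixed mesh.\<close>

lemma second_difference_collapse:
  fixes \<phi> :: "real \<Rightarrow> real"
  defines "\<psi> \<equiv> \<lambda>h x. 2 * \<phi> x - \<phi> (x + h) - \<phi> (x - h)"
  assumes up: "\<And>x y. x \<in> I \<Longrightarrow> x \<le> y \<Longrightarrow> y \<in> I" and op: "\<And>x. x \<in> I \<Longrightarrow> \<exists>e>0. x - e \<in> I"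
    and mono: "\<And>x y. x \<in> I \<Longrightarrow> x \<le> y \<Longrightarrow> \<phi> x \<le> \<phi> y"
    and conc: "\<And>x h. 0 < h \<Longrightarrow> x - h \<in> I \<Longrightarrow> 0 \<le> \<psi> h x"
    and m3: "\<And>x h. 0 < h \<Longrightarrow> x - h \<in> I \<Longrightarrow> 1 - exp (- \<psi> h x) \<le> (exp (\<psi> h (x + h)) - 1)\<^sup>2"
    and H: "0 < H" and x: "x - H \<in> I"
  shows "\<psi> H x = 0"
proof -
  obtain d where d: "0 < d" "x - H - d \<in> I" using op[OF x] by blast
  define l where "l = x - H - d"
  \<comment> \<open>Bounds at \<open>y\<close> come from bounds at \<open>y + h\<close>, so two
    applications of \<open>m3\<close> shrink the right end from \<open>x + 3 * H\<close> to
    \<open>x + 2 * H\<close> and then to \<open>x + H\<close>. \<open>C0\<close> is the total rise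
    of \<phi> over the largest range, with the room \<open>d\<close> added on the left.\<close>
  define C0 where "C0 = \<phi> (x + 3 * H) - \<phi> l"
  have l: "l \<in> I" using d by (simp add: l_def)
  have C0: "0 \<le> C0" using mono[OF l, of "x + 3 * H"] H d by (simp add: C0_def l_def)
  \<comment> \<open>The \<open>N\<close> steps used below have total length
    \<open>N * h = H / 2 ^ m \<le> d\<close>, so they stay in \<open>I\<close>. As \<open>m\<close>
    is fixed, \<open>N\<close> is a fixed fraction of \<open>2 ^ n\<close>.\<close>
  obtain m where m: "H / d < 2 ^ m" using real_arch_pow[of 2 "H / d"] by auto
  define C1 where "C1 = C0 * 2 ^ m"
  have C1: "0 \<le> C1" using C0 by (simp add: C1_def)
  obtain n1 where n1: "C1 < 2 ^ n1" using real_arch_pow[of 2 C1] by auto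
  obtain n2 where n2: "8 * C1\<^sup>2 < 2 ^ n2" using real_arch_pow[of 2 "8 * C1\<^sup>2"] by auto
  \<comment> \<open>On the unit interval \<open>1 - exp (- w) \<ge> w / 2\<close> and
    \<open>exp z - 1 \<le> 2 * z\<close>; the constant is \<open>2 * 2 ^ 2\<close>.\<close>
  have small: "w \<le> 8 * z\<^sup>2"
    if "1 - exp (- w) \<le> (exp z - 1)\<^sup>2" "0 \<le> w" "w \<le> 1" "0 \<le> z" "z \<le> 1" for w z :: real
  proof -
    have "z\<^sup>2 \<le> z" using that mult_left_le_one_le[of z z] by (simp add: power2_eq_square)
    then have "exp z - 1 \<le> 2 * z" using exp_bound[of z] that by simp
    then have "(exp z - 1)\<^sup>2 \<le> (2 * z)\<^sup>2" using that by (intro power_mono) auto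
    moreover have "w / 2 \<le> 1 - exp (- w)"
    proof -
      have "exp (- w) \<le> 1 / (1 + w)"
        using that exp_ge_add_one_self[of w] by (simp add: exp_minus divide_inverse le_imp_inverse_le)
      moreover have "w / 2 \<le> 1 - 1 / (1 + w)"
        using that mult_left_le_one_le[of w w] by (simp add: field_simps)
      ultimately show ?thesis by linarith
    qed
    ultimately show ?thesis using that(1) by (simp add: power2_eq_square)
  qed
  have bound: "\<psi> H x \<le> 512 * C1 ^ 4 * inverse (4 ^ n)" if n: "m \<le> n" "n1 \<le> n" "n2 \<le> n" for n
  proof -
    define h where "h = H / 2 ^ n"
    have h: "0 < h" "2 ^ n * h = H" using H by (simp_all add: h_def)
    have hH: "h \<le> H" using H by (simp add: h_def divide_le_eq)
    define N where "N = (2::nat) ^ (n - m)"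
    have p2: "(2::real) ^ n = 2 ^ (n - m) * 2 ^ m" using n by (simp add: power_add[symmetric])
    have NH: "real N * h = H / 2 ^ m" by (simp add: N_def h_def p2)
    have N: "real N = 2 ^ n / 2 ^ m" by (simp add: N_def p2)
    have Nd: "real N * h \<le> d" unfolding NH using m d by (simp add: field_simps)
    have inI: "y - h \<in> I" if "x - H \<le> y" for y
    proof -
      have "1 \<le> real N" by (simp add: N_def)
      then have "h \<le> real N * h" using h by simp
      then have "l \<le> y - h" using that Nd by (simp add: l_def)
      then show ?thesis by (rule up[OF l])
    qed
    have first: "\<psi> h y \<le> C1 / 2 ^ n" if y: "x - H \<le> y" "y \<le> x + 3 * H" for y
    proof -
      have y_I: "y \<in> I" by (rule up[OF inI[OF y(1)]]) (use h in simp)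
      have lI: "l \<le> y - real N * h" using y Nd by (simp add: l_def)
      have "real N * (\<phi> y - \<phi> (y - h)) \<le> \<phi> y - \<phi> (y - real N * h)"
      proof (rule concave_last_increment[where I = I])
        show "\<phi> (z + h) + \<phi> (z - h) \<le> 2 * \<phi> z" if "z - h \<in> I" for z
          using conc[OF h(1) that] by (simp add: \<psi>_def)
      qed (use up h(1) up[OF l lI] in auto)
      also have "\<dots> \<le> C0"
      proof -
        have "\<phi> y \<le> \<phi> (x + 3 * H)"
          by (rule mono[OF y_I y(2)])
        moreover have "\<phi> l \<le> \<phi> (y - real N * h)" by (rule mono[OF l lI])
        ultimately show ?thesis by (simp add: C0_def)
      qed
      finally have "\<phi> y - \<phi> (y - h) \<le> C1 / 2 ^ n"
        by (simp add: N C1_def field_simps)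
      moreover have "\<phi> y \<le> \<phi> (y + h)"
        by (rule mono[OF y_I]) (use h in simp)
      ultimately show ?thesis by (simp add: \<psi>_def)
    qed
    have C1n: "C1 / 2 ^ n \<le> 1"
    proof -
      have "(2::real) ^ n1 \<le> 2 ^ n" using n by simp
      then have "C1 \<le> 2 ^ n" using n1 by linarith
      then show ?thesis by (simp add: field_simps)
    qed
    have first1: "\<psi> h y \<le> 1" if "x - H \<le> y" "y \<le> x + 3 * H" for y
      by (rule order_trans[OF first[OF that] C1n])
    have pos: "0 \<le> \<psi> h y" if "x - H \<le> y" for y by (rule conc[OF h(1) inI[OF that]])
    have second: "\<psi> h y \<le> 8 * (C1 / 2 ^ n)\<^sup>2" if y: "x - H \<le> y" "y \<le> x + 2 * H" for y
    proof -
      have "\<psi> h y \<le> 8 * (\<psi> h (y + h))\<^sup>2"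
      proof (rule small)
        show "1 - exp (- \<psi> h y) \<le> (exp (\<psi> h (y + h)) - 1)\<^sup>2"
          by (rule m3[OF h(1) inI[OF y(1)]])
        show "0 \<le> \<psi> h y" "\<psi> h y \<le> 1" "0 \<le> \<psi> h (y + h)" "\<psi> h (y + h) \<le> 1"
          using y h(1) hH H by (auto intro!: pos first1)
      qed
      also have "\<dots> \<le> 8 * (C1 / 2 ^ n)\<^sup>2"
        using y h hH pos[of "y + h"] first[of "y + h"] by (intro mult_left_mono power_mono) auto
      finally show ?thesis .
    qed
    have third: "\<psi> h y \<le> 8 * (8 * (C1 / 2 ^ n)\<^sup>2)\<^sup>2" if y: "x - H \<le> y" "y \<le> x + H" for y
    proof -
      have "\<psi> h y \<le> 8 * (\<psi> h (y + h))\<^sup>2"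
      proof (rule small)
        show "1 - exp (- \<psi> h y) \<le> (exp (\<psi> h (y + h)) - 1)\<^sup>2"
          by (rule m3[OF h(1) inI[OF y(1)]])
        show "0 \<le> \<psi> h y" "\<psi> h y \<le> 1" "0 \<le> \<psi> h (y + h)" "\<psi> h (y + h) \<le> 1"
          using y h(1) hH H by (auto intro!: pos first1)
      qed
      also have "\<dots> \<le> 8 * (8 * (C1 / 2 ^ n)\<^sup>2)\<^sup>2"
        using y h hH pos[of "y + h"] second[of "y + h"] by (intro mult_left_mono power_mono) auto
      finally show ?thesis .
    qed
    define c where "c = 8 * (8 * (C1 / 2 ^ n)\<^sup>2)\<^sup>2"
    have "4 ^ n * (- c) \<le> 2 * (- \<phi> x) - (- \<phi> (x + 2 ^ n * h)) - (- \<phi> (x - 2 ^ n * h))"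
    proof (rule second_difference_doubling[OF h(1)])
      fix y assume "\<bar>y - x\<bar> < 2 ^ n * h"
      then have "\<psi> h y \<le> c" unfolding c_def h by (intro third) auto
      then show "- c \<le> 2 * - \<phi> y - - \<phi> (y + h) - - \<phi> (y - h)" by (simp add: \<psi>_def)
    qed
    then have "\<psi> H x \<le> 4 ^ n * c" by (simp add: \<psi>_def h)
    also have "\<dots> = 512 * C1 ^ 4 * inverse (4 ^ n)"
    proof -
      have "(4::real) ^ n = (2 ^ n)\<^sup>2" by (simp add: power2_eq_square power_mult_distrib[symmetric])
      then show ?thesis by (simp add: c_def power_divide power2_eq_square power4_eq_xxxx field_simps)
    qed
    finally show ?thesis .
  qed
  have "(\<lambda>n. inverse ((4::real) ^ n)) \<longlonglongrightarrow> 0"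
    by (rule LIMSEQ_inverse_realpow_zero) simp
  then have "(\<lambda>n. 512 * C1 ^ 4 * inverse (4 ^ n)) \<longlonglongrightarrow> 512 * C1 ^ 4 * 0"
    by (intro tendsto_intros)
  then have "\<psi> H x \<le> 512 * C1 ^ 4 * 0"
  proof (rule LIMSEQ_le_const)
    show "\<exists>N. \<forall>n\<ge>N. \<psi> H x \<le> 512 * C1 ^ 4 * inverse (4 ^ n)"
      by (intro exI[of _ "max m (max n1 n2)"] allI impI bound) auto
  qed
  then show ?thesis using conc[OF H x] by simp
qed

section \<open>Excluded exponents\<close>

text \<open>The weights 1, -3, 2 at \<open>x\<close>, \<open>x / 2\<close>, \<open>x / 4\<close>
  annihilate constants and linear terms and give \<open>1 - 3/4 + 2/16 = 3/8\<close> on squares,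
  which multiplies the Taylor coefficient
  \<open>\<alpha> * (\<alpha> - 1) / 2 * p ^ 2\<close>.\<close>

lemma powr_second_difference_limit:
  fixes p \<alpha> :: real
  shows "((\<lambda>x. ((1 - p * x) powr \<alpha> - 3 * (1 - p * x / 2) powr \<alpha> + 2 * (1 - p * x / 4) powr \<alpha>) / x\<^sup>2)
    \<longlongrightarrow> 3 * (\<alpha> * (p * (p * (\<alpha> - 1)))) / 16) (at_right 0)"
  by real_asymp

lemma powr_first_difference_limit:
  fixes p \<alpha> :: real
  shows "((\<lambda>x. ((1 - p * x / 2) powr \<alpha> - (1 - p * x / 4) powr \<alpha>) / x) \<longlongrightarrow> - (\<alpha> * p / 4)) (at_right 0)"
  by real_asymp

lemma powr_value_limit:
  fixes p \<alpha> :: real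
  shows "((\<lambda>x. (1 - p * x / 4) powr \<alpha>) \<longlongrightarrow> 1) (at_right 0)"
  by real_asymp

text \<open>The numbers 8, -14, 7 are the Lagrange weights that extrapolate a quadratic from the
  nodes 1/4, 1/2, 1 to 2. They sum to 1, so the difference vanishes at \<open>a = 0\<close>.\<close>

lemma extrapolation_limit:
  fixes \<alpha> :: real
  shows "((\<lambda>a. (exp (- 2 * \<alpha> * a * ln 2) * (1 + a / 2) powr \<alpha> -
      (8 * (1 + 3 * a / 4) powr \<alpha> - 14 * (1 + a / 2) powr \<alpha> + 7)) / a) \<longlongrightarrow> 3 * \<alpha> / 2 - 2 * \<alpha> * ln 2) (at_right 0)"
  by real_asymp

section \<open>Minors of order 4 and the exponents above 1\<close>

definition det4 :: "(nat \<Rightarrow> real) \<Rightarrow> (nat \<Rightarrow> real) \<Rightarrow> (nat \<Rightarrow> real) \<Rightarrow> (nat \<Rightarrow> real) \<Rightarrow> real" where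
  "det4 r p q s = Determinant.det (Matrix.mat 4 4 (\<lambda>(i, j). [r j, p j, q j, s j] ! i))"

lemma det4_expand:
  "det4 r p q s =
    r 0 * (p 1 * (q 2 * s 3 - q 3 * s 2) - p 2 * (q 1 * s 3 - q 3 * s 1) + p 3 * (q 1 * s 2 - q 2 * s 1))
    - r 1 * (p 0 * (q 2 * s 3 - q 3 * s 2) - p 2 * (q 0 * s 3 - q 3 * s 0) + p 3 * (q 0 * s 2 - q 2 * s 0))
    + r 2 * (p 0 * (q 1 * s 3 - q 3 * s 1) - p 1 * (q 0 * s 3 - q 3 * s 0) + p 3 * (q 0 * s 1 - q 1 * s 0))
    - r 3 * (p 0 * (q 1 * s 2 - q 2 * s 1) - p 1 * (q 0 * s 2 - q 2 * s 0) + p 2 * (q 0 * s 1 - q 1 * s 0))"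
  unfolding det4_def det_mat_4 det_mat_3
  by (simp add: insert_index_def lessThan_Suc numeral_eq_Suc)

lemma det4_row_ops:
  assumes "e \<noteq> 0"
  shows "det4 r (\<lambda>j. (p j - 3 * q j + 2 * s j) / e\<^sup>2) (\<lambda>j. (q j - s j) / e) s = det4 r p q s / e ^ 3"
  unfolding det4_expand using assms by (simp add: field_simps power2_eq_square power3_eq_cube)

text \<open>Expansion along the first row leaves Vandermonde minors in the nodes 1/4, 1/2, 1, 2.
  That of \<open>r 3\<close> is 3/32 up to the factor \<open>A * B\<close>, and relative to it the
  others are Lagrange weights.\<close>

lemma det4_geometric:
  "det4 r (\<lambda>j. A * (2 ^ j / 4)\<^sup>2) (\<lambda>j. B * (2 ^ j / 4)) (\<lambda>j. 1) =
    3 / 32 * (A * B) * (r 3 - (8 * r 0 - 14 * r 1 + 7 * r 2))"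
  unfolding det4_expand by (simp add: power2_eq_square field_simps)

text \<open>In the variable \<open>exp (- (x - y))\<close> the kernel is, up to positive factors, \<open>(1 - p * q) powr \<alpha>\<close>
  for \<open>q \<le> 1\<close>. Three rows far out become the monomials 1, \<open>q\<close>, \<open>q\<^sup>2\<close> with coefficients of known
  sign, so the minor compares the value at \<open>q = 2\<close> with the quadratic extrapolation from
  \<open>q = 1/4, 1/2, 1\<close>. The comparison fails to first order in \<open>a\<close> because \<open>ln 2 < 3/4\<close>.\<close>

lemma powr_gt_1_excluded:
  fixes \<alpha> :: real
  assumes \<alpha>: "1 < \<alpha>"
    and tn: "\<And>a. 0 < a \<Longrightarrow> totally_nonneg (\<lambda>k::int.
      (exp (- a * \<bar>ln 2 * k\<bar>) * (1 + a - a * exp (- \<bar>ln 2 * k\<bar>))) powr \<alpha>)"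
  shows False
proof -
  have main: "exp (- 2 * \<alpha> * a * ln 2) * (1 + a / 2) powr \<alpha> \<le>
      8 * (1 + 3 * a / 4) powr \<alpha> - 14 * (1 + a / 2) powr \<alpha> + 7" if a: "0 < a" for a
  proof -
    define s where "s k = (exp (- a * \<bar>ln 2 * real_of_int k\<bar>) * (1 + a - a * exp (- \<bar>ln 2 * real_of_int k\<bar>))) powr \<alpha>" for k
    \<comment> \<open>The exponential cancels the decay of \<open>s\<close> for k \<ge> 0. For
      negative \<open>k\<close> it doubles the decay, whence the factor 2 in the exponent of
      \<open>b (- 1)\<close>.\<close>
    define b where "b k = exp (\<alpha> * a * ln 2 * real_of_int k) * s k" for k
    have b: "totally_nonneg b"
      unfolding b_def s_def by (rule totally_nonneg_exp_mult_int[OF tn[OF a]])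
    have bn: "b (int k) = (1 + a - a * (1 / 2) ^ k) powr \<alpha>" for k
    proof -
      have e: "exp (- \<bar>ln 2 * real_of_int (int k)\<bar>) = (1 / 2) ^ k"
        by (simp add: exp_minus mult.commute[of "ln 2"] exp_of_nat_mult power_one_over inverse_eq_divide)
      have p: "0 \<le> 1 + a - a * (1 / 2) ^ k"
      proof -
        have "a * (1 / 2) ^ k \<le> a * 1" using a by (intro mult_left_mono) (auto simp: power_le_one)
        then show ?thesis by simp
      qed
      have "s (int k) = exp (- a * \<bar>ln 2 * real_of_int (int k)\<bar>) powr \<alpha> * (1 + a - a * (1 / 2) ^ k) powr \<alpha>"
        unfolding s_def e using p by (simp add: powr_mult)
      also have "exp (- a * \<bar>ln 2 * real_of_int (int k)\<bar>) powr \<alpha> = exp (- (\<alpha> * a * ln 2 * real_of_int (int k)))"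
        by (simp add: powr_def mult_ac)
      finally show ?thesis by (simp add: b_def exp_minus)
    qed
    have bm: "b (- 1) = exp (- 2 * \<alpha> * a * ln 2) * (1 + a / 2) powr \<alpha>"
    proof -
      have "s (- 1) = exp (- a * ln 2) powr \<alpha> * (1 + a / 2) powr \<alpha>"
        unfolding s_def using a by (simp add: powr_mult exp_minus add.commute)
      also have "exp (- a * ln 2) powr \<alpha> = exp (- (\<alpha> * a * ln 2))"
        by (simp add: powr_def mult_ac)
      finally show ?thesis by (simp add: b_def exp_minus exp_add[symmetric] algebra_simps flip: exp_minus)
    qed
    \<comment> \<open>Column \<open>j\<close> belongs to the node \<open>v j\<close>. Taking
      \<open>1 + a\<close> out of \<open>1 + a - a * v j * x\<close> leaves
      \<open>1 - p * v j * x\<close>.\<close>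
    define v where "v j = 2 ^ j / (4::real)" for j :: nat
    define r where "r j = b (2 - int j)" for j
    define p where "p = a / (1 + a)"
    define w where "w x j = (1 - p * v j * x) powr \<alpha>" for x j
    have det_nonneg: "0 \<le> det4 r (w x) (w (x / 2)) (w (x / 4))" if x: "x = (1 / 2) ^ Suc M" for x M
    proof -
      \<comment> \<open>Row 0 reads \<open>b\<close> at 2, 1, 0, -1, so only its last entry leaves
        the range of the formula \<open>bn\<close>. The other three rows move out with
        \<open>M\<close>, that is, \<open>x\<close> tends to 0.\<close>
      define X where "X i = (if i = 0 then 0 else int (M + i))" for i
      define Y where "Y j = int j - 2" for j
      have "strict_mono_on {..<4} X" "strict_mono_on {..<4} Y"
        by (auto simp: strict_mono_on_def X_def Y_def)
      then have "0 \<le> Determinant.det (Matrix.mat 4 4 (\<lambda>(i, j). b (X i - Y j)))"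
        by (rule totally_nonnegD[OF b])
      also have "Matrix.mat 4 4 (\<lambda>(i, j). b (X i - Y j)) =
          Matrix.mat 4 4 (\<lambda>(i, j). [r j, (1 + a) powr \<alpha> * w x j, (1 + a) powr \<alpha> * w (x / 2) j,
            (1 + a) powr \<alpha> * w (x / 4) j] ! i)" (is "_ = Matrix.mat 4 4 ?R")
      proof (rule eq_matI)
        fix i j assume "i < dim_row (Matrix.mat 4 4 ?R)" "j < dim_col (Matrix.mat 4 4 ?R)"
        then have i: "i < 4" and j: "j < 4" by auto
        have row: "b (X (Suc i') - Y j) = (1 + a) powr \<alpha> * w (x / 2 ^ i') j" if "i' < 3" for i'
        proof -
          have "X (Suc i') - Y j = int (M + (i' + 3 - j))"
            using j by (simp add: X_def Y_def of_nat_diff)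
          moreover have e: "(1 / 2 :: real) ^ (M + (i' + 3 - j)) = v j * (x / 2 ^ i')"
          proof -
            have "(1 / 2 :: real) ^ (i' + 3 - j) * (1 / 2) ^ j = (1 / 2) ^ i' * (1 / 2) ^ 3"
              using j by (simp only: power_add[symmetric]) simp
            then have "(1 / 2 :: real) ^ (i' + 3 - j) = 2 ^ j / 8 / 2 ^ i'"
              by (simp add: field_simps power_one_over)
            then show ?thesis by (simp add: v_def x power_add)
          qed
          ultimately have "b (X (Suc i') - Y j) = (1 + a - a * (v j * (x / 2 ^ i'))) powr \<alpha>"
            using bn[of "M + (i' + 3 - j)"] by simp
          also have "1 + a - a * (v j * (x / 2 ^ i')) = (1 + a) * (1 - p * v j * (x / 2 ^ i'))"
          proof -
            have "(1 + a) * p = a" using a by (simp add: p_def)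
            then show ?thesis by (simp add: right_diff_distrib mult.assoc[symmetric])
          qed
          also have "\<dots> powr \<alpha> = (1 + a) powr \<alpha> * w (x / 2 ^ i') j"
          proof -
            have "v j * (x / 2 ^ i') \<le> 1" unfolding e[symmetric] by (simp add: power_le_one)
            moreover have "0 \<le> p" "p \<le> 1" using a by (auto simp: p_def)
            ultimately have "p * (v j * (x / 2 ^ i')) \<le> 1 * 1"
              by (intro mult_mono) (auto simp: v_def x)
            then show ?thesis using a by (simp add: w_def powr_mult mult.assoc)
          qed
          finally show ?thesis .
        qed
        consider "i = 0" | "i = Suc 0" | "i = Suc 1" | "i = Suc 2" using i by linarith
        then have "b (X i - Y j) = ?R (i, j)"
        proof cases
          case 1
          then show ?thesis by (simp add: r_def X_def Y_def)
        next
          case 2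
          then show ?thesis using row[of 0] by simp
        next
          case 3
          then show ?thesis using row[of 1] by simp
        next
          case 4
          then show ?thesis using row[of 2] by (simp add: numeral_2_eq_2)
        qed
        then show "Matrix.mat 4 4 (\<lambda>(i, j). b (X i - Y j)) $$ (i, j) = Matrix.mat 4 4 ?R $$ (i, j)"
          using i j by simp
      qed auto
      finally have "0 \<le> det4 r (\<lambda>j. (1 + a) powr \<alpha> * w x j) (\<lambda>j. (1 + a) powr \<alpha> * w (x / 2) j)
          (\<lambda>j. (1 + a) powr \<alpha> * w (x / 4) j)" by (simp add: det4_def)
      also have "\<dots> = ((1 + a) powr \<alpha>) ^ 3 * det4 r (w x) (w (x / 2)) (w (x / 4))"
        unfolding det4_expand by (simp add: algebra_simps power3_eq_cube)
      finally show ?thesis using a by (simp add: zero_le_mult_iff)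
    qed
    define q where "q j = p * v j" for j
    define E where "E x = det4 r (\<lambda>j. ((1 - q j * x) powr \<alpha> - 3 * (1 - q j * x / 2) powr \<alpha> + 2 * (1 - q j * x / 4) powr \<alpha>) / x\<^sup>2)
      (\<lambda>j. ((1 - q j * x / 2) powr \<alpha> - (1 - q j * x / 4) powr \<alpha>) / x) (\<lambda>j. (1 - q j * x / 4) powr \<alpha>)" for x
    define L where "L = det4 r (\<lambda>j. 3 * (\<alpha> * (q j * (q j * (\<alpha> - 1)))) / 16) (\<lambda>j. - (\<alpha> * q j / 4)) (\<lambda>j. 1)"
    have "(E \<longlongrightarrow> L) (at_right 0)"
      unfolding E_def L_def det4_expand
      by (intro tendsto_intros powr_second_difference_limit powr_first_difference_limit powr_value_limit)
    moreover have "filterlim (\<lambda>M. (1 / 2 :: real) ^ Suc M) (at_right 0) sequentially"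
      by real_asymp
    ultimately have "(\<lambda>M. E ((1 / 2) ^ Suc M)) \<longlonglongrightarrow> L"
      by (rule filterlim_compose)
    moreover have "0 \<le> E ((1 / 2) ^ Suc M)" for M
    proof -
      define x :: real where "x = (1 / 2) ^ Suc M"
      have x0: "0 < x" by (simp add: x_def)
      have w: "w x j = (1 - q j * x) powr \<alpha>" "w (x / 2) j = (1 - q j * x / 2) powr \<alpha>"
        "w (x / 4) j = (1 - q j * x / 4) powr \<alpha>" for j
        by (simp_all add: w_def q_def)
      have "E x = det4 r (w x) (w (x / 2)) (w (x / 4)) / x ^ 3"
        using det4_row_ops[of x r "w x" "w (x / 2)" "w (x / 4)"] x0 unfolding E_def w by simp
      then show ?thesis using det_nonneg[OF x_def] x0 by (simp add: x_def)
    qed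
    ultimately have "0 \<le> L" by (intro LIMSEQ_le_const) auto
    define t where "t = \<alpha> - 1"
    define A where "A = 3 / 16 * \<alpha> * t * p\<^sup>2"
    define B where "B = \<alpha> * p / 4"
    have "L = det4 r (\<lambda>j. A * (2 ^ j / 4)\<^sup>2) (\<lambda>j. - B * (2 ^ j / 4)) (\<lambda>j. 1)"
      unfolding L_def A_def B_def q_def v_def t_def[symmetric] by (simp add: power2_eq_square mult_ac)
    \<comment> \<open>The first-difference row enters with a negative sign and the second-difference
      row with the sign of \<alpha> - 1, so \<open>L \<ge> 0\<close> bounds \<open>r 3\<close> above
      by its extrapolation.\<close>
    then have L: "L = - (3 / 32 * (A * B)) * (r 3 - (8 * r 0 - 14 * r 1 + 7 * r 2))"
      unfolding det4_geometric by simp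
    have pos: "0 < 3 / 32 * (A * B)" unfolding A_def B_def p_def t_def using a \<alpha> by simp
    have "r 3 - (8 * r 0 - 14 * r 1 + 7 * r 2) \<le> 0"
    proof (rule ccontr)
      assume "\<not> ?thesis"
      then have "0 < 3 / 32 * (A * B) * (r 3 - (8 * r 0 - 14 * r 1 + 7 * r 2))"
        by (intro mult_pos_pos[OF pos]) simp
      then have "L < 0" unfolding L by (simp only: mult_minus_left neg_less_0_iff_less)
      then show False using \<open>0 \<le> L\<close> by simp
    qed
    then have "r 3 \<le> 8 * r 0 - 14 * r 1 + 7 * r 2" by simp
    moreover have "r 0 = (1 + 3 * a / 4) powr \<alpha>" "r 1 = (1 + a / 2) powr \<alpha>" "r 2 = 1"
      using bn[of 2] bn[of 1] bn[of 0] by (simp_all add: r_def power2_eq_square add.commute)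
    ultimately show ?thesis using bm by (simp add: r_def)
  qed
  define D where "D a = (exp (- 2 * \<alpha> * a * ln 2) * (1 + a / 2) powr \<alpha> -
      (8 * (1 + 3 * a / 4) powr \<alpha> - 14 * (1 + a / 2) powr \<alpha> + 7)) / a" for a :: real
  have "(D \<longlongrightarrow> 3 * \<alpha> / 2 - 2 * \<alpha> * ln 2) (at_right 0)"
    unfolding D_def by (rule extrapolation_limit)
  then have "3 * \<alpha> / 2 - 2 * \<alpha> * ln 2 \<le> 0"
  proof (rule tendsto_upperbound)
    show "\<forall>\<^sub>F a in at_right 0. D a \<le> 0"
      using eventually_at_right_less[of 0]
    proof eventually_elim
      case (elim a)
      then show ?case using main[of a] by (simp add: D_def divide_le_0_iff)
    qed
  qed simp
  moreover have "ln 2 < (3 / 4 :: real)"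
  proof -
    have "2 < exp (3 / 4 :: real)" using exp_lower_Taylor_quadratic[of "3 / 4"] by (simp add: power2_eq_square)
    then show ?thesis by (metis exp_gt_zero ln_exp ln_less_cancel_iff zero_less_numeral)
  qed
  then have "0 < \<alpha> * (3 / 4 - ln 2)" using \<alpha> by simp
  ultimately show False by (simp add: algebra_simps)
qed

text \<open>Without its exponential factor, and shifted by one, the sequence is a multiple of
  \<open>(k + 1) powr \<alpha>\<close>. The minor of order 3 then requires
  \<open>2 * 3 powr \<alpha> \<le> 2 powr \<alpha> + 4 powr \<alpha>\<close>, against the strict
  concavity of the power.\<close>

lemma powr_less_1_excluded:
  fixes \<alpha> :: real
  assumes \<alpha>: "0 < \<alpha>" "\<alpha> < 1"
    and tn: "totally_nonneg (\<lambda>k::int. (if 0 \<le> k then k * exp (- k) else 0) powr \<alpha>)"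
  shows False
proof -
  define a where "a k = (if 0 \<le> k then real_of_int k * exp (- real_of_int k) else 0) powr \<alpha>" for k
  define b where "b k = exp (\<alpha> * real_of_int k) * a (k + 1)" for k
  have "totally_nonneg (\<lambda>k. a (k + 1))"
    by (rule totally_nonneg_transfer[of a "\<lambda>k. k + 1" id])
      (use tn in \<open>auto simp: a_def[abs_def] strict_mono_def algebra_simps\<close>)
  then have b: "totally_nonneg b" unfolding b_def by (rule totally_nonneg_exp_mult_int)
  have bk: "b (int k) = exp (- \<alpha>) * real (Suc k) powr \<alpha>" for k
  proof -
    have "a (int k + 1) = real (Suc k) powr \<alpha> * exp (- real (Suc k)) powr \<alpha>"
    proof -
      have "real_of_int (int k + 1) = real (Suc k)" by simp
      then show ?thesis by (simp only: a_def) (simp add: powr_mult del: of_nat_Suc)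
    qed
    also have "exp (- real (Suc k)) powr \<alpha> = exp (- \<alpha> * real k) * exp (- \<alpha>)"
      by (simp add: powr_def exp_add[symmetric] algebra_simps)
    finally show ?thesis by (simp add: b_def exp_minus)
  qed
  have "b (- 1) = 0" by (simp add: b_def a_def)
  then have "2 * b 0 * b 1 * b 2 \<le> b 1 ^ 3 + (b 0)\<^sup>2 * b 3" by (rule totally_nonneg_minor3[OF b])
  moreover have "b 0 = exp (- \<alpha>)" "b 1 = exp (- \<alpha>) * 2 powr \<alpha>" "b 2 = exp (- \<alpha>) * 3 powr \<alpha>"
    "b 3 = exp (- \<alpha>) * (2 powr \<alpha> * 2 powr \<alpha>)"
    using bk[of 0] bk[of 1] bk[of 2] bk[of 3] by (simp_all add: powr_mult[symmetric])
  ultimately have "exp (- \<alpha>) ^ 3 * (2 powr \<alpha> * (2 * 3 powr \<alpha>)) \<le>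
      exp (- \<alpha>) ^ 3 * (2 powr \<alpha> * (2 powr \<alpha> * 2 powr \<alpha> + 2 powr \<alpha>))"
    by (simp add: power2_eq_square power3_eq_cube algebra_simps)
  then have le: "2 * 3 powr \<alpha> \<le> 2 powr \<alpha> * 2 powr \<alpha> + 2 powr \<alpha>"
    by simp
  have four: "2 powr \<alpha> * 2 powr \<alpha> = 4 powr \<alpha>" by (simp add: powr_mult[symmetric])
  have d: "((\<lambda>x. x powr \<alpha>) has_real_derivative \<alpha> * x powr (\<alpha> - 1)) (at x)" if "0 < x" for x
    using that by (auto intro!: derivative_eq_intros)
  obtain y where y: "2 < y" "y < 3" "3 powr \<alpha> - 2 powr \<alpha> = (3 - 2) * (\<alpha> * y powr (\<alpha> - 1))"
    using MVT2[of 2 3 "\<lambda>x. x powr \<alpha>" "\<lambda>x. \<alpha> * x powr (\<alpha> - 1)"] d by auto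
  obtain z where z: "3 < z" "z < 4" "4 powr \<alpha> - 3 powr \<alpha> = (4 - 3) * (\<alpha> * z powr (\<alpha> - 1))"
    using MVT2[of 3 4 "\<lambda>x. x powr \<alpha>" "\<lambda>x. \<alpha> * x powr (\<alpha> - 1)"] d by auto
  have "z powr (\<alpha> - 1) < y powr (\<alpha> - 1)" using y z \<alpha> by (intro powr_less_mono2_neg) auto
  then have "\<alpha> * z powr (\<alpha> - 1) < \<alpha> * y powr (\<alpha> - 1)" using \<alpha> by simp
  then have "4 powr \<alpha> - 3 powr \<alpha> < 3 powr \<alpha> - 2 powr \<alpha>" using y(3) z(3) by simp
  then show False using le four by linarith
qed

section \<open>Classification\<close>

text \<open>Moving inward from positions -2 and 0 of the jump to -1 twice gives
  \<open>F x \<le> F 0\<close>; moving from both sides of an isolated peak onto the peak gives the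
  converse.\<close>

lemma preserver_const_if_nonzero_at_0:
  fixes F :: "real \<Rightarrow> real"
  assumes nn: "\<And>x. 0 \<le> x \<Longrightarrow> 0 \<le> F x" and F0: "F 0 \<noteq> 0"
    and step: "\<And>c. 0 < c \<Longrightarrow> totally_nonneg (\<lambda>k::int. F (c * (if 0 \<le> k then exp (- real_of_int k) else 0)))"
    and single: "\<And>c. 0 < c \<Longrightarrow> totally_nonneg (\<lambda>k::int. F (c * (if k = 0 then 1 else 0)))"
    and x: "0 \<le> x"
  shows "F x = F 0"
proof (cases "x = 0")
  case False
  then have x: "0 < x" using x by simp
  have F0: "0 < F 0" using nn[of 0] F0 by simp
  have "F 0 * F x \<le> F 0 * F 0"
    using totally_nonneg_inward[OF step[OF x], of 1 0 "- 2"] by simp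
  moreover have "F 0 * F 0 \<le> F x * F x"
    using totally_nonneg_inward[OF single[OF x], of 1 1 "- 1"] by simp
  ultimately show ?thesis
    using F0 nn[of x] x mult_strict_mono[of "F x" "F 0" "F x" "F 0"] by force
qed simp

lemma preserver_power:
  fixes F :: "real \<Rightarrow> real"
  assumes nn: "\<And>x. 0 \<le> x \<Longrightarrow> 0 \<le> F x" and F0: "F 0 = 0"
    and pff: "\<And>\<Lambda> h. polya_frequency_function \<Lambda> \<Longrightarrow> 0 < h \<Longrightarrow> totally_nonneg (\<lambda>k::int. F (\<Lambda> (h * k)))"
    and nz: "0 \<le> x\<^sub>0" "F x\<^sub>0 \<noteq> 0"
  obtains c \<alpha> where "0 < c" "0 \<le> \<alpha>" "\<And>x. 0 < x \<Longrightarrow> F x = c * x powr \<alpha>"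
proof -
  define G where "G u = F (exp u)" for u
  define \<phi> where "\<phi> u = ln (G u)" for u
  have G0: "0 \<le> G u" for u by (simp add: G_def nn)
  have mono: "G u \<le> G v" if "u < v" for u v
  proof -
    have "totally_nonneg (\<lambda>k::int. F (exp v * exp (- \<bar>(v - u) * k\<bar>)))"
      by (rule pff[OF polya_frequency_symmetric_exp]) (use that in auto)
    from totally_nonneg_inward[OF this, of 1 1 "- 1"] that
    have "G u * G u \<le> G v * G v" by (simp add: G_def exp_add[symmetric])
    then show ?thesis using G0[of v] by (metis G0 power2_eq_square power2_le_imp_le)
  qed
  define a where "a u h k = F (exp u * (if 0 \<le> h * real_of_int k then exp (- (h * real_of_int k)) else 0))" for u h k
  have a: "totally_nonneg (a u h)" if "0 < h" for u h
    unfolding a_def by (rule pff[OF polya_frequency_onesided_exp that]) simp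
  have ak: "a u h (int k) = G (u - h * real k)" if "0 < h" for u h k
    using that by (simp add: a_def G_def exp_diff exp_minus divide_inverse zero_le_mult_iff)
  have a_neg: "a u h (- 1) = 0" if "0 < h" for u h
    using that F0 by (simp add: a_def)
  have conc: "G (u + h) * G (u - h) \<le> (G u)\<^sup>2" if "0 < h" for u h
  proof -
    have "a (u + h) h 0 * a (u + h) h 2 \<le> a (u + h) h 1 * a (u + h) h 1"
      using totally_nonneg_inward[OF a[OF that], of 1 2 0] by simp
    then show ?thesis
      using ak[OF that, of "u + h" 0] ak[OF that, of "u + h" 1] ak[OF that, of "u + h" 2]
      by (simp add: power2_eq_square algebra_simps)
  qed
  have m3: "2 * G (u + 2 * h) * G (u + h) * G u \<le> G (u + h) ^ 3 + (G (u + 2 * h))\<^sup>2 * G (u - h)" if "0 < h" for u h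
    using totally_nonneg_minor3[OF a a_neg, OF that that, of "u + 2 * h"] ak[OF that, of "u + 2 * h" 0]
      ak[OF that, of "u + 2 * h" 1] ak[OF that, of "u + 2 * h" 2] ak[OF that, of "u + 2 * h" 3]
    by (simp add: algebra_simps)
  \<comment> \<open>Positivity is required at a strictly smaller point so that \<open>I\<close> is
    open to the left, as the collapse of second differences needs.\<close>
  define I where "I = {u. \<exists>v<u. 0 < G v}"
  have I_pos: "0 < G u" if "u \<in> I" for u
    using that mono by (fastforce simp: I_def)
  have I_up: "v \<in> I" if "u \<in> I" "u \<le> v" for u v
    using that by (force simp: I_def)
  have I_open: "\<exists>e>0. u - e \<in> I" if "u \<in> I" for u
  proof -
    have "\<exists>v<u. 0 < G v" using that by (simp add: I_def)
    then obtain v where "v < u" "0 < G v" by blast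
    then show ?thesis by (intro exI[of _ "(u - v) / 2"]) (auto simp: I_def field_simps intro!: exI[of _ v])
  qed
  have "x\<^sub>0 \<noteq> 0" using nz F0 by auto
  then have "0 < G (ln x\<^sub>0)" using nz nn[of x\<^sub>0] by (simp add: G_def less_le)
  then have I_ne: "ln x\<^sub>0 + 1 \<in> I" by (auto simp: I_def intro!: exI[of _ "ln x\<^sub>0"])
  have exp_\<phi>: "G u = exp (\<phi> u)" if "u \<in> I" for u using I_pos[OF that] by (simp add: \<phi>_def)
  have \<phi>_mono: "\<phi> u \<le> \<phi> v" if "u \<in> I" "u \<le> v" for u v
  proof (cases "u = v")
    case False
    then show ?thesis using mono[of u v] I_pos[of u] that by (simp add: \<phi>_def)
  qed simp
  have \<psi>_nn: "0 \<le> 2 * \<phi> u - \<phi> (u + h) - \<phi> (u - h)" if "0 < h" "u - h \<in> I" for u h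
  proof -
    have I: "u \<in> I" "u + h \<in> I" using that by (auto intro: I_up)
    have "exp (\<phi> (u + h) + \<phi> (u - h)) \<le> exp (2 * \<phi> u)"
      using conc[OF that(1), of u] that I by (simp add: exp_\<phi> exp_add exp_double)
    then show ?thesis by simp
  qed
  have \<psi>_sq: "1 - exp (- (2 * \<phi> u - \<phi> (u + h) - \<phi> (u - h))) \<le>
      (exp (2 * \<phi> (u + h) - \<phi> (u + h + h) - \<phi> (u + h - h)) - 1)\<^sup>2" if "0 < h" "u - h \<in> I" for u h
  proof -
    have I: "u \<in> I" "u + h \<in> I" "u + 2 * h \<in> I" using that by (auto intro: I_up)
    \<comment> \<open>Dividing the minor \<open>m3\<close> by \<open>G (u + h) ^ 3\<close> turns it
      into \<open>2 * p \<le> 1 + p ^ 2 * q\<close>, that is,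
      \<open>p ^ 2 * (1 - q) \<le> (1 - p) ^ 2\<close>.\<close>
    define p where "p = exp (- (2 * \<phi> (u + h) - \<phi> (u + 2 * h) - \<phi> u))"
    define q where "q = exp (- (2 * \<phi> u - \<phi> (u + h) - \<phi> (u - h)))"
    have e: "u + h + h = u + 2 * h" "u + h - h = u" by simp_all
    have "2 * exp (\<phi> (u + 2 * h) + \<phi> (u + h) + \<phi> u) \<le> exp (3 * \<phi> (u + h)) + exp (2 * \<phi> (u + 2 * h) + \<phi> (u - h))"
      using m3[OF that(1), of u] that I by (simp add: exp_\<phi> exp_add exp_double exp_of_nat_mult[of 3, simplified])
    then have "exp (- (3 * \<phi> (u + h))) * (2 * exp (\<phi> (u + 2 * h) + \<phi> (u + h) + \<phi> u)) \<le>
        exp (- (3 * \<phi> (u + h))) * (exp (3 * \<phi> (u + h)) + exp (2 * \<phi> (u + 2 * h) + \<phi> (u - h)))"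
      by (intro mult_left_mono) auto
    then have "2 * p \<le> 1 + p\<^sup>2 * q"
      by (simp add: p_def q_def exp_add[symmetric] exp_double[symmetric] algebra_simps power2_eq_square)
    then have "p\<^sup>2 * (1 - q) \<le> p\<^sup>2 * (inverse p - 1)\<^sup>2"
      by (simp add: p_def power2_eq_square algebra_simps)
    moreover have "0 < p\<^sup>2" by (simp add: p_def)
    ultimately have "1 - q \<le> (inverse p - 1)\<^sup>2" by (simp only: mult_le_cancel_left_pos)
    then show ?thesis unfolding e by (simp add: p_def q_def exp_minus[symmetric])
  qed
  obtain \<alpha> \<beta> where \<alpha>: "0 \<le> \<alpha>" and \<phi>_affine: "\<And>u. u \<in> I \<Longrightarrow> \<phi> u = \<alpha> * u + \<beta>"
  proof (rule monotone_jensen_affine[of I \<phi>])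
    show "\<phi> (u + h) + \<phi> (u - h) = 2 * \<phi> u" if "0 < h" "u - h \<in> I" for u h
    proof -
      have "2 * \<phi> u - \<phi> (u + h) - \<phi> (u - h) = 0"
        by (rule second_difference_collapse[of I, OF _ _ _ _ _ that])
          (rule I_up I_open \<phi>_mono \<psi>_nn \<psi>_sq; assumption)+
      then show ?thesis by simp
    qed
  qed (use I_ne I_up \<phi>_mono in auto)
  \<comment> \<open>If \<open>I\<close> had an infimum \<sigma>, the minor with points \<sigma> + 5,
    \<sigma> + 3, \<sigma> + 1, \<sigma> - 1 would lose its last term, while the affine logarithm
    makes the left-hand side twice the cube on the right.\<close>
  have "u \<in> I" for u
  proof (rule ccontr)
    assume "u \<notin> I"
    then have below: "u < v" if "v \<in> I" for v using I_up[OF that, of u] by force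
    define \<sigma> where "\<sigma> = Inf I"
    have bdd: "bdd_below I" using below by (intro bdd_belowI[of _ u]) (auto intro: less_imp_le)
    have in_I: "v \<in> I" if "\<sigma> < v" for v
    proof -
      have "I \<noteq> {}" "Inf I < v" using I_ne that by (auto simp: \<sigma>_def)
      then obtain w where "w \<in> I" "w < v" using cInf_lessD[of I v] by blast
      then show ?thesis using I_up by simp
    qed
    have "G (\<sigma> - 1) = 0"
    proof (rule ccontr)
      assume "G (\<sigma> - 1) \<noteq> 0"
      then have "0 < G (\<sigma> - 1)" using G0[of "\<sigma> - 1"] by simp
      then have "\<sigma> - 1 / 2 \<in> I" by (auto simp: I_def intro!: exI[of _ "\<sigma> - 1"])
      from cInf_lower[OF this bdd] show False by (simp add: \<sigma>_def)
    qed
    then have "2 * G (\<sigma> + 5) * G (\<sigma> + 3) * G (\<sigma> + 1) \<le> G (\<sigma> + 3) ^ 3"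
      using m3[of 2 "\<sigma> + 1"] by (simp add: add.commute)
    moreover have "G (\<sigma> + 5) * G (\<sigma> + 1) = (G (\<sigma> + 3))\<^sup>2"
      by (simp add: exp_\<phi> in_I \<phi>_affine exp_add[symmetric] exp_double[symmetric] algebra_simps)
    moreover have "2 * G (\<sigma> + 5) * G (\<sigma> + 3) * G (\<sigma> + 1) = 2 * (G (\<sigma> + 5) * G (\<sigma> + 1)) * G (\<sigma> + 3)"
      by (simp only: mult_ac)
    ultimately have "2 * (G (\<sigma> + 3))\<^sup>2 * G (\<sigma> + 3) \<le> G (\<sigma> + 3) ^ 3" by (simp only:)
    then have "2 * G (\<sigma> + 3) ^ 3 \<le> G (\<sigma> + 3) ^ 3"
      by (simp only: power2_eq_square power3_eq_cube mult.assoc)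
    moreover have "0 < G (\<sigma> + 3) ^ 3" using I_pos[of "\<sigma> + 3"] in_I by simp
    ultimately show False by simp
  qed
  then have G_eq: "G u = exp (\<alpha> * u + \<beta>)" for u by (simp add: exp_\<phi> \<phi>_affine)
  have "F x = exp \<beta> * x powr \<alpha>" if "0 < x" for x
  proof -
    have "F x = G (ln x)" using that by (simp add: G_def)
    also have "\<dots> = exp \<beta> * x powr \<alpha>" using that by (simp add: G_eq powr_def exp_add)
    finally show ?thesis .
  qed
  then show ?thesis by (intro that[of "exp \<beta>" \<alpha>]) (use \<alpha> in auto)
qed

lemma preserver_classification:
  fixes F :: "real \<Rightarrow> real"
  assumes nn: "\<And>x. 0 \<le> x \<Longrightarrow> 0 \<le> F x" and F0: "F 0 = 0"
    and pff: "\<And>\<Lambda> h. polya_frequency_function \<Lambda> \<Longrightarrow> 0 < h \<Longrightarrow> totally_nonneg (\<lambda>k::int. F (\<Lambda> (h * k)))"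
  shows "(\<forall>x\<ge>0. F x = 0) \<or> (\<exists>c>0. (\<forall>x\<ge>0. F x = c * x) \<or> (\<forall>x\<ge>0. F x = c * (if x > 0 then 1 else 0)))"
proof (rule ccontr)
  assume not: "\<not> ?thesis"
  then obtain x\<^sub>0 where "0 \<le> x\<^sub>0" "F x\<^sub>0 \<noteq> 0" by blast
  then obtain c \<alpha> where c: "0 < c" and \<alpha>: "0 \<le> \<alpha>" and F: "\<And>x. 0 < x \<Longrightarrow> F x = c * x powr \<alpha>"
    using preserver_power[of F, OF nn F0 pff] by blast
  have "\<alpha> \<noteq> 0"
  proof
    assume "\<alpha> = 0"
    then have "\<forall>x\<ge>0. F x = c * (if x > 0 then 1 else 0)" using F F0 by (auto simp: less_le)
    then show False using not c by blast
  qed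
  have "\<alpha> \<noteq> 1"
  proof
    assume "\<alpha> = 1"
    then have "F x = c * x" if "0 \<le> x" for x
      using F[of x] F0 that by (cases "x = 0") auto
    then have "\<forall>x\<ge>0. F x = c * x" by blast
    then show False using not c by blast
  qed
  have F': "F x = c * x powr \<alpha>" if "0 \<le> x" for x
    using F[of x] F0 that by (cases "x = 0") auto
  have scale: "totally_nonneg (\<lambda>k::int. (\<Lambda> (h * k)) powr \<alpha>)"
    if \<Lambda>: "polya_frequency_function \<Lambda>" and h: "0 < h" for \<Lambda> h
  proof -
    have "0 \<le> \<Lambda> x" for x
      using \<Lambda> by (intro totally_nonneg_nonneg) (simp add: polya_frequency_function_def)
    then have "(\<lambda>k::int. (\<Lambda> (h * k)) powr \<alpha>) = (\<lambda>k. 1 / c * F (\<Lambda> (h * k)))"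
      using c by (simp add: F')
    then show ?thesis using totally_nonneg_cmult[OF pff[OF \<Lambda> h], of "1 / c"] c by simp
  qed
  consider "0 < \<alpha>" "\<alpha> < 1" | "1 < \<alpha>" using \<alpha> \<open>\<alpha> \<noteq> 0\<close> \<open>\<alpha> \<noteq> 1\<close> by linarith
  then show False
  proof cases
    case 1
    show ?thesis
    proof (rule powr_less_1_excluded[OF 1])
      show "totally_nonneg (\<lambda>k::int. (if 0 \<le> k then k * exp (- k) else 0) powr \<alpha>)"
        using scale[OF polya_frequency_gamma, of 1] by (simp cong: if_cong)
    qed
  next
    case 2
    show ?thesis
    proof (rule powr_gt_1_excluded[OF 2])
      fix a :: real assume "0 < a"
      from scale[OF polya_frequency_two_exp[OF this], of "ln 2"]
      show "totally_nonneg (\<lambda>k::int. (exp (- a * \<bar>ln 2 * k\<bar>) * (1 + a - a * exp (- \<bar>ln 2 * k\<bar>))) powr \<alpha>)"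
        by simp
    qed
  qed
qed

section \<open>Support indicators and the three classes\<close>

lemma totally_nonneg_support_cases:
  fixes \<Lambda> :: "real \<Rightarrow> real"
  assumes \<Lambda>: "totally_nonneg \<Lambda>" and two: "\<Lambda> s \<noteq> 0" "\<Lambda> t \<noteq> 0" "s < t"
  obtains "\<And>x y. \<Lambda> x \<noteq> 0 \<Longrightarrow> x \<le> y \<Longrightarrow> \<Lambda> y \<noteq> 0" | "\<And>x y. \<Lambda> x \<noteq> 0 \<Longrightarrow> y \<le> x \<Longrightarrow> \<Lambda> y \<noteq> 0"
proof -
  have conv: "\<Lambda> y \<noteq> 0" if "\<Lambda> x \<noteq> 0" "\<Lambda> z \<noteq> 0" "x \<le> y" "y \<le> z" for x y z
    using totally_nonneg_support_convex[OF \<Lambda> that(1,2), of y] that by (cases "y = x \<or> y = z") auto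
  have "(\<forall>M. \<exists>x. M < x \<and> \<Lambda> x \<noteq> 0) \<or> (\<forall>M. \<exists>x. x < M \<and> \<Lambda> x \<noteq> 0)"
  proof (rule ccontr)
    assume "\<not> ?thesis"
    then obtain M N where "\<And>x. \<Lambda> x \<noteq> 0 \<Longrightarrow> x \<le> M" "\<And>x. \<Lambda> x \<noteq> 0 \<Longrightarrow> N \<le> x" by (meson not_le)
    then have "\<bar>x\<bar> \<le> \<bar>M\<bar> + \<bar>N\<bar>" if "\<Lambda> x \<noteq> 0" for x using that by (smt (verit))
    then show False by (rule totally_nonneg_unbounded_support[OF \<Lambda> _ two])
  qed
  then show ?thesis
  proof
    assume up: "\<forall>M. \<exists>x. M < x \<and> \<Lambda> x \<noteq> 0"
    show ?thesis by (rule that(1)) (meson conv up less_imp_le)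
  next
    assume down: "\<forall>M. \<exists>x. x < M \<and> \<Lambda> x \<noteq> 0"
    show ?thesis by (rule that(2)) (meson conv down less_imp_le)
  qed
qed

lemma totally_nonneg_support_indicator:
  fixes \<Lambda> :: "real \<Rightarrow> real"
  assumes \<Lambda>: "totally_nonneg \<Lambda>"
  shows "totally_nonneg (\<lambda>x. if 0 < \<Lambda> x then 1 else 0)"
proof -
  have eq: "(0 < \<Lambda> x) = (\<Lambda> x \<noteq> 0)" for x using totally_nonneg_nonneg[OF \<Lambda>, of x] by auto
  consider s t where "\<Lambda> s \<noteq> 0" "\<Lambda> t \<noteq> 0" "s < t" | p where "\<And>x. \<Lambda> x \<noteq> 0 \<longleftrightarrow> x = p" | "\<And>x. \<Lambda> x = 0"
    by (metis linorder_neqE)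
  then show ?thesis
  proof cases
    case 1
    from \<Lambda> this show ?thesis
    proof (cases rule: totally_nonneg_support_cases)
      case 1
      then have "totally_nonneg (\<lambda>x. if x \<in> {x. \<Lambda> x \<noteq> 0} then exp (- 0 * x) else 0)"
        by (intro totally_nonneg_exp_upset) auto
      then show ?thesis by (simp add: eq cong: if_cong)
    next
      case 2
      then have "totally_nonneg (\<lambda>x. if x \<in> {x. \<Lambda> (- x) \<noteq> 0} then exp (- 0 * x) else 0)"
        by (intro totally_nonneg_exp_upset) auto
      from totally_nonneg_reflect[OF this] show ?thesis by (simp add: eq cong: if_cong)
    qed
  next
    case 2
    then show ?thesis using totally_nonneg_single[of p] by (simp add: eq)
  next
    case 3
    then show ?thesis using totally_nonneg_cmult[OF \<Lambda>, of 0] by simp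
  qed
qed

lemma totally_nonneg_const:
  assumes "0 \<le> c"
  shows "totally_nonneg (\<lambda>x::'a::linordered_ab_group_add. c)"
  unfolding totally_nonneg_def
proof (intro allI impI)
  fix n :: nat
  assume n: "1 \<le> n"
  let ?A = "Matrix.mat n n (\<lambda>(i, j). c)"
  show "0 \<le> Determinant.det ?A"
  proof (cases "n = 1")
    case True
    then show ?thesis using assms by (simp add: det_single)
  next
    case False
    then have "Determinant.det ?A = 0"
      using n by (intro det_identical_columns[where i = 0 and j = 1 and n = n]) auto
    then show ?thesis by simp
  qed
qed

lemma binomial_sequence:
  "shift_sum (shift_sum (\<lambda>k. if k = 0 then 1 else 0)) k = (if k = 1 then 2 else if k = 0 \<or> k = 2 then 1 else 0)"
  by (auto simp: shift_sum_def)

lemma totally_nonneg_comp_linear: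
  assumes "totally_nonneg \<Lambda>" "0 \<le> c" "\<forall>x\<ge>0. F x = c * x"
  shows "totally_nonneg (F \<circ> \<Lambda>)"
proof -
  have "F \<circ> \<Lambda> = (\<lambda>x. c * \<Lambda> x)" using assms(3) totally_nonneg_nonneg[OF assms(1)] by auto
  then show ?thesis using totally_nonneg_cmult[OF assms(1,2)] by simp
qed

lemma totally_nonneg_comp_const:
  assumes "totally_nonneg \<Lambda>" "0 \<le> c" "\<forall>x\<ge>0. F x = c"
  shows "totally_nonneg (F \<circ> \<Lambda>)"
proof -
  have "F \<circ> \<Lambda> = (\<lambda>x. c)" using assms(3) totally_nonneg_nonneg[OF assms(1)] by auto
  then show ?thesis using totally_nonneg_const[OF assms(2)] by simp
qed

lemma totally_nonneg_scaled_single: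
  "0 \<le> c \<Longrightarrow> totally_nonneg (\<lambda>x. c * (if x = 0 then 1 else 0))"
  by (rule totally_nonneg_cmult[OF totally_nonneg_single])

theorem theorem5p4:
  fixes F :: "real \<Rightarrow> real"
  assumes "F \<in> {0..} \<rightarrow> {0..}"
  shows "(preserves F polya_frequency_function \<longleftrightarrow> (\<exists>c>0. \<forall>x\<ge>0. F x = c * x)) \<and>
    (preserves F polya_frequency_sequence \<longleftrightarrow>
      (\<forall>x\<ge>0. F x = 0) \<or>
      (\<exists>c>0. (\<forall>x\<ge>0. F x = c) \<or> (\<forall>x\<ge>0. F x = c * x))) \<and>
    (preserves F (totally_nonneg :: (real \<Rightarrow> real) \<Rightarrow> bool) \<longleftrightarrow>
      (\<forall>x\<ge>0. F x = 0) \<or>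
      (\<exists>c>0. (\<forall>x\<ge>0. F x = c) \<or> (\<forall>x\<ge>0. F x = c * x) \<or>
        (\<forall>x\<ge>0. F x = c * (if x > 0 then 1 else 0))))"
proof (intro conjI)
  have nn: "0 \<le> F x" if "0 \<le> x" for x using assms that by auto
  have seq_of_pff: "totally_nonneg (\<lambda>k::int. \<Lambda> (h * k))"
    if "polya_frequency_function \<Lambda>" "0 < h" for \<Lambda> h
    using totally_nonneg_sample[of \<Lambda> h 0] that by (simp add: polya_frequency_function_def)
  show "preserves F polya_frequency_function \<longleftrightarrow> (\<exists>c>0. \<forall>x\<ge>0. F x = c * x)"
  proof
    assume "\<exists>c>0. \<forall>x\<ge>0. F x = c * x"
    then obtain c where c: "0 < c" "\<forall>x\<ge>0. F x = c * x" by blast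
    show "preserves F polya_frequency_function"
      unfolding preserves_def
    proof (intro allI impI)
      fix \<Lambda> assume \<Lambda>: "polya_frequency_function \<Lambda>"
      then have tn: "totally_nonneg \<Lambda>" by (simp add: polya_frequency_function_def)
      have eq: "F \<circ> \<Lambda> = (\<lambda>x. c * \<Lambda> x)" using c totally_nonneg_nonneg[OF tn] by auto
      show "polya_frequency_function (F \<circ> \<Lambda>)"
        using \<Lambda> c(1) totally_nonneg_cmult[OF tn, of c] unfolding polya_frequency_function_def eq by auto
    qed
  next
    assume P: "preserves F polya_frequency_function"
    have pff: "totally_nonneg (\<lambda>k::int. F (\<Lambda> (h * k)))" if "polya_frequency_function \<Lambda>" "0 < h" for \<Lambda> h
      using P seq_of_pff[of "F \<circ> \<Lambda>" h] that by (simp add: preserves_def)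
    have sym: "polya_frequency_function (\<lambda>x::real. exp (- \<bar>x\<bar>))"
      using polya_frequency_symmetric_exp[of 1] by simp
    have onesided: "polya_frequency_function (\<lambda>x::real. 1 * (if 0 \<le> x then exp (- x) else 0))"
      by (rule polya_frequency_onesided_exp) simp
    have no_const: "\<not> integrable lebesgue (\<lambda>x::real. d)" if "d \<noteq> 0" for d :: real
    proof
      assume "integrable lebesgue (\<lambda>x::real. d)"
      then have "integrable lebesgue (\<lambda>x::real. 1 / d * d)" by (rule integrable_mult_right)
      moreover have "(\<lambda>x::real. 1 / d * d) = indicat_real UNIV" using that by (simp add: fun_eq_iff)
      ultimately have "integrable lebesgue (indicat_real (UNIV :: real set))" by (simp only:)
      then show False by (simp only: integrable_indicator_iff) simp
    qed
    have "F 0 = 0"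
    proof (rule ccontr)
      \<comment> \<open>On x < 0 the one-sided exponential vanishes, so the composition equals
        \<open>F 0\<close> on a ray of infinite measure.\<close>
      assume F0: "F 0 \<noteq> 0"
      have "polya_frequency_function (F \<circ> (\<lambda>x. 1 * (if 0 \<le> x then exp (- x) else 0)))"
        using P onesided unfolding preserves_def by blast
      then have "integrable lebesgue (F \<circ> (\<lambda>x. 1 * (if 0 \<le> x then exp (- x) else 0)))"
        by (simp only: polya_frequency_function_def)
      then have "set_integrable lebesgue {..<0} (F \<circ> (\<lambda>x. 1 * (if 0 \<le> x then exp (- x) else 0)))"
        unfolding set_integrable_def by (rule integrable_mult_indicator[rotated]) simp
      then have "set_integrable lebesgue {..<0} (\<lambda>x::real. F 0)"
        by (rule set_integrable_cong[THEN iffD1, rotated -1]) auto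
      then have "integrable lebesgue (indicator {..<0::real} :: real \<Rightarrow> real)"
        using F0 by (simp add: set_integrable_def)
      then have "emeasure lborel {..<0::real} < \<infinity>" by (simp add: integrable_indicator_iff)
      then obtain n :: nat where n: "emeasure lborel {..<0::real} < of_nat n"
        by (auto dest: ennreal_Ex_less_of_nat)
      have "of_nat n = emeasure lborel {- real n..<0}" by (simp add: ennreal_of_nat_eq_real_of_nat)
      also have "\<dots> \<le> emeasure lborel {..<0::real}" by (intro emeasure_mono) auto
      finally show False using n by simp
    qed
    from preserver_classification[of F, OF nn this pff]
    consider "\<forall>x\<ge>0. F x = 0" | c where "0 < c" "\<forall>x\<ge>0. F x = c * x"
      | c where "0 < c" "\<forall>x\<ge>0. F x = c * (if x > 0 then 1 else 0)" by blast
    then show "\<exists>c>0. \<forall>x\<ge>0. F x = c * x"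
    proof cases
      case 1
      have "polya_frequency_function (F \<circ> (\<lambda>x. exp (- \<bar>x\<bar>)))"
        using P sym unfolding preserves_def by blast
      with 1 show ?thesis by (simp add: polya_frequency_function_def)
    next
      case 2
      then show ?thesis by blast
    next
      case 3
      have "polya_frequency_function (F \<circ> (\<lambda>x. exp (- \<bar>x\<bar>)))"
        using P sym unfolding preserves_def by blast
      then have "integrable lebesgue (F \<circ> (\<lambda>x::real. exp (- \<bar>x\<bar>)))"
        by (simp only: polya_frequency_function_def)
      moreover have "F \<circ> (\<lambda>x::real. exp (- \<bar>x\<bar>)) = (\<lambda>x. c)" using 3 by auto
      ultimately show ?thesis using no_const[of c] 3(1) by simp
    qed
  qed
  \<comment> \<open>Point masses are tested separately: with a single nonzero value they are not
    Polya frequency functions.\<close>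
  have F0_const: "\<exists>c>0. \<forall>x\<ge>0. F x = c"
    if F0: "F 0 \<noteq> 0"
      and pff: "\<And>\<Lambda> h. polya_frequency_function \<Lambda> \<Longrightarrow> 0 < h \<Longrightarrow> totally_nonneg (\<lambda>k::int. F (\<Lambda> (h * k)))"
      and single: "\<And>c. 0 < c \<Longrightarrow> totally_nonneg (\<lambda>k::int. F (c * (if k = 0 then 1 else 0)))"
  proof -
    have "F x = F 0" if "0 \<le> x" for x
    proof (rule preserver_const_if_nonzero_at_0[of F, OF nn F0 _ single that])
      fix c :: real assume "0 < c"
      from pff[OF polya_frequency_onesided_exp[OF this], of 1]
      show "totally_nonneg (\<lambda>k::int. F (c * (if 0 \<le> k then exp (- real_of_int k) else 0)))" by (simp cong: if_cong)
    qed
    moreover have "0 < F 0" using F0 nn[of 0] by simp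
    ultimately show ?thesis by blast
  qed
  show "preserves F polya_frequency_sequence \<longleftrightarrow>
      (\<forall>x\<ge>0. F x = 0) \<or> (\<exists>c>0. (\<forall>x\<ge>0. F x = c) \<or> (\<forall>x\<ge>0. F x = c * x))" (is "_ \<longleftrightarrow> ?R")
  proof
    assume ?R
    then consider "\<forall>x\<ge>0. F x = 0" | c where "0 < c" "\<forall>x\<ge>0. F x = c" | c where "0 < c" "\<forall>x\<ge>0. F x = c * x"
      by blast
    then have "preserves F (totally_nonneg :: (int \<Rightarrow> real) \<Rightarrow> bool)"
    proof cases
      case 1
      then show ?thesis using totally_nonneg_comp_const[OF _ order_refl 1] unfolding preserves_def by blast
    next
      case 2
      then show ?thesis using totally_nonneg_comp_const[OF _ less_imp_le[OF 2(1)] 2(2)] unfolding preserves_def by blast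
    next
      case 3
      then show ?thesis using totally_nonneg_comp_linear[OF _ less_imp_le[OF 3(1)] 3(2)] unfolding preserves_def by blast
    qed
    then show "preserves F polya_frequency_sequence"
      unfolding preserves_def polya_frequency_sequence_def .
  next
    assume "preserves F polya_frequency_sequence"
    then have P: "totally_nonneg (\<lambda>k. F (a k))" if "totally_nonneg a" for a :: "int \<Rightarrow> real"
      using that by (simp add: preserves_def polya_frequency_sequence_def comp_def)
    have pff: "totally_nonneg (\<lambda>k::int. F (\<Lambda> (h * k)))" if "polya_frequency_function \<Lambda>" "0 < h" for \<Lambda> h
      by (rule P[OF seq_of_pff[OF that]])
    show ?R
    proof (cases "F 0 = 0")
      case False
      then show ?thesis using F0_const[OF False pff P[OF totally_nonneg_scaled_single[OF less_imp_le]]] by blast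
    next
      case True
      from preserver_classification[of F, OF nn this pff]
      consider "\<forall>x\<ge>0. F x = 0" | c where "0 < c" "\<forall>x\<ge>0. F x = c * x"
        | c where "0 < c" "\<forall>x\<ge>0. F x = c * (if x > 0 then 1 else 0)" by blast
      then show ?thesis
      proof cases
        case 3
        \<comment> \<open>The coefficients of \<open>(1 + z) ^ 2\<close>. The indicator of their
          support, scaled by \<open>c\<close>, would have to satisfy
          \<open>2 * c ^ 3 \<le> c ^ 3\<close> in the minor of order 3.\<close>
        define b :: "int \<Rightarrow> real" where "b = shift_sum (shift_sum (\<lambda>k. if k = 0 then 1 else 0))"
        have "totally_nonneg b"
          unfolding b_def by (intro totally_nonneg_shift_sum totally_nonneg_single)
        then have "totally_nonneg (\<lambda>k. F (b k))" by (rule P)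
        from totally_nonneg_minor3[OF this] 3
        show ?thesis by (simp add: b_def binomial_sequence power2_eq_square power3_eq_cube)
      qed blast+
    qed
  qed
  show "preserves F (totally_nonneg :: (real \<Rightarrow> real) \<Rightarrow> bool) \<longleftrightarrow>
      (\<forall>x\<ge>0. F x = 0) \<or>
      (\<exists>c>0. (\<forall>x\<ge>0. F x = c) \<or> (\<forall>x\<ge>0. F x = c * x) \<or>
        (\<forall>x\<ge>0. F x = c * (if x > 0 then 1 else 0)))" (is "_ \<longleftrightarrow> ?R")
  proof
    assume ?R
    then consider "\<forall>x\<ge>0. F x = 0" | c where "0 < c" "\<forall>x\<ge>0. F x = c" | c where "0 < c" "\<forall>x\<ge>0. F x = c * x"
      | c where "0 < c" "\<forall>x\<ge>0. F x = c * (if x > 0 then 1 else 0)"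
      by blast
    then show "preserves F (totally_nonneg :: (real \<Rightarrow> real) \<Rightarrow> bool)"
    proof cases
      case 1
      then show ?thesis using totally_nonneg_comp_const[OF _ order_refl 1] unfolding preserves_def by blast
    next
      case 2
      then show ?thesis using totally_nonneg_comp_const[OF _ less_imp_le[OF 2(1)] 2(2)] unfolding preserves_def by blast
    next
      case 3
      then show ?thesis using totally_nonneg_comp_linear[OF _ less_imp_le[OF 3(1)] 3(2)] unfolding preserves_def by blast
    next
      case 4
      show ?thesis
        unfolding preserves_def
      proof (intro allI impI)
        fix \<Lambda> :: "real \<Rightarrow> real" assume \<Lambda>: "totally_nonneg \<Lambda>"
        have "F \<circ> \<Lambda> = (\<lambda>x. c * (if 0 < \<Lambda> x then 1 else 0))"
          using 4(2) totally_nonneg_nonneg[OF \<Lambda>] by (simp add: fun_eq_iff)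
        then show "totally_nonneg (F \<circ> \<Lambda>)"
          using totally_nonneg_cmult[OF totally_nonneg_support_indicator[OF \<Lambda>], of c] 4(1) by simp
      qed
    qed
  next
    assume P: "preserves F (totally_nonneg :: (real \<Rightarrow> real) \<Rightarrow> bool)"
    have sample: "totally_nonneg (\<lambda>k::int. F (\<Lambda> (h * k)))" if "totally_nonneg \<Lambda>" "0 < h" for \<Lambda> :: "real \<Rightarrow> real" and h
      using totally_nonneg_sample[of "F \<circ> \<Lambda>" h 0] P that by (simp add: preserves_def)
    have pff: "totally_nonneg (\<lambda>k::int. F (\<Lambda> (h * k)))" if "polya_frequency_function \<Lambda>" "0 < h" for \<Lambda> h
      using sample that by (simp add: polya_frequency_function_def)
    show ?R
    proof (cases "F 0 = 0")
      case False
      have "totally_nonneg (\<lambda>k::int. F (c * (if k = 0 then 1 else 0)))" if "0 < c" for c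
        using sample[OF totally_nonneg_scaled_single, of c 1] that by (simp cong: if_cong)
      then show ?thesis using F0_const[OF False pff] by blast
    next
      case True
      from preserver_classification[of F, OF nn this pff] show ?thesis by blast
    qed
  qed
qed

end
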